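(* Let $M,\widehat M$ be oriented connected $n$-dimensional Riemannian manifolds. A curve $q(t)$ in $Q$ is an intrinsic rolling of $M$ on $\widehat M$ if and only if it is a horizontal curve with respect to the distribution $D$ defined by $$D_q=\{X_0+qX_0+\mathcal V(X_0)(q)\ :\ X_0\in T_xM\},\qquad q\in Q_x .$$
   Context: $Q=\{q\in\mathrm{Isom}_0^+(T_xM,T_{\widehat x}\widehat M): x\in M,\widehat x\in\widehat M\}$, where $\mathrm{Isom}_0^+$ denotes linear orientation preserving isometries; it is a bundle over $M\times\widehat M$ with fiber diffeomorphic to $\mathrm{SO}(n)$, and $Q_x$ is the set of elements over $x\in M$. $\nabla$ is the Levi-Civita connection on $M$ or $\widehat M$. A vector field along an absolutely continuous curve is parallel if it is absolutely continuous and its covariant derivative vanishes a.e. An intrinsic rolling is an absolutely continuous curve $q:[0,\tau]\to Q$ such that, with $x(t),\widehat x(t)$ its projections to $M,\widehat M$: (I') $\dot{\widehat x}(t)=q(t)\dot x(t)$ for almost all $t$; (II') a tangent field $Z(t)$ is parallel along $x(t)$ if and only if $q(t)Z(t)$ is parallel along $\widehat x(t)$. A curve is horizontal with respect to a distribution (smooth subbundle of the tangent bundle) if it is absolutely continuous and its derivative lies in the distribution for almost every $t$. Local description of $D$: let $U\subset M$, $\widehat U\subset\widehat M$ be open sets with positively oriented orthonormal frames $\{e_j\}$ of $TM|_U$ and $\{\hat e_i\}$ of $T\widehat M|_{\widehat U}$. They give a trivialization $q\mapsto(x,\widehat x,A)\in U\times\widehat U\times\mathrm{SO}(n)$, $A=(a_{ij})=(\langle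 qe_j,\hat e_i\rangle)$, under which the tangent space splits as $TU\times T\widehat U\times T\mathrm{SO}(n)$; $X_0$ and $qX_0$ are regarded as elements of $TU$ and $T\widehat U$ in this splitting, and $$\mathcal V(X_0)(q)=\sum_{i<j}(\langle\nabla_{X_0}e_j,e_i\rangle-\langle\nabla_{qX_0}qe_j,qe_i\rangle)W_{ij}(A),\qquad W_{ij}(A)=\sum_r\left(a_{ri}\frac{\partial}{\partial a_{rj}}-a_{rj}\frac{\partial}{\partial a_{ri}}\right),$$ where for fixed $q$ the symbol $qe_j$ stands for the local field $\sum_s a_{sj}\hat e_s$ on $\widehat U$ with constant coefficients. The subspace $D_q$ is given by these formulas in any such trivialization. *)

theory Defs
  imports "HOL-Analysis.Analysis" "HOL-Library.Function_Algebras" "HOL-Library.FuncSet"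
begin

section \<open>Smooth and absolutely continuous maps in normed spaces\<close>

text \<open>The set \<^term>\<open>S\<close> is always open below, so that the total derivative is unambiguous.\<close>

primrec Ck_on :: "nat \<Rightarrow> 'a::real_normed_vector set \<Rightarrow> ('a \<Rightarrow> 'b::real_normed_vector) \<Rightarrow> bool" where
  "Ck_on 0 S f \<longleftrightarrow> continuous_on S f"
| "Ck_on (Suc k) S f \<longleftrightarrow>
     (\<forall>x\<in>S. f differentiable (at x)) \<and> (\<forall>v. Ck_on k S (\<lambda>x. frechet_derivative f (at x) v))"

definition smooth_on :: "'a::real_normed_vector set \<Rightarrow> ('a \<Rightarrow> 'b::real_normed_vector) \<Rightarrow> bool" where
  "smooth_on S f \<longleftrightarrow> (\<forall>k. Ck_on k S f)"

definition abs_continuous_on :: "real \<Rightarrow> real \<Rightarrow> (real \<Rightarrow> 'a::metric_space) \<Rightarrow> bool" where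
  "abs_continuous_on a b f \<longleftrightarrow>
     (\<forall>\<epsilon>>0. \<exists>\<delta>>0. \<forall>D :: (real \<times> real) set.
        finite D \<longrightarrow>
        (\<forall>(s, t)\<in>D. a \<le> s \<and> s \<le> t \<and> t \<le> b) \<longrightarrow>
        pairwise (\<lambda>(s, t) (s', t'). {s<..<t} \<inter> {s'<..<t'} = {}) D \<longrightarrow>
        (\<Sum>(s, t)\<in>D. t - s) < \<delta> \<longrightarrow>
        (\<Sum>(s, t)\<in>D. dist (f s) (f t)) < \<epsilon>)"


section \<open>Oriented Riemannian manifolds\<close>

text \<open>
  The points of a manifold are all elements of a Hausdorff, second countable type \<^typ>\<open>'a\<close>, and its
  dimension is the cardinality of the index type \<^typ>\<open>'n\<close>. A chart is a domain together with a map;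
  the values of the map outside the domain are irrelevant.

  A tangent vector at \<open>x\<close> is represented by the family of its components in all charts around \<open>x\<close>,
  related by the derivatives of the transition maps; the components in all other charts are \<open>0\<close>.
  The zero vector is then the same object at every point, so base points are always carried along
  explicitly.
\<close>

type_synonym ('a, 'n) chart = "'a set \<times> ('a \<Rightarrow> real ^ 'n)"
type_synonym ('a, 'n) tvec = "('a, 'n) chart \<Rightarrow> real ^ 'n"

record ('a, 'n) manifold =
  charts :: "('a, 'n) chart set"
  rmetric :: "'a \<Rightarrow> ('a, 'n) tvec \<Rightarrow> ('a, 'n) tvec \<Rightarrow> real"

abbreviation chart_dom :: "('a, 'n) chart \<Rightarrow> 'a set" where
  "chart_dom \<equiv> fst"

abbreviation chart_map :: "('a, 'n) chart \<Rightarrow> 'a \<Rightarrow> real ^ 'n" where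
  "chart_map \<equiv> snd"

definition chart_inv :: "('a, 'n) chart \<Rightarrow> real ^ 'n \<Rightarrow> 'a" where
  "chart_inv c = inv_into (chart_dom c) (chart_map c)"

definition transition :: "('a, 'n) chart \<Rightarrow> ('a, 'n) chart \<Rightarrow> real ^ 'n \<Rightarrow> real ^ 'n" where
  "transition c c' = chart_map c' \<circ> chart_inv c"

definition charts_at :: "('a, 'n) manifold \<Rightarrow> 'a \<Rightarrow> ('a, 'n) chart set" where
  "charts_at M x = {c \<in> charts M. x \<in> chart_dom c}"

definition tscale :: "real \<Rightarrow> ('a, 'n::finite) tvec \<Rightarrow> ('a, 'n) tvec"  (infixr \<open>*\<^sub>T\<close> 75) where
  "a *\<^sub>T v = (\<lambda>c. a *\<^sub>R v c)"

definition tangent_space :: "('a, 'n::finite) manifold \<Rightarrow> 'a \<Rightarrow> ('a, 'n) tvec set" where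
  "tangent_space M x =
     {v. (\<forall>c\<in>charts_at M x. \<forall>c'\<in>charts_at M x.
            v c' = frechet_derivative (transition c c') (at (chart_map c x)) (v c)) \<and>
         (\<forall>c. c \<notin> charts_at M x \<longrightarrow> v c = 0)}"

text \<open>The tangent vector at \<open>x\<close> with components \<open>w\<close> in the chart \<open>c\<close>, and the coordinate fields.\<close>

definition coord_vec :: "('a, 'n::finite) manifold \<Rightarrow> ('a, 'n) chart \<Rightarrow> 'a \<Rightarrow> real ^ 'n \<Rightarrow> ('a, 'n) tvec" where
  "coord_vec M c x w =
     (\<lambda>c'. if c' \<in> charts_at M x
           then frechet_derivative (transition c c') (at (chart_map c x)) w else 0)"

definition coord_field :: "('a, 'n::finite) manifold \<Rightarrow> ('a, 'n) chart \<Rightarrow> 'n \<Rightarrow> 'a \<Rightarrow> ('a, 'n) tvec" where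
  "coord_field M c j = (\<lambda>x. coord_vec M c x (axis j 1))"

definition oriented_smooth_manifold :: "('a::topological_space, 'n::finite) manifold \<Rightarrow> bool" where
  "oriented_smooth_manifold M \<longleftrightarrow>
     (\<Union>c\<in>charts M. chart_dom c) = UNIV \<and>
     (\<forall>c\<in>charts M. open (chart_dom c) \<and> open (chart_map c ` chart_dom c) \<and>
        homeomorphism (chart_dom c) (chart_map c ` chart_dom c) (chart_map c) (chart_inv c)) \<and>
     (\<forall>c\<in>charts M. \<forall>c'\<in>charts M.
        smooth_on (chart_map c ` (chart_dom c \<inter> chart_dom c')) (transition c c') \<and>
        (\<forall>p \<in> chart_map c ` (chart_dom c \<inter> chart_dom c').
           det (matrix (frechet_derivative (transition c c') (at p))) > 0))"

definition riemannian_metric :: "('a, 'n::finite) manifold \<Rightarrow> bool" where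
  "riemannian_metric M \<longleftrightarrow>
     (\<forall>x. \<forall>u\<in>tangent_space M x. \<forall>v\<in>tangent_space M x. \<forall>w\<in>tangent_space M x. \<forall>a b.
        rmetric M x (a *\<^sub>T u + b *\<^sub>T v) w = a * rmetric M x u w + b * rmetric M x v w) \<and>
     (\<forall>x. \<forall>v\<in>tangent_space M x. \<forall>w\<in>tangent_space M x. rmetric M x v w = rmetric M x w v) \<and>
     (\<forall>x. \<forall>v\<in>tangent_space M x. v \<noteq> 0 \<longrightarrow> rmetric M x v v > 0) \<and>
     (\<forall>c\<in>charts M. \<forall>i j. smooth_on (chart_map c ` chart_dom c)
        (\<lambda>p. rmetric M (chart_inv c p) (coord_field M c i (chart_inv c p)) (coord_field M c j (chart_inv c p))))"

definition oriented_riemannian_manifold :: "('a::topological_space, 'n::finite) manifold \<Rightarrow> bool" where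
  "oriented_riemannian_manifold M \<longleftrightarrow> oriented_smooth_manifold M \<and> riemannian_metric M"


section \<open>Functions, vector fields and frames\<close>

definition smooth_function_on :: "('a, 'n::finite) manifold \<Rightarrow> 'a set \<Rightarrow> ('a \<Rightarrow> real) \<Rightarrow> bool" where
  "smooth_function_on M U f \<longleftrightarrow>
     (\<forall>c\<in>charts M. smooth_on (chart_map c ` (U \<inter> chart_dom c)) (f \<circ> chart_inv c))"

definition smooth_field_on :: "('a, 'n::finite) manifold \<Rightarrow> 'a set \<Rightarrow> ('a \<Rightarrow> ('a, 'n) tvec) \<Rightarrow> bool" where
  "smooth_field_on M U Y \<longleftrightarrow>
     (\<forall>x\<in>U. Y x \<in> tangent_space M x) \<and>
     (\<forall>c\<in>charts M. smooth_on (chart_map c ` (U \<inter> chart_dom c)) (\<lambda>p. Y (chart_inv c p) c))"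

text \<open>The derivative \<open>v f\<close> of a function in direction of a tangent vector at \<open>x\<close>; it does not depend on the chart.\<close>

definition dir_deriv :: "('a, 'n::finite) manifold \<Rightarrow> 'a \<Rightarrow> ('a, 'n) tvec \<Rightarrow> ('a \<Rightarrow> real) \<Rightarrow> real" where
  "dir_deriv M x v f =
     (let c = (SOME c. c \<in> charts_at M x)
      in frechet_derivative (f \<circ> chart_inv c) (at (chart_map c x)) (v c))"

definition lie_bracket ::
  "('a, 'n::finite) manifold \<Rightarrow> ('a \<Rightarrow> ('a, 'n) tvec) \<Rightarrow> ('a \<Rightarrow> ('a, 'n) tvec) \<Rightarrow> 'a \<Rightarrow> ('a, 'n) tvec" where
  "lie_bracket M X Y x =
     (\<lambda>c. if c \<in> charts_at M x
          then frechet_derivative (\<lambda>p. Y (chart_inv c p) c) (at (chart_map c x)) (X x c)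
             - frechet_derivative (\<lambda>p. X (chart_inv c p) c) (at (chart_map c x)) (Y x c)
          else 0)"

definition positive_basis :: "('a, 'n::finite) manifold \<Rightarrow> 'a \<Rightarrow> ('n \<Rightarrow> ('a, 'n) tvec) \<Rightarrow> bool" where
  "positive_basis M x b \<longleftrightarrow>
     (\<forall>j. b j \<in> tangent_space M x) \<and>
     (\<forall>c\<in>charts_at M x. det ((\<chi> i j. b j c $ i) :: real ^ 'n ^ 'n) > 0)"

definition positive_orthonormal_frame ::
  "('a::topological_space, 'n::finite) manifold \<Rightarrow> 'a set \<Rightarrow> ('n \<Rightarrow> 'a \<Rightarrow> ('a, 'n) tvec) \<Rightarrow> bool" where
  "positive_orthonormal_frame M U e \<longleftrightarrow>
     open U \<and> (\<forall>j. smooth_field_on M U (e j)) \<and>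
     (\<forall>x\<in>U. positive_basis M x (\<lambda>j. e j x)) \<and>
     (\<forall>x\<in>U. \<forall>i j. rmetric M x (e i x) (e j x) = (if i = j then 1 else 0))"


section \<open>The Levi-Civita connection\<close>

text \<open>
  \<open>nabla x v Y\<close> is the covariant derivative at \<open>x\<close>, in direction \<open>v\<close>, of a vector field \<open>Y\<close> which
  is smooth on some neighbourhood of \<open>x\<close>. Since \<open>nabla\<close> takes local fields as arguments,
  dependence on the germ only is part of the definition.
\<close>

type_synonym ('a, 'n) connection = "'a \<Rightarrow> ('a, 'n) tvec \<Rightarrow> ('a \<Rightarrow> ('a, 'n) tvec) \<Rightarrow> ('a, 'n) tvec"

definition affine_connection ::
  "('a::topological_space, 'n::finite) manifold \<Rightarrow> ('a, 'n) connection \<Rightarrow> bool" where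
  "affine_connection M nabla \<longleftrightarrow>
     (\<forall>U Y. open U \<and> smooth_field_on M U Y \<longrightarrow>
        (\<forall>x\<in>U. \<forall>v\<in>tangent_space M x.
           nabla x v Y \<in> tangent_space M x \<and>
           (\<forall>w\<in>tangent_space M x. \<forall>a b.
              nabla x (a *\<^sub>T v + b *\<^sub>T w) Y = a *\<^sub>T nabla x v Y + b *\<^sub>T nabla x w Y) \<and>
           (\<forall>Y'. smooth_field_on M U Y' \<longrightarrow>
              nabla x v (\<lambda>y. Y y + Y' y) = nabla x v Y + nabla x v Y') \<and>
           (\<forall>f. smooth_function_on M U f \<longrightarrow>
              nabla x v (\<lambda>y. f y *\<^sub>T Y y) = dir_deriv M x v f *\<^sub>T Y x + f x *\<^sub>T nabla x v Y) \<and>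
           (\<forall>Y'. (\<forall>y\<in>U. Y' y = Y y) \<longrightarrow> nabla x v Y' = nabla x v Y)) \<and>
        (\<forall>X. smooth_field_on M U X \<longrightarrow> smooth_field_on M U (\<lambda>x. nabla x (X x) Y)))"

definition torsion_free ::
  "('a::topological_space, 'n::finite) manifold \<Rightarrow> ('a, 'n) connection \<Rightarrow> bool" where
  "torsion_free M nabla \<longleftrightarrow>
     (\<forall>U X Y. open U \<and> smooth_field_on M U X \<and> smooth_field_on M U Y \<longrightarrow>
        (\<forall>x\<in>U. nabla x (X x) Y = nabla x (Y x) X + lie_bracket M X Y x))"

definition metric_compatible ::
  "('a::topological_space, 'n::finite) manifold \<Rightarrow> ('a, 'n) connection \<Rightarrow> bool" where
  "metric_compatible M nabla \<longleftrightarrow>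
     (\<forall>U Y Z. open U \<and> smooth_field_on M U Y \<and> smooth_field_on M U Z \<longrightarrow>
        (\<forall>x\<in>U. \<forall>v\<in>tangent_space M x.
           dir_deriv M x v (\<lambda>y. rmetric M y (Y y) (Z y)) =
             rmetric M x (nabla x v Y) (Z x) + rmetric M x (Y x) (nabla x v Z)))"

definition levi_civita ::
  "('a::topological_space, 'n::finite) manifold \<Rightarrow> ('a, 'n) connection \<Rightarrow> bool" where
  "levi_civita M nabla \<longleftrightarrow>
     affine_connection M nabla \<and> torsion_free M nabla \<and> metric_compatible M nabla"


section \<open>Absolutely continuous curves and parallel fields\<close>

text \<open>
  Curves are functions on \<^typ>\<open>real\<close> of which only the restriction to \<open>{0..\<tau>}\<close> matters. A curve in a
  manifold is absolutely continuous if it is continuous and absolutely continuous in every chart on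
  every interval that it maps into the chart domain; velocities then exist almost everywhere.
\<close>

definition ac_curve :: "('a::topological_space, 'n::finite) manifold \<Rightarrow> real \<Rightarrow> (real \<Rightarrow> 'a) \<Rightarrow> bool" where
  "ac_curve M \<tau> x \<longleftrightarrow>
     continuous_on {0..\<tau>} x \<and>
     (\<forall>c\<in>charts M. \<forall>a b. 0 \<le> a \<and> a \<le> b \<and> b \<le> \<tau> \<and> x ` {a..b} \<subseteq> chart_dom c \<longrightarrow>
        abs_continuous_on a b (\<lambda>t. chart_map c (x t)))"

definition velocity :: "('a, 'n::finite) manifold \<Rightarrow> (real \<Rightarrow> 'a) \<Rightarrow> real \<Rightarrow> ('a, 'n) tvec" where
  "velocity M x t =
     (\<lambda>c. if c \<in> charts_at M (x t) then vector_derivative (\<lambda>s. chart_map c (x s)) (at t) else 0)"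

definition field_along :: "('a, 'n::finite) manifold \<Rightarrow> real \<Rightarrow> (real \<Rightarrow> 'a) \<Rightarrow> (real \<Rightarrow> ('a, 'n) tvec) \<Rightarrow> bool" where
  "field_along M \<tau> x Z \<longleftrightarrow> (\<forall>t\<in>{0..\<tau>}. Z t \<in> tangent_space M (x t))"

definition ac_field_along ::
  "('a, 'n::finite) manifold \<Rightarrow> real \<Rightarrow> (real \<Rightarrow> 'a) \<Rightarrow> (real \<Rightarrow> ('a, 'n) tvec) \<Rightarrow> bool" where
  "ac_field_along M \<tau> x Z \<longleftrightarrow>
     field_along M \<tau> x Z \<and>
     (\<forall>c\<in>charts M. \<forall>a b. 0 \<le> a \<and> a \<le> b \<and> b \<le> \<tau> \<and> x ` {a..b} \<subseteq> chart_dom c \<longrightarrow>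
        abs_continuous_on a b (\<lambda>t. Z t c))"

text \<open>
  With \<open>Z = \<Sum>\<^sub>j z\<^sub>j \<partial>\<^sub>j\<close> in a chart, the covariant derivative along \<open>x\<close> is
  \<open>\<Sum>\<^sub>j (z\<^sub>j' \<partial>\<^sub>j + z\<^sub>j \<nabla>\<^bsub>x'\<^esub> \<partial>\<^sub>j)\<close>.
\<close>

definition cov_deriv ::
  "('a, 'n::finite) manifold \<Rightarrow> ('a, 'n) connection \<Rightarrow> (real \<Rightarrow> 'a) \<Rightarrow> (real \<Rightarrow> ('a, 'n) tvec) \<Rightarrow> real \<Rightarrow> ('a, 'n) tvec" where
  "cov_deriv M nabla x Z t =
     (\<lambda>c. if c \<in> charts_at M (x t)
          then vector_derivative (\<lambda>s. Z s c) (at t)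
             + (\<Sum>j\<in>UNIV. (Z t c $ j) *\<^sub>R nabla (x t) (velocity M x t) (coord_field M c j) c)
          else 0)"

definition parallel_along ::
  "('a, 'n::finite) manifold \<Rightarrow> ('a, 'n) connection \<Rightarrow> real \<Rightarrow> (real \<Rightarrow> 'a) \<Rightarrow> (real \<Rightarrow> ('a, 'n) tvec) \<Rightarrow> bool" where
  "parallel_along M nabla \<tau> x Z \<longleftrightarrow>
     ac_field_along M \<tau> x Z \<and> (AE t\<in>{0..\<tau>} in lebesgue. cov_deriv M nabla x Z t = 0)"


section \<open>The configuration space and rolling\<close>

type_synonym ('a, 'b, 'n) config = "'a \<times> 'b \<times> (('a, 'n) tvec \<Rightarrow> ('b, 'n) tvec)"

abbreviation base1 :: "('a, 'b, 'n) config \<Rightarrow> 'a" where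
  "base1 \<equiv> fst"

abbreviation base2 :: "('a, 'b, 'n) config \<Rightarrow> 'b" where
  "base2 q \<equiv> fst (snd q)"

abbreviation qmap :: "('a, 'b, 'n) config \<Rightarrow> ('a, 'n) tvec \<Rightarrow> ('b, 'n) tvec" where
  "qmap q \<equiv> snd (snd q)"

text \<open>
  The maps are required to be extensional, so that an element of the configuration space is determined
  by its base points and its values on the tangent space.
\<close>

definition config_space ::
  "('a, 'n::finite) manifold \<Rightarrow> ('b, 'n) manifold \<Rightarrow> ('a, 'b, 'n) config set" where
  "config_space M N =
     {(x, y, L).
        L \<in> tangent_space M x \<rightarrow>\<^sub>E tangent_space N y \<and>
        (\<forall>v\<in>tangent_space M x. \<forall>w\<in>tangent_space M x. \<forall>a b.
           L (a *\<^sub>T v + b *\<^sub>T w) = a *\<^sub>T L v + b *\<^sub>T L w) \<and>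
        (\<forall>v\<in>tangent_space M x. \<forall>w\<in>tangent_space M x. rmetric N y (L v) (L w) = rmetric M x v w) \<and>
        (\<forall>b. positive_basis M x b \<longrightarrow> positive_basis N y (\<lambda>j. L (b j)))}"

record ('a, 'b, 'n) triv =
  dom1 :: "'a set"
  frame1 :: "'n \<Rightarrow> 'a \<Rightarrow> ('a, 'n) tvec"
  dom2 :: "'b set"
  frame2 :: "'n \<Rightarrow> 'b \<Rightarrow> ('b, 'n) tvec"

definition trivializations ::
  "('a::topological_space, 'n::finite) manifold \<Rightarrow> ('b::topological_space, 'n) manifold \<Rightarrow> ('a, 'b, 'n) triv set" where
  "trivializations M N =
     {T. positive_orthonormal_frame M (dom1 T) (frame1 T) \<and> positive_orthonormal_frame N (dom2 T) (frame2 T)}"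

definition trivs_at ::
  "('a::topological_space, 'n::finite) manifold \<Rightarrow> ('b::topological_space, 'n) manifold \<Rightarrow>
   ('a, 'b, 'n) config \<Rightarrow> ('a, 'b, 'n) triv set" where
  "trivs_at M N q = {T \<in> trivializations M N. base1 q \<in> dom1 T \<and> base2 q \<in> dom2 T}"

definition triv_matrix ::
  "('b, 'n::finite) manifold \<Rightarrow> ('a, 'b, 'n) triv \<Rightarrow> ('a, 'b, 'n) config \<Rightarrow> real ^ 'n ^ 'n" where
  "triv_matrix N T q =
     (\<chi> i j. rmetric N (base2 q) (qmap q (frame1 T j (base1 q))) (frame2 T i (base2 q)))"

definition ac_config_curve ::
  "('a::topological_space, 'n::finite) manifold \<Rightarrow> ('b::topological_space, 'n) manifold \<Rightarrow> real \<Rightarrow>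
   (real \<Rightarrow> ('a, 'b, 'n) config) \<Rightarrow> bool" where
  "ac_config_curve M N \<tau> q \<longleftrightarrow>
     q ` {0..\<tau>} \<subseteq> config_space M N \<and>
     ac_curve M \<tau> (\<lambda>t. base1 (q t)) \<and> ac_curve N \<tau> (\<lambda>t. base2 (q t)) \<and>
     (\<forall>T\<in>trivializations M N. \<forall>a b.
        0 \<le> a \<and> a \<le> b \<and> b \<le> \<tau> \<and> (\<forall>t\<in>{a..b}. base1 (q t) \<in> dom1 T \<and> base2 (q t) \<in> dom2 T) \<longrightarrow>
        abs_continuous_on a b (\<lambda>t. triv_matrix N T (q t)))"

definition intrinsic_rolling ::
  "('a::topological_space, 'n::finite) manifold \<Rightarrow> ('b::topological_space, 'n) manifold \<Rightarrow>
   ('a, 'n) connection \<Rightarrow> ('b, 'n) connection \<Rightarrow> real \<Rightarrow> (real \<Rightarrow> ('a, 'b, 'n) config) \<Rightarrow> bool" where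
  "intrinsic_rolling M N nablaM nablaN \<tau> q \<longleftrightarrow>
     ac_config_curve M N \<tau> q \<and>
     (AE t\<in>{0..\<tau>} in lebesgue.
        velocity N (\<lambda>s. base2 (q s)) t = qmap (q t) (velocity M (\<lambda>s. base1 (q s)) t)) \<and>
     (\<forall>Z. field_along M \<tau> (\<lambda>t. base1 (q t)) Z \<longrightarrow>
        (parallel_along M nablaM \<tau> (\<lambda>t. base1 (q t)) Z \<longleftrightarrow>
         parallel_along N nablaN \<tau> (\<lambda>t. base2 (q t)) (\<lambda>t. qmap (q t) (Z t))))"


section \<open>The rolling distribution\<close>

text \<open>
  In the trivialization given by a pair of frames, the tangent space of the configuration space splits,
  and a tangent vector becomes a triple consisting of tangent vectors of the two manifolds and a matrix
  tangent to the rotation group. As for the manifolds themselves, a tangent vector at \<open>q\<close> is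
  represented by the family of these triples over all trivializations around \<open>q\<close>.
\<close>

type_synonym ('a, 'b, 'n) qvec =
  "('a, 'b, 'n) triv \<Rightarrow> ('a, 'n) tvec \<times> ('b, 'n) tvec \<times> (real ^ 'n ^ 'n)"

definition config_velocity ::
  "('a::topological_space, 'n::finite) manifold \<Rightarrow> ('b::topological_space, 'n) manifold \<Rightarrow>
   (real \<Rightarrow> ('a, 'b, 'n) config) \<Rightarrow> real \<Rightarrow> ('a, 'b, 'n) qvec" where
  "config_velocity M N q t =
     (\<lambda>T\<in>trivs_at M N (q t).
        (velocity M (\<lambda>s. base1 (q s)) t,
         velocity N (\<lambda>s. base2 (q s)) t,
         vector_derivative (\<lambda>s. triv_matrix N T (q s)) (at t)))"

text \<open>The matrix unit \<open>\<partial>/\<partial>a\<^bsub>ij\<^esub>\<close>.\<close>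

definition mat_unit :: "'n \<Rightarrow> 'n \<Rightarrow> real ^ 'n ^ 'n::finite" where
  "mat_unit i j = axis i (axis j 1)"

definition Wfield :: "'n::finite \<Rightarrow> 'n \<Rightarrow> real ^ 'n ^ 'n \<Rightarrow> real ^ 'n ^ 'n" where
  "Wfield i j A = (\<Sum>r\<in>UNIV. (A $ r $ i) *\<^sub>R mat_unit r j - (A $ r $ j) *\<^sub>R mat_unit r i)"

text \<open>The local field \<open>q e\<^sub>j\<close> with constant coefficients in the second frame.\<close>

definition transported_frame ::
  "('b, 'n::finite) manifold \<Rightarrow> ('a, 'b, 'n) triv \<Rightarrow> ('a, 'b, 'n) config \<Rightarrow> 'n \<Rightarrow> 'b \<Rightarrow> ('b, 'n) tvec" where
  "transported_frame N T q j = (\<lambda>y. \<Sum>s\<in>UNIV. (triv_matrix N T q $ s $ j) *\<^sub>T frame2 T s y)"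

definition vertical_part ::
  "('a, 'n::{finite, linorder}) manifold \<Rightarrow> ('b, 'n) manifold \<Rightarrow> ('a, 'n) connection \<Rightarrow> ('b, 'n) connection \<Rightarrow>
   ('a, 'b, 'n) triv \<Rightarrow> ('a, 'b, 'n) config \<Rightarrow> ('a, 'n) tvec \<Rightarrow> ((real, 'n) vec, 'n) vec" where
  "vertical_part M N nablaM nablaN T q X =
     (let x = base1 q; y = base2 q in
      \<Sum>(i, j) | i < j.
        (rmetric M x (nablaM x X (frame1 T j)) (frame1 T i x)
         - rmetric N y (nablaN y (qmap q X) (transported_frame N T q j)) (transported_frame N T q i y))
        *\<^sub>R Wfield i j (triv_matrix N T q))"

definition rolling_distribution ::
  "('a::topological_space, 'n::{finite, linorder}) manifold \<Rightarrow> ('b::topological_space, 'n) manifold \<Rightarrow>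
   ('a, 'n) connection \<Rightarrow> ('b, 'n) connection \<Rightarrow> ('a, 'b, 'n) config \<Rightarrow> ('a, 'b, 'n) qvec set" where
  "rolling_distribution M N nablaM nablaN q =
     {(\<lambda>T\<in>trivs_at M N q. (X, qmap q X, vertical_part M N nablaM nablaN T q X)) |X.
        X \<in> tangent_space M (base1 q)}"

definition horizontal_curve ::
  "('a::topological_space, 'n::finite) manifold \<Rightarrow> ('b::topological_space, 'n) manifold \<Rightarrow>
   (('a, 'b, 'n) config \<Rightarrow> ('a, 'b, 'n) qvec set) \<Rightarrow> real \<Rightarrow> (real \<Rightarrow> ('a, 'b, 'n) config) \<Rightarrow> bool" where
  "horizontal_curve M N D \<tau> q \<longleftrightarrow>
     ac_config_curve M N \<tau> q \<and>
     (AE t\<in>{0..\<tau>} in lebesgue. config_velocity M N q t \<in> D (q t))"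

end

theory Submission
  imports Defs
begin

text \<open>
  In a pair of orthonormal frames, a configuration curve becomes a curve \<open>A(t)\<close> of rotations and a field
  along the first curve becomes a coordinate curve \<open>z(t)\<close>. Writing \<open>\<Omega>\<close> and \<open>\<Psi>\<close> for the skew connection
  matrices of the two frames in the directions of the two velocities, the covariant derivatives of the
  field and of its image have coordinates \<open>w = z' + \<Omega> z\<close> and \<open>A w + (A' - (A \<Omega> - \<Psi> A)) z\<close>, and
  \<open>A \<Omega> - \<Psi> A\<close> is the vertical part of the rolling distribution. So horizontality makes the curve carry
  parallel fields to parallel fields. Conversely, the first curve has a parallel frame; evaluating the
  formula on it almost everywhere forces \<open>A' = A \<Omega> - \<Psi> A\<close>, in all trivializations at once.

  The frame is obtained by solving a linear equation with merely integrable coefficients, and everything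
  rests on the almost everywhere differentiability of absolutely continuous functions. The latter are
  shown to be indefinite integrals: the positive variation reduces this to monotone functions, where
  the Radon-Nikodym theorem applies to the Stieltjes measure.
\<close>

section \<open>Absolutely continuous functions\<close>

text \<open>Two quantifiers resist almost everywhere arguments. The velocity of a configuration
  curve is a family over all trivializations, of which there are uncountably many, so their
  exceptional null sets cannot simply be united: differentiability is obtained in one trivialization
  around almost every time and carried, at that fixed time, to all others by smooth changes of
  frames. Condition (II') quantifies over all fields, but at a given time it must determine the
  whole matrix \<open>A'\<close>; the finitely many fields of one parallel frame on all of
  \<open>{0..\<tau>}\<close> have a common null set and are enough vectors. This frame stays
  independent because on short intervals the fundamental matrix is close to the identity, and the
  pieces are joined by bisection. Since \<open>vector_derivative\<close> and
  \<open>frechet_derivative\<close> are choices, coordinate formulas are stated only at times where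
  differentiability is known. The equivalence in (II') also covers fields that are not absolutely
  continuous: there both sides fail, because an absolutely continuous curve of orthogonal matrices
  carries absolute continuity both ways.\<close>

definition disjoint_intervals :: "real \<Rightarrow> real \<Rightarrow> (real \<times> real) set \<Rightarrow> bool" where
  "disjoint_intervals a b D \<longleftrightarrow> finite D \<and> (\<forall>(s, t)\<in>D. a \<le> s \<and> s \<le> t \<and> t \<le> b) \<and>
     pairwise (\<lambda>(s, t) (s', t'). {s<..<t} \<inter> {s'<..<t'} = {}) D"

lemma abs_continuous_on_iff:
  "abs_continuous_on a b f \<longleftrightarrow> (\<forall>\<epsilon>>0. \<exists>\<delta>>0. \<forall>D. disjoint_intervals a b D \<longrightarrow>
     (\<Sum>(s, t)\<in>D. t - s) < \<delta> \<longrightarrow> (\<Sum>(s, t)\<in>D. dist (f s) (f t)) < \<epsilon>)"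
  unfolding abs_continuous_on_def disjoint_intervals_def by (simp only: imp_conjL)

lemma abs_continuous_onE:
  assumes "abs_continuous_on a b f" "\<epsilon> > 0"
  obtains \<delta> where "\<delta> > 0" "\<And>D. disjoint_intervals a b D \<Longrightarrow> (\<Sum>(s, t)\<in>D. t - s) < \<delta> \<Longrightarrow>
    (\<Sum>(s, t)\<in>D. dist (f s) (f t)) < \<epsilon>"
  using assms unfolding abs_continuous_on_iff by blast

section \<open>Indefinite integrals: absolute continuity and almost everywhere
  differentiability\<close>

lemma sum_integral_disjoint_le:
  fixes k :: "real \<Rightarrow> real"
  assumes "disjoint_intervals a b D" and k: "k integrable_on {a..b}" and nn: "\<And>x. x \<in> {a..b} \<Longrightarrow> 0 \<le> k x"
  shows "(\<Sum>(s, t)\<in>D. integral {s..t} k) \<le> integral {a..b} k"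
proof -
  have fin: "finite D" and D: "\<forall>(s, t)\<in>D. a \<le> s \<and> s \<le> t \<and> t \<le> b"
    and disj: "pairwise (\<lambda>(s, t) (s', t'). {s<..<t} \<inter> {s'<..<t'} = {}) D"
    using assms(1) by (auto simp: disjoint_intervals_def)
  define \<phi> where "\<phi> p x = (if x \<in> {fst p<..<snd p} then k x else 0)" for p :: "real \<times> real" and x
  have sub: "{fst p<..<snd p} \<subseteq> {a..b}" "{fst p..snd p} \<subseteq> {a..b}" if "p \<in> D" for p
    using D that by (auto simp: case_prod_beta)
  have int: "\<phi> p integrable_on {a..b}" and eq: "integral {a..b} (\<phi> p) = integral {fst p..snd p} k" if "p \<in> D" for p
  proof -
    have "k integrable_on {fst p..snd p}"
      using integrable_on_subinterval[OF k] sub[OF that] by auto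
    then have "k integrable_on {fst p<..<snd p}"
      by (metis integrable_on_Icc_iff_Ioo)
    then show "\<phi> p integrable_on {a..b}"
      unfolding \<phi>_def using sub(1)[OF that] by (subst integrable_restrict_Int) (simp add: Int_absorb2)
    show "integral {a..b} (\<phi> p) = integral {fst p..snd p} k"
      unfolding \<phi>_def using sub(1)[OF that]
      by (subst integral_restrict_Int) (simp add: Int_absorb2 integral_open_interval_real)
  qed
  have "(\<Sum>(s, t)\<in>D. integral {s..t} k) = (\<Sum>p\<in>D. integral {a..b} (\<phi> p))"
    by (simp add: case_prod_beta eq)
  also have "\<dots> = integral {a..b} (\<lambda>x. \<Sum>p\<in>D. \<phi> p x)"
    using int fin by (simp add: integral_sum)
  also have "\<dots> \<le> integral {a..b} k"
  proof (rule integral_le)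
    show "(\<lambda>x. \<Sum>p\<in>D. \<phi> p x) integrable_on {a..b}"
      using int fin by (simp add: integrable_sum)
    \<comment> \<open>A point lies in at most one of the open intervals, so at most one summand
      differs from zero. Restricting to open rather than closed intervals makes common endpoints
      harmless and does not change the integrals.\<close>
    show "(\<Sum>p\<in>D. \<phi> p x) \<le> k x" if x: "x \<in> {a..b}" for x
    proof (cases "\<exists>p\<in>D. x \<in> {fst p<..<snd p}")
      case True
      then obtain p where p: "p \<in> D" "x \<in> {fst p<..<snd p}" by blast
      have "\<phi> r x = 0" if "r \<in> D - {p}" for r
        using pairwiseD[OF disj, of p r] p that by (auto simp: \<phi>_def case_prod_beta)
      then have "(\<Sum>p\<in>D. \<phi> p x) = \<phi> p x"
        using fin p(1) by (simp add: sum.remove)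
      then show ?thesis using p by (simp add: \<phi>_def)
    next
      case False
      then have "(\<Sum>p\<in>D. \<phi> p x) = 0" by (intro sum.neutral) (auto simp: \<phi>_def)
      then show ?thesis using nn x by simp
    qed
  qed (rule k)
  finally show ?thesis .
qed

text \<open>The part of \<open>norm g\<close> above the height \<open>n\<close> vanishes in the
  limit by dominated convergence. This supplies the quantitative absolute continuity of the integral
  without speaking of the measure of sets on which \<open>g\<close> is large.\<close>

lemma integral_excess_tendsto_0:
  fixes g :: "real \<Rightarrow> 'e::euclidean_space"
  assumes g: "g absolutely_integrable_on {a..b}"
  shows "(\<lambda>x. max (norm (g x) - c) 0) absolutely_integrable_on {a..b}"
    and "(\<lambda>n. integral {a..b} (\<lambda>x. max (norm (g x) - real n) 0)) \<longlonglongrightarrow> 0"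
proof -
  show ai: "(\<lambda>x. max (norm (g x) - c) 0) absolutely_integrable_on {a..b}" for c
    by (intro absolutely_integrable_max_1 set_integral_diff absolutely_integrable_norm[unfolded o_def] g) auto
  have "(\<lambda>n. integral {a..b} (\<lambda>x. max (norm (g x) - real n) 0)) \<longlonglongrightarrow> integral {a..b} (\<lambda>x. 0)"
  proof (rule dominated_convergence(2))
    show "(\<lambda>x. max (norm (g x) - real n) 0) integrable_on {a..b}" for n
      using ai set_lebesgue_integral_eq_integral(1) by blast
    show "(\<lambda>x. norm (g x)) integrable_on {a..b}"
      using g absolutely_integrable_on_def by blast
    show "norm (max (norm (g x) - real n) 0) \<le> norm (g x)" for x n by auto
    show "(\<lambda>n. max (norm (g x) - real n) 0) \<longlonglongrightarrow> 0" for x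
    proof (rule tendsto_eventually)
      obtain N :: nat where "norm (g x) \<le> real N" using real_arch_simple by blast
      then show "\<forall>\<^sub>F n in sequentially. max (norm (g x) - real n) 0 = 0"
        by (intro eventually_sequentiallyI[of N]) auto
    qed
  qed
  then show "(\<lambda>n. integral {a..b} (\<lambda>x. max (norm (g x) - real n) 0)) \<longlonglongrightarrow> 0" by simp
qed

text \<open>\<open>norm g\<close> is at most its excess over \<open>n\<close> plus \<open>n\<close>.
  The excess contributes little over any family of intervals once \<open>n\<close> is large; the
  bounded part contributes \<open>n\<close> times the total length.\<close>

lemma abs_continuous_on_indefinite_integral:
  fixes g :: "real \<Rightarrow> 'e::euclidean_space"
  assumes g: "g absolutely_integrable_on {a..b}"
    and f: "\<And>t. t \<in> {a..b} \<Longrightarrow> f t = f a + integral {a..t} g"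
  shows "abs_continuous_on a b f"
  unfolding abs_continuous_on_iff
proof (intro allI impI)
  fix \<epsilon> :: real assume "\<epsilon> > 0"
  then obtain n :: nat where n: "integral {a..b} (\<lambda>x. max (norm (g x) - real n) 0) < \<epsilon> / 2"
    using order_tendstoD(2)[OF integral_excess_tendsto_0(2)[OF g], of "\<epsilon>/2"]
    by (auto simp: eventually_sequentially)
  define k where "k x = max (norm (g x) - real n) 0" for x
  have kint: "k integrable_on {a..b}"
    unfolding k_def by (rule set_lebesgue_integral_eq_integral(1)[OF integral_excess_tendsto_0(1)[OF g]])
  show "\<exists>\<delta>>0. \<forall>D. disjoint_intervals a b D \<longrightarrow>
           (\<Sum>(s, t)\<in>D. t - s) < \<delta> \<longrightarrow> (\<Sum>(s, t)\<in>D. dist (f s) (f t)) < \<epsilon>"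
  \<comment> \<open>With total length below this bound, the bounded part contributes at most
    \<open>\<epsilon> / 2\<close>; the summand \<open>1\<close> covers \<open>n = 0\<close>.\<close>
  proof (intro exI[of _ "\<epsilon> / (2 * (real n + 1))"] conjI allI impI)
    show "\<epsilon> / (2 * (real n + 1)) > 0" using \<open>\<epsilon> > 0\<close> by simp
    fix D :: "(real \<times> real) set"
    assume disj: "disjoint_intervals a b D" and small: "(\<Sum>(s, t)\<in>D. t - s) < \<epsilon> / (2 * (real n + 1))"
    have le: "dist (f s) (f t) \<le> integral {s..t} k + real n * (t - s)" if "(s, t) \<in> D" for s t
    proof -
      have st: "a \<le> s" "s \<le> t" "t \<le> b" using disj that by (auto simp: disjoint_intervals_def)
      have gst: "g absolutely_integrable_on {s..t}"
        using g by (rule set_integrable_subset) (use st in auto)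
      have "g integrable_on {a..t}"
        using g st by (intro integrable_on_subinterval[OF set_lebesgue_integral_eq_integral(1)[OF g]]) auto
      then have "f t - f s = integral {s..t} g"
        using f[of s] f[of t] st Henstock_Kurzweil_Integration.integral_combine[of a s t g] by (simp add: algebra_simps)
      then have "dist (f s) (f t) = norm (integral {s..t} g)"
        by (metis dist_norm dist_commute)
      also have "\<dots> \<le> integral {s..t} (\<lambda>x. norm (g x))"
        using gst by (intro integral_norm_bound_integral) (auto simp: absolutely_integrable_on_def)
      also have "\<dots> \<le> integral {s..t} (\<lambda>x. k x + real n)"
        using gst st by (intro integral_le integrable_add integrable_on_subinterval[OF kint])
          (auto simp: absolutely_integrable_on_def k_def)
      also have "\<dots> = integral {s..t} k + real n * (t - s)"
        using st by (subst integral_add) (auto intro!: integrable_on_subinterval[OF kint])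
      finally show ?thesis .
    qed
    have "(\<Sum>(s, t)\<in>D. dist (f s) (f t)) \<le> (\<Sum>(s, t)\<in>D. integral {s..t} k + real n * (t - s))"
      by (rule sum_mono) (use le in auto)
    also have "\<dots> = (\<Sum>(s, t)\<in>D. integral {s..t} k) + real n * (\<Sum>(s, t)\<in>D. t - s)"
      by (simp add: case_prod_beta sum.distrib sum_distrib_left)
    also have "\<dots> < \<epsilon>"
    proof -
      have "(\<Sum>(s, t)\<in>D. integral {s..t} k) < \<epsilon> / 2"
        by (rule le_less_trans[OF sum_integral_disjoint_le[OF disj kint]])
           (use n in \<open>simp_all flip: k_def\<close>, simp add: k_def)
      moreover have "real n * (\<Sum>(s, t)\<in>D. t - s) \<le> real n * (\<epsilon> / (2 * (real n + 1)))"
        using small by (intro mult_left_mono) auto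
      moreover have "real n * (\<epsilon> / (2 * (real n + 1))) \<le> \<epsilon> / 2"
        using \<open>\<epsilon> > 0\<close> by (simp add: field_simps)
      ultimately show ?thesis by linarith
    qed
    finally show "(\<Sum>(s, t)\<in>D. dist (f s) (f t)) < \<epsilon>" .
  qed
qed

text \<open>The theorem \<open>integrable_ccontinuous_explicit\<close> concerns averages over boxes
  with lower corner \<open>x\<close> and therefore yields a right derivative. The left derivative
  comes from the same theorem for the reflected function, at the price of a reflected null
  set.\<close>

lemma AE_has_vector_derivative_indefinite_integral:
  fixes g :: "real \<Rightarrow> 'e::euclidean_space"
  assumes g: "g integrable_on {a..b}"
  shows "AE t\<in>{a..b} in lebesgue. ((\<lambda>t. integral {a..t} g) has_vector_derivative g t) (at t)"
proof -
  \<comment> \<open>Extension by zero makes the function integrable on every box, as the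
    differentiation theorem demands; near an interior point nothing changes.\<close>
  define h where "h x = (if x \<in> {a..b} then g x else 0)" for x
  have hU: "h integrable_on UNIV" unfolding h_def using g integrable_restrict_UNIV by blast
  have h: "h integrable_on cbox u v" for u v
    using integrable_on_subcbox[OF hU, of u v] by auto
  have h': "(\<lambda>x. h (- x)) integrable_on cbox u v" for u v
    using h[of "-v" "-u"] Henstock_Kurzweil_Integration.integrable_reflect_real[where f=h and a="-v" and b="-u"] by simp
  obtain N where N: "negligible N"
    "\<And>x e. \<lbrakk>x \<notin> N; 0 < e\<rbrakk> \<Longrightarrow> \<exists>d>0. \<forall>r. 0 < r \<and> r < d \<longrightarrow> norm (integral (cbox x (x + r *\<^sub>R One)) h /\<^sub>R r ^ DIM(real) - h x) < e"
    using integrable_ccontinuous_explicit[OF h] by metis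
  obtain N' where N': "negligible N'"
    "\<And>x e. \<lbrakk>x \<notin> N'; 0 < e\<rbrakk> \<Longrightarrow> \<exists>d>0. \<forall>r. 0 < r \<and> r < d \<longrightarrow> norm (integral (cbox x (x + r *\<^sub>R One)) (\<lambda>x. h (- x)) /\<^sub>R r ^ DIM(real) - h (- x)) < e"
    using integrable_ccontinuous_explicit[OF h'] by metis
  have nul: "uminus ` N' \<in> null_sets lebesgue" "N \<in> null_sets lebesgue" "{a, b} \<in> null_sets lebesgue"
    using N(1) negligible_differentiable_image_negligible[OF order_refl N'(1), of uminus] negligible_iff_null_sets
    by (auto simp: differentiable_on_def intro!: derivative_intros)
  have "((\<lambda>t. integral {a..t} g) has_vector_derivative g t) (at t)"
    if t: "t \<in> {a..b}" "t \<notin> {a, b}" "t \<notin> N" "t \<notin> uminus ` N'" for t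
    unfolding has_vector_derivative_def has_derivative_at'
  proof (intro conjI allI impI)
    show "bounded_linear (\<lambda>x. x *\<^sub>R g t)" by (rule bounded_linear_scaleR_left)
    fix e :: real assume "e > 0"
    have "- t \<notin> N'" using t(4) by force
    have ht: "h t = g t" using t by (simp add: h_def)
    obtain d1 where d1: "d1 > 0" "\<And>r. 0 < r \<Longrightarrow> r < d1 \<Longrightarrow> norm (integral {t..t + r} h /\<^sub>R r - g t) < e"
      using N(2)[OF t(3) \<open>e > 0\<close>] ht by auto
    obtain d2 where d2: "d2 > 0" "\<And>r. 0 < r \<Longrightarrow> r < d2 \<Longrightarrow> norm (integral {-t..-t + r} (\<lambda>x. h (-x)) /\<^sub>R r - g t) < e"
      using N'(2)[OF \<open>-t \<notin> N'\<close> \<open>e > 0\<close>] ht by auto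
    define d where "d = min (min d1 d2) (min (t - a) (b - t))"
    have diff: "integral {a..v} g - integral {a..u} g = integral {u..v} h" if "a \<le> u" "u \<le> v" "v \<le> b" for u v
    proof -
      have "integral {u..v} h = integral {u..v} g"
        by (rule integral_cong) (use that in \<open>auto simp: h_def\<close>)
      moreover have "integral {a..u} g + integral {u..v} g = integral {a..v} g"
        using that by (intro Henstock_Kurzweil_Integration.integral_combine integrable_on_subinterval[OF g]) auto
      ultimately show ?thesis by (simp add: algebra_simps)
    qed
    have aux: "norm (I - r *\<^sub>R y) / r < e" if "r > 0" "norm (I /\<^sub>R r - y) < e" for I y :: 'e and r :: real
    proof -
      have "I /\<^sub>R r - y = (I - r *\<^sub>R y) /\<^sub>R r" using that by (simp add: algebra_simps)
      then show ?thesis using that by (simp add: divide_inverse mult.commute)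
    qed
    show "\<exists>d>0. \<forall>x'. 0 < norm (x' - t) \<and> norm (x' - t) < d \<longrightarrow>
             norm (integral {a..x'} g - integral {a..t} g - (x' - t) *\<^sub>R g t) / norm (x' - t) < e"
    proof (intro exI[of _ d] conjI allI impI)
      show "d > 0" using d1 d2 t by (auto simp: d_def)
      fix y assume y: "0 < norm (y - t) \<and> norm (y - t) < d"
      show "norm (integral {a..y} g - integral {a..t} g - (y - t) *\<^sub>R g t) / norm (y - t) < e"
      proof (cases "y > t")
        case True
        then have "integral {a..y} g - integral {a..t} g = integral {t..t + (y - t)} h"
          using diff[of t y] y t by (auto simp: d_def)
        moreover have "norm (integral {t..t + (y - t)} h - (y - t) *\<^sub>R g t) / (y - t) < e"
          using True y d1(2)[of "y - t"] by (intro aux) (auto simp: d_def)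
        ultimately show ?thesis using True by simp
      next
        case False
        then have lt: "y < t" using y by auto
        then have 1: "integral {a..t} g - integral {a..y} g = integral {y..t} h"
          using diff[of y t] y t by (auto simp: d_def)
        have "integral {y..t} h = integral {-t..-t + (t - y)} (\<lambda>x. h (-x))"
          using Henstock_Kurzweil_Integration.integral_reflect_real[where f=h and a=y and b=t] by simp
        then have "norm (integral {y..t} h - (t - y) *\<^sub>R g t) / (t - y) < e"
          using lt y d2(2)[of "t - y"] by (intro aux) (auto simp: d_def)
        moreover have "integral {a..y} g - integral {a..t} g - (y - t) *\<^sub>R g t = - (integral {y..t} h - (t - y) *\<^sub>R g t)"
          unfolding 1[symmetric] by (simp add: algebra_simps)
        ultimately show ?thesis using lt by (simp only: norm_minus_cancel) simp
      qed
    qed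
  qed
  then show ?thesis
    by (intro AE_I'[of "N \<union> uminus ` N' \<union> {a, b}"] null_sets.Un nul) auto
qed


section \<open>Stability of absolute continuity\<close>

lemma abs_continuous_on_le:
  assumes f: "abs_continuous_on a b f" and g: "abs_continuous_on a b g" and "0 \<le> C"
    and le: "\<And>s t. a \<le> s \<Longrightarrow> s \<le> t \<Longrightarrow> t \<le> b \<Longrightarrow> dist (h s) (h t) \<le> C * (dist (f s) (f t) + dist (g s) (g t))"
  shows "abs_continuous_on a b h"
  unfolding abs_continuous_on_iff
proof (intro allI impI)
  fix \<epsilon> :: real assume "\<epsilon> > 0"
  \<comment> \<open>Two families of increments enter with the factor \<open>C\<close>, hence the
    halving; \<open>C + 1\<close> instead of \<open>C\<close> allows \<open>C = 0\<close> and makes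
    the final estimate strict.\<close>
  define \<eta> where "\<eta> = \<epsilon> / (C + 1) / 2"
  have "\<eta> > 0" using \<open>\<epsilon> > 0\<close> \<open>0 \<le> C\<close> by (simp add: \<eta>_def)
  obtain d1 where d1: "d1 > 0" "\<And>D. disjoint_intervals a b D \<Longrightarrow>
        (\<Sum>(s, t)\<in>D. t - s) < d1 \<Longrightarrow> (\<Sum>(s, t)\<in>D. dist (f s) (f t)) < \<eta>"
    using abs_continuous_onE[OF f \<open>\<eta> > 0\<close>] by metis
  obtain d2 where d2: "d2 > 0" "\<And>D. disjoint_intervals a b D \<Longrightarrow>
        (\<Sum>(s, t)\<in>D. t - s) < d2 \<Longrightarrow> (\<Sum>(s, t)\<in>D. dist (g s) (g t)) < \<eta>"
    using abs_continuous_onE[OF g \<open>\<eta> > 0\<close>] by metis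
  show "\<exists>\<delta>>0. \<forall>D. disjoint_intervals a b D \<longrightarrow>
           (\<Sum>(s, t)\<in>D. t - s) < \<delta> \<longrightarrow> (\<Sum>(s, t)\<in>D. dist (h s) (h t)) < \<epsilon>"
  proof (intro exI[of _ "min d1 d2"] conjI allI impI)
    show "min d1 d2 > 0" using d1 d2 by simp
    fix D :: "(real \<times> real) set"
    assume D: "disjoint_intervals a b D" "(\<Sum>(s, t)\<in>D. t - s) < min d1 d2"
    have "(\<Sum>(s, t)\<in>D. dist (h s) (h t)) \<le> (\<Sum>(s, t)\<in>D. C * (dist (f s) (f t) + dist (g s) (g t)))"
      by (rule sum_mono) (use D(1) le in \<open>auto simp: disjoint_intervals_def\<close>)
    also have "\<dots> = C * ((\<Sum>(s, t)\<in>D. dist (f s) (f t)) + (\<Sum>(s, t)\<in>D. dist (g s) (g t)))"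
      by (simp add: case_prod_beta sum.distrib sum_distrib_left distrib_left)
    also have "\<dots> \<le> C * (\<eta> + \<eta>)"
      using d1(2)[of D] d2(2)[of D] D \<open>0 \<le> C\<close> by (intro mult_left_mono add_mono) auto
    also have "\<dots> < (C + 1) * (\<eta> + \<eta>)" using \<open>\<eta> > 0\<close> by (intro mult_strict_right_mono) auto
    also have "\<dots> = \<epsilon>"
    proof -
      have "\<eta> + \<eta> = \<epsilon> / (C + 1)" unfolding \<eta>_def by (rule field_sum_of_halves)
      then show ?thesis using \<open>0 \<le> C\<close> by simp
    qed
    finally show "(\<Sum>(s, t)\<in>D. dist (h s) (h t)) < \<epsilon>" .
  qed
qed

lemma abs_continuous_on_imp_continuous_on:
  assumes f: "abs_continuous_on a b f"
  shows "continuous_on {a..b} f"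
  unfolding continuous_on_iff
proof (intro ballI allI impI)
  fix x \<epsilon> :: real assume x: "x \<in> {a..b}" and "\<epsilon> > 0"
  obtain d where d: "d > 0" "\<And>D. disjoint_intervals a b D \<Longrightarrow>
        (\<Sum>(s, t)\<in>D. t - s) < d \<Longrightarrow> (\<Sum>(s, t)\<in>D. dist (f s) (f t)) < \<epsilon>"
    using abs_continuous_onE[OF f \<open>\<epsilon> > 0\<close>] by metis
  show "\<exists>d>0. \<forall>x'\<in>{a..b}. dist x' x < d \<longrightarrow> dist (f x') (f x) < \<epsilon>"
  proof (intro exI[of _ d] conjI ballI impI)
    fix y assume y: "y \<in> {a..b}" "dist y x < d"
    show "dist (f y) (f x) < \<epsilon>"
    proof (cases "x \<le> y")
      case True
      then show ?thesis
        using d(2)[of "{(x, y)}"] x y by (simp add: disjoint_intervals_def dist_real_def dist_commute)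
    next
      case False
      then show ?thesis
        using d(2)[of "{(y, x)}"] x y by (simp add: disjoint_intervals_def dist_real_def)
    qed
  qed (rule d)
qed

lemma disjoint_intervals_mono:
  "disjoint_intervals c d D \<Longrightarrow> a \<le> c \<Longrightarrow> d \<le> b \<Longrightarrow> disjoint_intervals a b D"
  unfolding disjoint_intervals_def by fastforce

lemma abs_continuous_on_subinterval:
  assumes f: "abs_continuous_on a b f" and "a \<le> c" "d \<le> b"
  shows "abs_continuous_on c d f"
  unfolding abs_continuous_on_iff
proof (intro allI impI)
  fix \<epsilon> :: real assume "\<epsilon> > 0"
  obtain r where "r > 0" and r: "\<And>D. disjoint_intervals a b D \<Longrightarrow> (\<Sum>(s, t)\<in>D. t - s) < r \<Longrightarrow>
      (\<Sum>(s, t)\<in>D. dist (f s) (f t)) < \<epsilon>"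
    using abs_continuous_onE[OF f \<open>\<epsilon> > 0\<close>] by metis
  then show "\<exists>\<delta>>0. \<forall>D. disjoint_intervals c d D \<longrightarrow> (\<Sum>(s, t)\<in>D. t - s) < \<delta> \<longrightarrow>
      (\<Sum>(s, t)\<in>D. dist (f s) (f t)) < \<epsilon>"
    by (intro exI[of _ r] conjI allI impI) (assumption | rule r[OF disjoint_intervals_mono[OF _ assms(2,3)]])+
qed

text \<open>Absolute continuity controls finite families of intervals only. Inside an open set
  around the null set, of length below \<open>d\<close>, a countable nonoverlapping system of closed
  intervals covers the null set; each finite subsystem has measure at most
  \<open>\<epsilon>\<close>, and continuity from below passes to the whole system.\<close>

lemma abs_continuous_on_mono_null_set:
  fixes G :: "real \<Rightarrow> real"
  assumes ab: "a < b" and G: "abs_continuous_on a b G" and mono: "mono G" and cont: "continuous_on UNIV G"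
    and A: "A \<in> null_sets lborel" "A \<subseteq> {a..b}"
  shows "emeasure (interval_measure G) A = 0"
proof -
  have "emeasure (interval_measure G) A \<le> 0"
  proof (rule ennreal_le_epsilon)
    fix \<epsilon> :: real assume "\<epsilon> > 0"
    obtain d where d: "d > 0" "\<And>D. disjoint_intervals a b D \<Longrightarrow>
        (\<Sum>(s, t)\<in>D. t - s) < d \<Longrightarrow> (\<Sum>(s, t)\<in>D. dist (G s) (G t)) < \<epsilon>"
      using abs_continuous_onE[OF G \<open>\<epsilon> > 0\<close>] by metis
    have Ab: "A \<in> sets borel" "emeasure lborel A = 0" using A by auto
    obtain U where U: "open U" "A \<subseteq> U" "emeasure lborel (U - A) < d"
      using outer_regular_lborel[OF Ab(1) d(1)] by blast
    have Ud: "emeasure lborel U < d"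
      using U emeasure_Diff_null_set[of A lborel U] A(1) borel_open[OF U(1)] by simp
    \<comment> \<open>The gauge is \<open>U\<close> at points of \<open>U\<close> and trivial
      elsewhere, so every interval of the covering, being tagged by a point of \<open>A\<close>,
      lies in \<open>U\<close>.\<close>
    define \<gamma> where "\<gamma> x = (if x \<in> U then U else UNIV)" for x
    have "gauge \<gamma>" unfolding gauge_def \<gamma>_def using U(1) by auto
    obtain \<D> where \<D>: "countable \<D>" "\<Union>\<D> \<subseteq> cbox a b"
      "\<And>K. K \<in> \<D> \<Longrightarrow> interior K \<noteq> {} \<and> (\<exists>c d. K = cbox c d)"
      "pairwise (\<lambda>A B. interior A \<inter> interior B = {}) \<D>"
      "\<And>K. K \<in> \<D> \<Longrightarrow> \<exists>x \<in> A \<inter> K. K \<subseteq> \<gamma> x" "A \<subseteq> \<Union>\<D>"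
      by (rule covering_lemma[of A a b \<gamma>]) (use A(2) ab \<open>gauge \<gamma>\<close> in auto)
    have Icc: "K = {Inf K..Sup K} \<and> a \<le> Inf K \<and> Inf K < Sup K \<and> Sup K \<le> b \<and> K \<subseteq> U" if K: "K \<in> \<D>" for K
    proof -
      obtain u v where uv: "K = {u..v}" using \<D>(3)[OF K] by auto
      have "u < v" using \<D>(3)[OF K] uv by (auto simp: interior_atLeastAtMost_real)
      moreover have "{u..v} \<subseteq> {a..b}" using order.trans[OF Union_upper[OF K] \<D>(2)] uv by simp
      moreover have "K \<subseteq> U" using \<D>(5)[OF K] U(2) by (auto simp: \<gamma>_def split: if_splits)
      ultimately show ?thesis using uv by auto
    qed
    have fin: "(\<Sum>K\<in>F. emeasure (interval_measure G) K) \<le> ennreal \<epsilon>" if F: "finite F" "F \<subseteq> \<D>" for F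
    proof -
      define D where "D = (\<lambda>K. (Inf K, Sup K)) ` F"
      have inj: "inj_on (\<lambda>K::real set. (Inf K, Sup K)) F"
        using Icc F(2) by (intro inj_onI) (metis (no_types, lifting) Pair_inject subsetD)
      have disK: "{Inf K<..<Sup K} \<inter> {Inf L<..<Sup L} = {}" if KL: "K \<in> F" "L \<in> F" "K \<noteq> L" for K L
      proof -
        have "interior K \<inter> interior L = {}"
          using KL F(2) \<D>(4) by (auto simp: pairwise_def)
        moreover have "interior K = {Inf K<..<Sup K}" "interior L = {Inf L<..<Sup L}"
          using Icc[of K] Icc[of L] KL F(2) interior_atLeastAtMost_real by (metis subsetD)+
        ultimately show ?thesis by simp
      qed
      have dis: "pairwise (\<lambda>(s, t) (s', t'). {s<..<t} \<inter> {s'<..<t'} = {}) D"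
        unfolding D_def by (rule pairwise_imageI) (use disK in simp)
      have "ennreal (\<Sum>(s, t)\<in>D. t - s) = (\<Sum>K\<in>F. emeasure lborel {Inf K<..<Sup K})"
      proof -
        have "(\<Sum>(s, t)\<in>D. t - s) = (\<Sum>K\<in>F. Sup K - Inf K)"
          unfolding D_def by (subst sum.reindex[OF inj]) simp
        also have "ennreal \<dots> = (\<Sum>K\<in>F. ennreal (Sup K - Inf K))"
          using Icc F(2) by (subst sum_ennreal) (auto simp: subset_iff less_imp_le)
        also have "\<dots> = (\<Sum>K\<in>F. emeasure lborel {Inf K<..<Sup K})"
          using Icc F(2) by (intro sum.cong refl) (auto simp: subset_iff less_imp_le)
        finally show ?thesis .
      qed
      also have "\<dots> = emeasure lborel (\<Union>K\<in>F. {Inf K<..<Sup K})"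
      proof (rule sum_emeasure)
        show "disjoint_family_on (\<lambda>K. {Inf K<..<Sup K}) F"
          unfolding disjoint_family_on_def using disK by blast
      qed (use F in auto)
      also have "\<dots> \<le> emeasure lborel U"
      proof (rule emeasure_mono)
        show "(\<Union>K\<in>F. {Inf K<..<Sup K}) \<subseteq> U"
          using Icc F(2) by (smt (verit) UN_least greaterThanLessThan_subseteq_atLeastAtMost_iff order.trans subset_iff)
      qed (use borel_open[OF U(1)] in auto)
      finally have "ennreal (\<Sum>(s, t)\<in>D. t - s) < ennreal d" using Ud by (rule le_less_trans)
      moreover have "0 \<le> (\<Sum>(s, t)\<in>D. t - s)"
        using Icc F(2) by (intro sum_nonneg) (auto simp: D_def subset_iff less_imp_le)
      ultimately have len: "(\<Sum>(s, t)\<in>D. t - s) < d" using ennreal_less_iff by blast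
      have "(\<Sum>(s, t)\<in>D. dist (G s) (G t)) < \<epsilon>"
        by (rule d(2)[OF _ len]) (use Icc F dis in \<open>auto simp: disjoint_intervals_def D_def subset_iff less_imp_le\<close>)
      moreover have "(\<Sum>(s, t)\<in>D. dist (G s) (G t)) = (\<Sum>K\<in>F. G (Sup K) - G (Inf K))"
        unfolding D_def using Icc F(2) mono
        by (subst sum.reindex[OF inj], simp, intro sum.cong refl) (auto simp: dist_real_def mono_def subset_iff less_imp_le)
      moreover have "(\<Sum>K\<in>F. emeasure (interval_measure G) K) = ennreal (\<Sum>K\<in>F. G (Sup K) - G (Inf K))"
      proof -
        have "emeasure (interval_measure G) K = ennreal (G (Sup K) - G (Inf K))" if "K \<in> F" for K
          using Icc[of K] that F(2) emeasure_interval_measure_Icc[of "Inf K" "Sup K" G] mono cont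
          by (metis less_imp_le monoD subsetD)
        moreover have "G (Inf K) \<le> G (Sup K)" if "K \<in> F" for K
          using Icc[of K] that F(2) mono by (auto simp: mono_def)
        ultimately show ?thesis by (simp add: sum_ennreal)
      qed
      ultimately show ?thesis by (simp add: ennreal_leI)
    qed
    have meas: "K \<in> sets borel" if "K \<in> \<D>" for K using \<D>(3)[OF that] by auto
    show "emeasure (interval_measure G) A \<le> 0 + ennreal \<epsilon>"
    proof (cases "\<D> = {}")
      case True
      then show ?thesis using \<D>(6) by simp
    next
      case False
      \<comment> \<open>The enumeration may repeat members; the sum in the estimate of
        \<open>B n\<close> runs over the image set, so each member counts once.\<close>
      define B where "B n = \<Union>(from_nat_into \<D> ` {..<n})" for n :: nat
      have inD: "from_nat_into \<D> ` {..<n} \<subseteq> \<D>" for n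
        using from_nat_into[OF False] by auto
      have Bm: "B n \<in> sets (interval_measure G)" for n
        unfolding B_def by (rule sets.finite_Union) (use inD[of n] meas in auto)
      have "emeasure (interval_measure G) A \<le> emeasure (interval_measure G) (\<Union>n. B n)"
      proof (rule emeasure_mono)
        show "A \<subseteq> (\<Union>n. B n)"
        proof
          fix x assume "x \<in> A"
          then obtain K where K: "K \<in> \<D>" "x \<in> K" using \<D>(6) by blast
          then obtain n where "K = from_nat_into \<D> n"
            using from_nat_into_surj[OF \<D>(1) K(1)] by metis
          then have "x \<in> B (Suc n)" using K(2) unfolding B_def by blast
          then show "x \<in> (\<Union>n. B n)" by blast
        qed
        show "(\<Union>n. B n) \<in> sets (interval_measure G)"
          using Bm by auto
      qed
      also have "\<dots> = (SUP n. emeasure (interval_measure G) (B n))"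
      proof (rule SUP_emeasure_incseq[symmetric])
        show "range B \<subseteq> sets (interval_measure G)"
          using Bm by auto
        show "incseq B" unfolding incseq_def B_def by (auto intro!: Union_mono image_mono)
      qed
      also have "\<dots> \<le> ennreal \<epsilon>"
      proof (rule SUP_least)
        fix n
        have "emeasure (interval_measure G) (B n) \<le> (\<Sum>K\<in>from_nat_into \<D> ` {..<n}. emeasure (interval_measure G) K)"
          using meas inD[of n] emeasure_subadditive_finite[of "from_nat_into \<D> ` {..<n}" "\<lambda>K. K" "interval_measure G"]
          unfolding B_def by auto
        also have "\<dots> \<le> ennreal \<epsilon>" using fin[OF _ inD] by simp
        finally show "emeasure (interval_measure G) (B n) \<le> ennreal \<epsilon>" .
      qed
      finally show ?thesis by simp
    qed
  qed
  then show ?thesis by simp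
qed


lemma mono_abs_continuous_on_imp_integral:
  fixes F :: "real \<Rightarrow> real"
  assumes ab: "a \<le> b" and F: "abs_continuous_on a b F" and mono: "mono_on {a..b} F"
  shows "\<exists>g. g absolutely_integrable_on {a..b} \<and> (\<forall>t\<in>{a..b}. F t = F a + integral {a..t} g)"
proof (cases "a = b")
  case True
  then show ?thesis by (intro exI[of _ "\<lambda>_. 0"]) auto
next
  case False
  then have ab: "a < b" using ab by simp
  \<comment> \<open>Continued by its boundary values: the Stieltjes measure is formed on the whole
    line, and clamping keeps the function monotone and continuous without adding mass.\<close>
  define G where "G t = F (max a (min b t))" for t
  have GF: "G t = F t" if "t \<in> {a..b}" for t using that by (simp add: G_def)
  have mG: "mono G"
    unfolding mono_def G_def using mono ab by (auto simp: mono_on_def)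
  have cG: "continuous_on UNIV G"
    unfolding G_def
    by (rule continuous_on_compose2[OF abs_continuous_on_imp_continuous_on[OF F]])
       (use ab in \<open>auto intro!: continuous_intros\<close>)
  have acG: "abs_continuous_on a b G"
    by (rule abs_continuous_on_le[OF F F, of 1]) (auto simp: GF)
  have rc: "continuous (at_right t) G" for t
    using cG by (simp add: continuous_on_eq_continuous_within continuous_at_imp_continuous_at_within)
  let ?\<mu> = "interval_measure G"
  have Ioc: "emeasure ?\<mu> {s<..t} = ennreal (G t - G s)" if "s \<le> t" for s t
    by (rule emeasure_interval_measure_Ioc) (use that mG rc in \<open>auto simp: mono_def\<close>)
  \<comment> \<open>The null set lemma treats subsets of \<open>{a..b}\<close>; this disposes of the
    remainder of an arbitrary Lebesgue null set.\<close>
  have out: "- {a<..b} \<in> null_sets ?\<mu>"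
  proof -
    have "{- real n<..a} \<in> null_sets ?\<mu>" "{b<..real n} \<in> null_sets ?\<mu>" for n
    proof -
      have "emeasure ?\<mu> {- real n<..a} = 0"
        using Ioc[of "- real n" a] ab by (cases "- real n \<le> a") (auto simp: G_def)
      moreover have "emeasure ?\<mu> {b<..real n} = 0"
        using Ioc[of b "real n"] ab by (cases "b \<le> real n") (auto simp: G_def max_def min_def)
      ultimately show "{- real n<..a} \<in> null_sets ?\<mu>" "{b<..real n} \<in> null_sets ?\<mu>" by auto
    qed
    then have "(\<Union>n. {- real n<..a}) \<union> (\<Union>n. {b<..real n}) \<in> null_sets ?\<mu>"
      by (intro null_sets.Un null_sets_UN) auto
    moreover have "(\<Union>n. {- real n<..a}) \<union> (\<Union>n. {b<..real n}) = - {a<..b}"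
    proof (rule antisym)
      show "- {a<..b} \<subseteq> (\<Union>n. {- real n<..a}) \<union> (\<Union>n. {b<..real n})"
      proof
        fix x assume x: "x \<in> - {a<..b}"
        obtain n where n: "\<bar>x\<bar> < real n" using reals_Archimedean2 by blast
        then have "- real n < x \<and> x \<le> real n" by linarith
        then show "x \<in> (\<Union>n. {- real n<..a}) \<union> (\<Union>n. {b<..real n})"
          using x by auto
      qed
    qed (use ab in auto)
    ultimately show ?thesis by simp
  qed
  have ac: "absolutely_continuous lborel ?\<mu>"
    unfolding absolutely_continuous_def
  proof
    fix A :: "real set" assume A: "A \<in> null_sets lborel"
    have "A \<inter> {a..b} \<in> null_sets lborel"
      by (rule null_set_Int2[OF A]) auto
    then have "A \<inter> {a..b} \<in> null_sets ?\<mu>"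
      using abs_continuous_on_mono_null_set[OF ab acG mG cG, of "A \<inter> {a..b}"] by (auto simp: null_sets_def)
    then have "(A \<inter> {a..b}) \<union> - {a<..b} \<in> null_sets ?\<mu>" using out by auto
    then show "A \<in> null_sets ?\<mu>"
      by (rule null_sets_subset) (use A in auto)
  qed
  obtain h where h: "h \<in> borel_measurable lborel" "density lborel h = ?\<mu>"
    using sigma_finite_measure.Radon_Nikodym[OF sigma_finite_lborel ac] by auto
  have hint: "(\<integral>\<^sup>+x. h x * indicator {a<..t} x \<partial>lborel) = ennreal (G t - G a)" if "t \<in> {a..b}" for t
    using Ioc[of a t] that emeasure_density[OF h(1), of "{a<..t}"] h(2) by simp
  \<comment> \<open>The density takes values in \<open>ennreal\<close>. Its integral over
    \<open>{a<..b}\<close> is finite, so it is finite almost everywhere there and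
    \<open>enn2real\<close> loses nothing.\<close>
  have fin: "AE x in lborel. h x * indicator {a<..b} x \<noteq> \<infinity>"
    by (rule nn_integral_noteq_infinite) (use hint[of b] ab h(1) in auto)
  define g where "g x = enn2real (h x) * indicator {a<..b} x" for x
  have gm: "g \<in> borel_measurable borel" unfolding g_def using h(1) by simp
  have int: "(g has_integral (G t - G a)) {a..t}" if t: "t \<in> {a..b}" for t
  proof -
    have "((\<lambda>x. g x * indicator {a<..t} x) has_integral (G t - G a)) UNIV"
    proof (rule nn_integral_has_integral)
      show "(\<lambda>x. g x * indicator {a<..t} x) \<in> borel_measurable borel" using gm by simp
      have "(\<integral>\<^sup>+x. ennreal (g x * indicator {a<..t} x) \<partial>lborel) = (\<integral>\<^sup>+x. h x * indicator {a<..t} x \<partial>lborel)"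
        by (rule nn_integral_cong_AE) (use fin t in \<open>auto simp: g_def indicator_def less_top elim!: eventually_mono\<close>)
      then show "(\<integral>\<^sup>+x. ennreal (g x * indicator {a<..t} x) \<partial>lborel) = ennreal (G t - G a)"
        using hint[OF t] by simp
      show "0 \<le> G t - G a" using t mG by (auto simp: mono_def)
    qed (auto simp: g_def)
    moreover have "(\<lambda>x. g x * indicator {a<..t} x) = (\<lambda>x. if x \<in> {a..t} then g x else 0)"
      by (auto simp: g_def indicator_def fun_eq_iff)
    ultimately show ?thesis using has_integral_restrict_UNIV[of "{a..t}" g] by simp
  qed
  have "g absolutely_integrable_on {a..b}"
    by (rule nonnegative_absolutely_integrable_1) (use int[of b] ab in \<open>auto simp: g_def\<close>)
  moreover have "F t = F a + integral {a..t} g" if "t \<in> {a..b}" for t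
    using integral_unique[OF int[OF that]] GF[OF that] GF[of a] ab by simp
  ultimately show ?thesis by blast
qed

section \<open>Positive variation and the Jordan decomposition\<close>

definition strict_disjoint_intervals :: "real \<Rightarrow> real \<Rightarrow> (real \<times> real) set \<Rightarrow> bool" where
  "strict_disjoint_intervals a b D \<longleftrightarrow> disjoint_intervals a b D \<and> (\<forall>(s, t)\<in>D. s < t)"

text \<open>The increments are signed, unlike in the total variation: a family may skip intervals on
  which \<open>f\<close> falls, so the supremum measures the rise alone. Signed sums moreover split
  exactly when a family is cut at a point.\<close>

definition positive_variation :: "(real \<Rightarrow> real) \<Rightarrow> real \<Rightarrow> real \<Rightarrow> real" where
  "positive_variation f a b = (SUP D\<in>Collect (strict_disjoint_intervals a b). \<Sum>(s, t)\<in>D. f t - f s)"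

text \<open>Applied with \<open>l\<close> the truncation \<open>min b\<close> or
  \<open>max b\<close>. Intervals that collapse are dropped; the others only shrink, by the last
  hypothesis, so they stay disjoint, and having nonempty interior they stay distinct.\<close>

lemma strict_disjoint_intervals_image:
  assumes D: "strict_disjoint_intervals a b D" and D': "D' = {p \<in> D. l (fst p) < l (snd p)}"
    and l: "mono l" "\<And>x. a \<le> x \<Longrightarrow> x \<le> b \<Longrightarrow> c \<le> l x \<and> l x \<le> d"
    and inc: "\<And>p. p \<in> D' \<Longrightarrow> {l (fst p)<..<l (snd p)} \<subseteq> {fst p<..<snd p}"
  shows "strict_disjoint_intervals c d (map_prod l l ` D')" "inj_on (map_prod l l) D'"
proof -
  have dis: "p = r" if p: "p \<in> D'" "r \<in> D'" and ne: "{l (fst p)<..<l (snd p)} \<inter> {l (fst r)<..<l (snd r)} \<noteq> {}" for p r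
  proof (rule ccontr)
    assume "p \<noteq> r"
    then have "{fst p<..<snd p} \<inter> {fst r<..<snd r} = {}"
      using D p D' unfolding strict_disjoint_intervals_def disjoint_intervals_def pairwise_def by fastforce
    then show False using ne inc[OF p(1)] inc[OF p(2)] by blast
  qed
  show "inj_on (map_prod l l) D'"
  proof (rule inj_onI)
    fix p r assume "p \<in> D'" "r \<in> D'" "map_prod l l p = map_prod l l r"
    then show "p = r" using D' dis[of p r] by (cases p; cases r) auto
  qed
  have "pairwise (\<lambda>(s, t) (s', t'). {s<..<t} \<inter> {s'<..<t'} = {}) (map_prod l l ` D')"
    by (rule pairwise_imageI) (use dis in \<open>force simp: case_prod_beta\<close>)
  then show "strict_disjoint_intervals c d (map_prod l l ` D')"
    using D D' l unfolding strict_disjoint_intervals_def disjoint_intervals_def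
    by (auto simp: case_prod_beta)
qed

lemma strict_disjoint_intervals_split:
  fixes f :: "real \<Rightarrow> real"
  assumes D: "strict_disjoint_intervals a c D" and b: "a \<le> b" "b \<le> c"
  obtains D1 D2 where "strict_disjoint_intervals a b D1" "strict_disjoint_intervals b c D2"
    "(\<Sum>(s, t)\<in>D. f t - f s) = (\<Sum>(s, t)\<in>D1. f t - f s) + (\<Sum>(s, t)\<in>D2. f t - f s)"
proof -
  define l where "l = min b"
  define r where "r = max b"
  define L where "L = {p \<in> D. l (fst p) < l (snd p)}"
  define R where "R = {p \<in> D. r (fst p) < r (snd p)}"
  have fin: "finite D" and lt: "\<And>p. p \<in> D \<Longrightarrow> fst p < snd p"
    using D by (auto simp: strict_disjoint_intervals_def disjoint_intervals_def)
  have 1: "strict_disjoint_intervals a b (map_prod l l ` L)" "inj_on (map_prod l l) L"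
    by (rule strict_disjoint_intervals_image[where c=a and d=b, OF D L_def]; use b in \<open>auto simp: l_def L_def mono_def\<close>)+
  have 2: "strict_disjoint_intervals b c (map_prod r r ` R)" "inj_on (map_prod r r) R"
    by (rule strict_disjoint_intervals_image[where c=b and d=c, OF D R_def]; use b in \<open>auto simp: r_def R_def mono_def\<close>)+
  \<comment> \<open>The dropped intervals have equal endpoints after truncation and contribute zero,
    so the sum may run over all of \<open>D\<close>.\<close>
  have red: "(\<Sum>(s, t)\<in>map_prod k k ` K. f t - f s) = (\<Sum>p\<in>D. f (k (snd p)) - f (k (fst p)))"
    if "inj_on (map_prod k k) K" "K = {p \<in> D. k (fst p) < k (snd p)}" "mono k" for k K
  proof -
    have "(\<Sum>(s, t)\<in>map_prod k k ` K. f t - f s) = (\<Sum>p\<in>K. f (k (snd p)) - f (k (fst p)))"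
      by (subst sum.reindex[OF that(1)]) (auto simp: case_prod_beta intro!: sum.cong)
    also have "\<dots> = (\<Sum>p\<in>D. f (k (snd p)) - f (k (fst p)))"
    proof (rule sum.mono_neutral_left[OF fin])
      show "\<forall>p\<in>D - K. f (k (snd p)) - f (k (fst p)) = 0"
      proof
        fix p assume p: "p \<in> D - K"
        then have "k (fst p) \<le> k (snd p)" using lt[of p] \<open>mono k\<close> by (auto simp: mono_def)
        then have "k (fst p) = k (snd p)" using p that(2) by auto
        then show "f (k (snd p)) - f (k (fst p)) = 0" by simp
      qed
    qed (use that in auto)
    finally show ?thesis .
  qed
  \<comment> \<open>For each endpoint, \<open>f (min b t) + f (max b t) = f t + f b\<close>, and the
    terms \<open>f b\<close> cancel in the increments.\<close>
  have "(\<Sum>(s, t)\<in>D. f t - f s) = (\<Sum>p\<in>D. (f (l (snd p)) - f (l (fst p))) + (f (r (snd p)) - f (r (fst p))))"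
    by (rule sum.cong) (auto simp: l_def r_def min_def max_def)
  also have "\<dots> = (\<Sum>(s, t)\<in>map_prod l l ` L. f t - f s) + (\<Sum>(s, t)\<in>map_prod r r ` R. f t - f s)"
    by (subst red[OF 1(2) L_def], simp add: l_def mono_def min.coboundedI2, subst red[OF 2(2) R_def])
       (simp_all add: r_def mono_def sum.distrib max.coboundedI2)
  finally show ?thesis using that 1(1) 2(1) by blast
qed


lemma sum_length_le:
  assumes "disjoint_intervals a b D" "a \<le> b"
  shows "(\<Sum>(s, t)\<in>D. t - s) \<le> b - a"
proof -
  have "(\<Sum>(s, t)\<in>D. t - s) = (\<Sum>(s, t)\<in>D. integral {s..t} (\<lambda>_. 1))"
    using assms(1) by (intro sum.cong) (auto simp: disjoint_intervals_def)
  also have "\<dots> \<le> integral {a..b} (\<lambda>_. 1)"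
    by (rule sum_integral_disjoint_le[OF assms(1)]) auto
  finally show ?thesis using assms(2) by simp
qed

lemma sum_diff_le_sum_dist:
  fixes f :: "real \<Rightarrow> real"
  shows "(\<Sum>(s, t)\<in>D. f t - f s) \<le> (\<Sum>(s, t)\<in>D. dist (f s) (f t))"
  by (rule sum_mono) (auto simp: dist_real_def)

context
  fixes f :: "real \<Rightarrow> real" and a b :: real
  assumes f: "abs_continuous_on a b f"
begin

text \<open>By the splitting lemma finiteness is inherited under concatenation, and on intervals
  shorter than the length belonging to \<open>\<epsilon> = 1\<close> every sum is at most
  \<open>1\<close>; \<open>Bolzano\<close> turns this into a global bound.\<close>

lemma bdd_above_variation:
  assumes "a \<le> s" "s \<le> t" "t \<le> b"
  shows "bdd_above ((\<lambda>D. \<Sum>(s, t)\<in>D. f t - f s) ` Collect (strict_disjoint_intervals s t))"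
proof -
  have "a \<le> s \<longrightarrow> t \<le> b \<longrightarrow> bdd_above ((\<lambda>D. \<Sum>(s, t)\<in>D. f t - f s) ` Collect (strict_disjoint_intervals s t))"
    using \<open>s \<le> t\<close>
  proof (induction s t rule: Bolzano)
    case (trans r s t)
    show ?case
    proof (intro impI)
      assume r: "a \<le> r" and t: "t \<le> b"
      obtain B where B: "\<And>D. strict_disjoint_intervals r s D \<Longrightarrow> (\<Sum>(s, t)\<in>D. f t - f s) \<le> B"
        using trans r t by (auto simp: bdd_above_def)
      obtain C where C: "\<And>D. strict_disjoint_intervals s t D \<Longrightarrow> (\<Sum>(s, t)\<in>D. f t - f s) \<le> C"
        using trans r t by (auto simp: bdd_above_def)
      show "bdd_above ((\<lambda>D. \<Sum>(s, t)\<in>D. f t - f s) ` Collect (strict_disjoint_intervals r t))"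
      proof (rule bdd_aboveI2)
        fix D assume "D \<in> Collect (strict_disjoint_intervals r t)"
        then obtain D1 D2 where "strict_disjoint_intervals r s D1" "strict_disjoint_intervals s t D2"
          "(\<Sum>(s, t)\<in>D. f t - f s) = (\<Sum>(s, t)\<in>D1. f t - f s) + (\<Sum>(s, t)\<in>D2. f t - f s)"
          using strict_disjoint_intervals_split[of r t D s f] trans by auto
        then show "(\<Sum>(s, t)\<in>D. f t - f s) \<le> B + C" using B C by (simp add: add_mono)
      qed
    qed
  next
    case (local x)
    obtain d where d: "d > 0" "\<And>D. disjoint_intervals a b D \<Longrightarrow> (\<Sum>(s, t)\<in>D. t - s) < d \<Longrightarrow>
        (\<Sum>(s, t)\<in>D. dist (f s) (f t)) < 1"
      using abs_continuous_onE[OF f zero_less_one] by metis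
    show ?case
    proof (intro exI[of _ d] conjI allI impI)
      fix s t assume st: "s \<le> x \<and> x \<le> t \<and> t - s < d" "a \<le> s" "t \<le> b"
      show "bdd_above ((\<lambda>D. \<Sum>(s, t)\<in>D. f t - f s) ` Collect (strict_disjoint_intervals s t))"
      proof (rule bdd_aboveI2)
        fix D assume "D \<in> Collect (strict_disjoint_intervals s t)"
        then have D: "disjoint_intervals s t D" by (auto simp: strict_disjoint_intervals_def)
        have "(\<Sum>(s, t)\<in>D. t - s) < d" using sum_length_le[OF D] st by auto
        then have "(\<Sum>(s, t)\<in>D. dist (f s) (f t)) < 1"
          by (rule d(2)[OF disjoint_intervals_mono[OF D st(2,3)]])
        then show "(\<Sum>(s, t)\<in>D. f t - f s) \<le> 1" using sum_diff_le_sum_dist[of f D] by linarith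
      qed
    qed (rule d)
  qed
  then show ?thesis using assms by simp
qed

lemma variation_le_positive_variation:
  assumes "a \<le> s" "s \<le> t" "t \<le> b" "strict_disjoint_intervals s t D"
  shows "(\<Sum>(s, t)\<in>D. f t - f s) \<le> positive_variation f s t"
  unfolding positive_variation_def
  by (rule cSUP_upper) (use assms bdd_above_variation in auto)

lemma positive_variation_leI:
  assumes "\<And>D. strict_disjoint_intervals s t D \<Longrightarrow> (\<Sum>(s, t)\<in>D. f t - f s) \<le> B"
  shows "positive_variation f s t \<le> B"
proof -
  have "strict_disjoint_intervals s t {}" by (simp add: strict_disjoint_intervals_def disjoint_intervals_def)
  then show ?thesis
    unfolding positive_variation_def by (intro cSUP_least) (use assms in auto)
qed

lemma positive_variation_subadditive:
  assumes "a \<le> r" "r \<le> s" "s \<le> t" "t \<le> b"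
  shows "positive_variation f r t \<le> positive_variation f r s + positive_variation f s t"
proof (rule positive_variation_leI)
  fix D assume "strict_disjoint_intervals r t D"
  then obtain D1 D2 where "strict_disjoint_intervals r s D1" "strict_disjoint_intervals s t D2"
    "(\<Sum>(s, t)\<in>D. f t - f s) = (\<Sum>(s, t)\<in>D1. f t - f s) + (\<Sum>(s, t)\<in>D2. f t - f s)"
    using strict_disjoint_intervals_split assms by metis
  then show "(\<Sum>(s, t)\<in>D. f t - f s) \<le> positive_variation f r s + positive_variation f s t"
    using variation_le_positive_variation[of r s D1] variation_le_positive_variation[of s t D2] assms by simp
qed

lemma positive_variation_mono:
  assumes "a \<le> s" "s \<le> t" "t \<le> b"
  shows "positive_variation f a s \<le> positive_variation f a t"
proof (rule positive_variation_leI)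
  fix D assume "strict_disjoint_intervals a s D"
  then have "strict_disjoint_intervals a t D"
    using assms disjoint_intervals_mono[of a s D a t] by (auto simp: strict_disjoint_intervals_def)
  then show "(\<Sum>(s, t)\<in>D. f t - f s) \<le> positive_variation f a t"
    using variation_le_positive_variation assms by simp
qed

text \<open>A family for \<open>{a..s}\<close> can be enlarged by the interval
  \<open>(s, t)\<close>. This is what makes the difference of \<open>positive_variation f a\<close>
  and \<open>f\<close> monotone.\<close>

lemma positive_variation_increment:
  assumes "a \<le> s" "s < t" "t \<le> b"
  shows "positive_variation f a s + (f t - f s) \<le> positive_variation f a t"
proof -
  have "positive_variation f a s \<le> positive_variation f a t - (f t - f s)"
  proof (rule positive_variation_leI)
    fix D assume D: "strict_disjoint_intervals a s D"
    then have fin: "finite D" and Ds: "\<And>p. p \<in> D \<Longrightarrow> a \<le> fst p \<and> fst p < snd p \<and> snd p \<le> s"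
      by (auto simp: strict_disjoint_intervals_def disjoint_intervals_def)
    have nin: "(s, t) \<notin> D" using Ds[of "(s, t)"] assms by auto
    have "strict_disjoint_intervals a t (insert (s, t) D)"
      unfolding strict_disjoint_intervals_def disjoint_intervals_def
    proof (intro conjI)
      show "pairwise (\<lambda>(s, t) (s', t'). {s<..<t} \<inter> {s'<..<t'} = {}) (insert (s, t) D)"
        using D Ds unfolding pairwise_insert strict_disjoint_intervals_def disjoint_intervals_def by fastforce
    qed (use fin Ds assms in \<open>fastforce+\<close>)
    then have "(\<Sum>(s, t)\<in>insert (s, t) D. f t - f s) \<le> positive_variation f a t"
      using variation_le_positive_variation assms by simp
    then show "(\<Sum>(s, t)\<in>D. f t - f s) \<le> positive_variation f a t - (f t - f s)"
      using fin nin by simp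
  qed
  then show ?thesis by simp
qed

text \<open>Inside each interval of a short family a nearly optimal family for the positive
  variation is chosen. Together these form a family of at most the same total length, to which the
  absolute continuity of \<open>f\<close> applies.\<close>

lemma abs_continuous_on_positive_variation:
  shows "abs_continuous_on a b (positive_variation f a)"
  unfolding abs_continuous_on_iff
proof (intro allI impI)
  let ?P = "positive_variation f a"
  fix \<epsilon> :: real assume "\<epsilon> > 0"
  then have "\<epsilon> / 2 > 0" by simp
  obtain d where d: "d > 0" "\<And>D. disjoint_intervals a b D \<Longrightarrow> (\<Sum>(s, t)\<in>D. t - s) < d \<Longrightarrow>
      (\<Sum>(s, t)\<in>D. dist (f s) (f t)) < \<epsilon> / 2"
    using abs_continuous_onE[OF f \<open>\<epsilon> / 2 > 0\<close>] by metis
  show "\<exists>\<delta>>0. \<forall>D. disjoint_intervals a b D \<longrightarrow> (\<Sum>(s, t)\<in>D. t - s) < \<delta> \<longrightarrow>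
      (\<Sum>(s, t)\<in>D. dist (?P s) (?P t)) < \<epsilon>"
  proof (intro exI[of _ d] conjI allI impI)
    fix D assume D: "disjoint_intervals a b D" and len: "(\<Sum>(s, t)\<in>D. t - s) < d"
    have fin: "finite D" and Ds: "\<And>p. p \<in> D \<Longrightarrow> a \<le> fst p \<and> fst p \<le> snd p \<and> snd p \<le> b"
      using D by (auto simp: disjoint_intervals_def)
    \<comment> \<open>Each of the \<open>card D\<close> choices may miss its supremum by
      \<open>\<eta>\<close>, at most \<open>\<epsilon> / 2\<close> altogether; \<open>+ 1\<close>
      covers the empty family.\<close>
    define \<eta> where "\<eta> = \<epsilon> / (2 * (real (card D) + 1))"
    have "\<eta> > 0" using \<open>\<epsilon> > 0\<close> by (simp add: \<eta>_def)
    have "\<exists>E. strict_disjoint_intervals (fst p) (snd p) E \<and> positive_variation f (fst p) (snd p) \<le> (\<Sum>(s, t)\<in>E. f t - f s) + \<eta>"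
      for p
    proof (rule ccontr)
      assume *: "\<not> ?thesis"
      have "positive_variation f (fst p) (snd p) \<le> positive_variation f (fst p) (snd p) - \<eta>"
        by (rule positive_variation_leI) (use * in force)
      then show False using \<open>\<eta> > 0\<close> by simp
    qed
    then obtain E where E: "\<And>p. strict_disjoint_intervals (fst p) (snd p) (E p)"
      and Ev: "\<And>p. positive_variation f (fst p) (snd p) \<le> (\<Sum>(s, t)\<in>E p. f t - f s) + \<eta>"
      by metis
    have Es: "\<And>p r. r \<in> E p \<Longrightarrow> fst p \<le> fst r \<and> fst r < snd r \<and> snd r \<le> snd p" and finE: "\<And>p. finite (E p)"
      using E by (fastforce simp: strict_disjoint_intervals_def disjoint_intervals_def)+
    have disj: "{fst r<..<snd r} \<inter> {fst r'<..<snd r'} = {}" if "p \<in> D" "p' \<in> D" "p \<noteq> p'" "r \<in> E p" "r' \<in> E p'" for p p' r r'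
    proof -
      have "{fst p<..<snd p} \<inter> {fst p'<..<snd p'} = {}"
        using D that unfolding disjoint_intervals_def pairwise_def by fastforce
      moreover have "{fst r<..<snd r} \<subseteq> {fst p<..<snd p}" "{fst r'<..<snd r'} \<subseteq> {fst p'<..<snd p'}"
        using Es[OF that(4)] Es[OF that(5)] by auto
      ultimately show ?thesis by blast
    qed
    \<comment> \<open>An interval shared by two of the chosen families would lie in two members of
      \<open>D\<close> with disjoint interiors. Strictness excludes this, so sums over the union
      split.\<close>
    have disjE: "\<forall>p\<in>D. \<forall>p'\<in>D. p \<noteq> p' \<longrightarrow> E p \<inter> E p' = {}"
    proof (intro ballI impI)
      fix p p' assume p: "p \<in> D" "p' \<in> D" "p \<noteq> p'"
      show "E p \<inter> E p' = {}"
      proof (rule ccontr)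
        assume "E p \<inter> E p' \<noteq> {}"
        then obtain r where r: "r \<in> E p" "r \<in> E p'" by auto
        then show False using disj[OF p r] Es[OF r(1)] by auto
      qed
    qed
    define U where "U = (\<Union>p\<in>D. E p)"
    have "disjoint_intervals a b U"
      unfolding disjoint_intervals_def
    proof (intro conjI)
      show "finite U" using fin finE by (simp add: U_def)
      show "\<forall>(s, t)\<in>U. a \<le> s \<and> s \<le> t \<and> t \<le> b"
        using Ds Es unfolding U_def by fastforce
      show "pairwise (\<lambda>(s, t) (s', t'). {s<..<t} \<inter> {s'<..<t'} = {}) U"
      proof (rule pairwiseI)
        fix r r' assume r: "r \<in> U" "r' \<in> U" "r \<noteq> r'"
        then obtain p p' where p: "p \<in> D" "r \<in> E p" "p' \<in> D" "r' \<in> E p'" by (auto simp: U_def)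
        have "{fst r<..<snd r} \<inter> {fst r'<..<snd r'} = {}"
        proof (cases "p = p'")
          case True
          then show ?thesis using E[of p] p r unfolding strict_disjoint_intervals_def disjoint_intervals_def pairwise_def
            by fastforce
        qed (use disj p in blast)
        then show "(\<lambda>(s, t) (s', t'). {s<..<t} \<inter> {s'<..<t'} = {}) r r'"
          by (simp add: case_prod_beta)
      qed
    qed
    moreover have sumU: "(\<Sum>r\<in>U. h r) = (\<Sum>p\<in>D. \<Sum>r\<in>E p. h r)" for h :: "real \<times> real \<Rightarrow> real"
      unfolding U_def by (rule sum.UNION_disjoint) (use fin finE disjE in auto)
    moreover have "(\<Sum>(s, t)\<in>U. t - s) < d"
    proof -
      have "(\<Sum>(s, t)\<in>U. t - s) \<le> (\<Sum>(s, t)\<in>D. t - s)"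
        unfolding sumU
      proof (rule sum_mono)
        fix p assume "p \<in> D"
        then have "(\<Sum>(s, t)\<in>E p. t - s) \<le> snd p - fst p"
          using E[of p] Ds by (intro sum_length_le) (auto simp: strict_disjoint_intervals_def)
        then show "(\<Sum>(s, t)\<in>E p. t - s) \<le> (case p of (s, t) \<Rightarrow> t - s)" by (simp add: case_prod_beta)
      qed
      then show ?thesis using len by simp
    qed
    ultimately have "(\<Sum>(s, t)\<in>U. dist (f s) (f t)) < \<epsilon> / 2" using d(2) by blast
    then have "(\<Sum>(s, t)\<in>U. f t - f s) < \<epsilon> / 2" using sum_diff_le_sum_dist[of f U] by linarith
    then have Uv: "(\<Sum>p\<in>D. \<Sum>(s, t)\<in>E p. f t - f s) < \<epsilon> / 2" by (simp add: sumU)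
    have "(\<Sum>(s, t)\<in>D. dist (?P s) (?P t)) \<le> (\<Sum>p\<in>D. (\<Sum>(s, t)\<in>E p. f t - f s) + \<eta>)"
    proof (rule sum_mono)
      fix p assume p: "p \<in> D"
      have "dist (?P (fst p)) (?P (snd p)) = ?P (snd p) - ?P (fst p)"
        using positive_variation_mono[of "fst p" "snd p"] Ds[OF p] by (auto simp: dist_real_def)
      also have "\<dots> \<le> positive_variation f (fst p) (snd p)"
        using positive_variation_subadditive[of a "fst p" "snd p"] Ds[OF p] by simp
      also have "\<dots> \<le> (\<Sum>(s, t)\<in>E p. f t - f s) + \<eta>" by (rule Ev)
      finally show "(case p of (s, t) \<Rightarrow> dist (?P s) (?P t)) \<le> (\<Sum>(s, t)\<in>E p. f t - f s) + \<eta>"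
        by (simp add: case_prod_beta)
    qed
    also have "\<dots> < \<epsilon> / 2 + real (card D) * \<eta>" using Uv by (simp add: sum.distrib)
    also have "real (card D) * \<eta> \<le> \<epsilon> / 2"
      using \<open>\<epsilon> > 0\<close> by (simp add: \<eta>_def field_simps)
    finally show "(\<Sum>(s, t)\<in>D. dist (?P s) (?P t)) < \<epsilon>" by simp
  qed (rule d)
qed

end

text \<open>Jordan decomposition: \<open>f\<close> is the difference of its positive variation
  \<open>?P\<close> and of \<open>?P - f\<close>, both monotone and absolutely continuous.\<close>

lemma abs_continuous_on_real_imp_integral:
  fixes f :: "real \<Rightarrow> real"
  assumes ab: "a \<le> b" and f: "abs_continuous_on a b f"
  shows "\<exists>g. g absolutely_integrable_on {a..b} \<and> (\<forall>t\<in>{a..b}. f t = f a + integral {a..t} g)"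
proof -
  let ?P = "positive_variation f a"
  have P: "abs_continuous_on a b ?P" by (rule abs_continuous_on_positive_variation[OF f])
  have mP: "mono_on {a..b} ?P"
    using positive_variation_mono[OF f] by (auto simp: mono_on_def)
  obtain g where g: "g absolutely_integrable_on {a..b}" "\<And>t. t \<in> {a..b} \<Longrightarrow> ?P t = ?P a + integral {a..t} g"
    using mono_abs_continuous_on_imp_integral[OF ab P mP] by blast
  have Q: "abs_continuous_on a b (\<lambda>t. ?P t - f t)"
    by (rule abs_continuous_on_le[OF P f, of 1]) (auto simp: dist_real_def)
  have mQ: "mono_on {a..b} (\<lambda>t. ?P t - f t)"
  proof (rule mono_onI)
    fix s t assume "s \<in> {a..b}" "t \<in> {a..b}" "s \<le> t"
    then show "?P s - f s \<le> ?P t - f t"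
      using positive_variation_increment[OF f, of s t] by (cases "s = t") auto
  qed
  obtain h where h: "h absolutely_integrable_on {a..b}" "\<And>t. t \<in> {a..b} \<Longrightarrow> ?P t - f t = ?P a - f a + integral {a..t} h"
    using mono_abs_continuous_on_imp_integral[OF ab Q mQ] by blast
  have "f t = f a + integral {a..t} (\<lambda>x. g x - h x)" if t: "t \<in> {a..b}" for t
  proof -
    have "g integrable_on {a..t}" "h integrable_on {a..t}"
      using t by (auto intro: integrable_on_subinterval[OF set_lebesgue_integral_eq_integral(1)[OF g(1)]]
          integrable_on_subinterval[OF set_lebesgue_integral_eq_integral(1)[OF h(1)]])
    then have "integral {a..t} (\<lambda>x. g x - h x) = integral {a..t} g - integral {a..t} h"
      by (rule Henstock_Kurzweil_Integration.integral_diff)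
    then show ?thesis using g(2)[OF t] h(2)[OF t] by simp
  qed
  then show ?thesis using set_integral_diff(1)[OF g(1) h(1)] by blast
qed

section \<open>Densities and closure properties of absolutely continuous curves\<close>

lemma absolutely_integrable_subinterval:
  fixes g :: "real \<Rightarrow> 'e::euclidean_space"
  assumes "g absolutely_integrable_on {a..b}" "a \<le> c" "d \<le> b"
  shows "g absolutely_integrable_on {c..d}" "g integrable_on {c..d}"
proof -
  show "g absolutely_integrable_on {c..d}"
    by (rule set_integrable_subset[OF assms(1)]) (use assms in auto)
  then show "g integrable_on {c..d}" by (rule set_lebesgue_integral_eq_integral(1))
qed

lemma abs_continuous_on_const [simp]: "abs_continuous_on a b (\<lambda>_. c)"
  unfolding abs_continuous_on_def by (auto intro: exI[of _ 1] simp: case_prod_beta)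

lemma abs_continuous_on_cong:
  assumes "abs_continuous_on a b f" "\<And>t. t \<in> {a..b} \<Longrightarrow> g t = f t"
  shows "abs_continuous_on a b g"
  by (rule abs_continuous_on_le[OF assms(1) assms(1), of 1]) (use assms(2) in auto)

lemma abs_continuous_on_imp_integral:
  fixes f :: "real \<Rightarrow> 'e::euclidean_space"
  assumes ab: "a \<le> b" and f: "abs_continuous_on a b f"
  shows "\<exists>g. g absolutely_integrable_on {a..b} \<and> (\<forall>t\<in>{a..b}. f t = f a + integral {a..t} g)"
proof -
  have "abs_continuous_on a b (\<lambda>t. f t \<bullet> i)" if "i \<in> Basis" for i
  proof (rule abs_continuous_on_le[OF f f, of 1])
    fix s t
    have "\<bar>(f s - f t) \<bullet> i\<bar> \<le> norm (f s - f t)" using Basis_le_norm[OF that] .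
    then show "dist (f s \<bullet> i) (f t \<bullet> i) \<le> 1 * (dist (f s) (f t) + dist (f s) (f t))"
      by (simp add: dist_norm inner_diff_left)
  qed auto
  then have "\<exists>g. g absolutely_integrable_on {a..b} \<and> (\<forall>t\<in>{a..b}. f t \<bullet> i = f a \<bullet> i + integral {a..t} g)"
    if "i \<in> Basis" for i using abs_continuous_on_real_imp_integral[OF ab] that by blast
  then obtain g where g: "\<And>i. i \<in> Basis \<Longrightarrow> g i absolutely_integrable_on {a..b}"
    "\<And>i t. i \<in> Basis \<Longrightarrow> t \<in> {a..b} \<Longrightarrow> f t \<bullet> i = f a \<bullet> i + integral {a..t} (g i)"
    by metis
  define h where "h t = (\<Sum>i\<in>Basis. g i t *\<^sub>R i)" for t
  have hi: "h t \<bullet> i = g i t" if "i \<in> Basis" for i t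
    using that by (simp add: h_def)
  have h: "h absolutely_integrable_on {a..b}"
    unfolding h_def
    by (intro absolutely_integrable_sum finite_Basis absolutely_integrable_scaleR_right g)
  have "f t = f a + integral {a..t} h" if t: "t \<in> {a..b}" for t
  proof (rule euclidean_eqI)
    fix i :: 'e assume i: "i \<in> Basis"
    have "h integrable_on {a..t}" using absolutely_integrable_subinterval(2)[OF h] t by auto
    then have "integral {a..t} h \<bullet> i = integral {a..t} (\<lambda>s. h s \<bullet> i)"
      by (rule integral_component_eq[symmetric])
    then show "f t \<bullet> i = (f a + integral {a..t} h) \<bullet> i"
      using g(2)[OF i t] by (simp add: inner_add_left hi[OF i])
  qed
  then show ?thesis using h by blast
qed

text \<open>The functions agree on the closed interval only, while the derivative is two-sided, so
  nothing is known at the endpoints; these form a null set.\<close>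

lemma has_vector_derivative_transform_AE:
  fixes f :: "real \<Rightarrow> 'e::real_normed_vector"
  assumes g: "AE t\<in>{a..b} in lebesgue. (g has_vector_derivative d t) (at t)"
    and eq: "\<And>t. t \<in> {a..b} \<Longrightarrow> f t = g t"
  shows "AE t\<in>{a..b} in lebesgue. (f has_vector_derivative d t) (at t)"
proof -
  have "AE t in lebesgue. t \<notin> {a, b}"
    by (rule AE_not_in) (simp flip: negligible_iff_null_sets)
  then show ?thesis
    using g
  proof (eventually_elim, intro impI)
    fix t assume "t \<notin> {a, b}" "t \<in> {a..b} \<longrightarrow> (g has_vector_derivative d t) (at t)" "t \<in> {a..b}"
    then have "(g has_vector_derivative d t) (at t)" "t \<in> {a<..<b}" by auto
    then show "(f has_vector_derivative d t) (at t)"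
      using has_vector_derivative_transform_within_open[of g "d t" t "{a<..<b}" f] eq by auto
  qed
qed

lemma AE_has_vector_derivative_integral_form:
  fixes f :: "real \<Rightarrow> 'e::euclidean_space"
  assumes g: "g absolutely_integrable_on {a..b}" and f: "\<And>t. t \<in> {a..b} \<Longrightarrow> f t = c + integral {a..t} g"
  shows "AE t\<in>{a..b} in lebesgue. (f has_vector_derivative g t) (at t)"
proof (rule has_vector_derivative_transform_AE)
  have "AE t\<in>{a..b} in lebesgue. ((\<lambda>t. integral {a..t} g) has_vector_derivative g t) (at t)"
    by (rule AE_has_vector_derivative_indefinite_integral[OF set_lebesgue_integral_eq_integral(1)[OF g]])
  then show "AE t\<in>{a..b} in lebesgue. ((\<lambda>t. c + integral {a..t} g) has_vector_derivative g t) (at t)"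
  proof eventually_elim
    case (elim t)
    then show ?case by (auto intro!: derivative_eq_intros)
  qed
qed (rule f)

lemma abs_continuous_on_AE_derivative:
  fixes f :: "real \<Rightarrow> 'e::euclidean_space"
  assumes ab: "a \<le> b" and f: "abs_continuous_on a b f"
  obtains g where "g absolutely_integrable_on {a..b}" "\<And>t. t \<in> {a..b} \<Longrightarrow> f t = f a + integral {a..t} g"
    "AE t\<in>{a..b} in lebesgue. (f has_vector_derivative g t) (at t)"
proof -
  obtain g where g: "g absolutely_integrable_on {a..b}" "\<forall>t\<in>{a..b}. f t = f a + integral {a..t} g"
    using abs_continuous_on_imp_integral[OF ab f] by blast
  then have "AE t\<in>{a..b} in lebesgue. (f has_vector_derivative g t) (at t)"
    by (intro AE_has_vector_derivative_integral_form[where c="f a"]) blast+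
  then show ?thesis using that g by blast
qed

text \<open>Gluing the densities avoids cutting intervals that straddle \<open>b\<close>.\<close>

lemma abs_continuous_on_combine:
  fixes f :: "real \<Rightarrow> 'e::euclidean_space"
  assumes "a \<le> b" "b \<le> c" and f: "abs_continuous_on a b f" "abs_continuous_on b c f"
  shows "abs_continuous_on a c f"
proof -
  obtain g where g: "g absolutely_integrable_on {a..b}" "\<And>t. t \<in> {a..b} \<Longrightarrow> f t = f a + integral {a..t} g"
    using abs_continuous_on_imp_integral[OF assms(1) f(1)] by blast
  obtain h where h: "h absolutely_integrable_on {b..c}" "\<And>t. t \<in> {b..c} \<Longrightarrow> f t = f b + integral {b..t} h"
    using abs_continuous_on_imp_integral[OF assms(2) f(2)] by blast
  \<comment> \<open>The second piece is half open, so that the two densities are not added at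
    \<open>b\<close>.\<close>
  define k where "k t = (if t \<in> {a..b} then g t else 0) + (if t \<in> {b<..c} then h t else 0)" for t
  have "(\<lambda>t. if t \<in> {a..b} then g t else 0) absolutely_integrable_on {a..c}"
    by (rule set_integrable_subset[OF absolutely_integrable_restrict_UNIV[THEN iffD2, OF g(1)]]) auto
  moreover have "(\<lambda>t. if t \<in> {b<..c} then h t else 0) absolutely_integrable_on {a..c}"
  proof -
    have "h absolutely_integrable_on {b<..c}"
      by (rule set_integrable_subset[OF h(1)]) auto
    then show ?thesis
      by (rule set_integrable_subset[OF absolutely_integrable_restrict_UNIV[THEN iffD2]]) auto
  qed
  ultimately have k: "k absolutely_integrable_on {a..c}" unfolding k_def by (rule set_integral_add(1))
  have kg: "integral {a..t} k = integral {a..t} g" if "t \<in> {a..b}" for t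
    by (rule integral_cong) (use that in \<open>auto simp: k_def\<close>)
  have "f t = f a + integral {a..t} k" if t: "t \<in> {a..c}" for t
  proof (cases "t \<le> b")
    case True
    then show ?thesis using g(2)[of t] kg[of t] t by simp
  next
    case False
    have "integral {b..t} k = integral {b..t} h"
      by (rule integral_spike[of "{b}"]) (use t assms in \<open>auto simp: k_def\<close>)
    moreover have "integral {a..b} k + integral {b..t} k = integral {a..t} k"
      using False assms t
      by (intro Henstock_Kurzweil_Integration.integral_combine absolutely_integrable_subinterval(2)[OF k]) auto
    ultimately show ?thesis using g(2)[of b] h(2)[of t] kg[of b] False t assms by (simp add: algebra_simps)
  qed
  then show ?thesis by (rule abs_continuous_on_indefinite_integral[OF k])
qed

lemma abs_continuous_on_bounded:
  fixes f :: "real \<Rightarrow> 'e::real_normed_vector"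
  assumes "abs_continuous_on a b f"
  obtains B where "B > 0" "\<And>t. t \<in> {a..b} \<Longrightarrow> norm (f t) \<le> B"
  using compact_imp_bounded[OF compact_continuous_image[OF abs_continuous_on_imp_continuous_on[OF assms] compact_Icc]]
  unfolding bounded_pos by auto

lemma (in bounded_linear) abs_continuous_on:
  assumes g: "abs_continuous_on a b g"
  shows "abs_continuous_on a b (\<lambda>t. f (g t))"
proof -
  obtain K where K: "K > 0" "\<And>x. norm (f x) \<le> norm x * K" using pos_bounded by blast
  show ?thesis
  proof (rule abs_continuous_on_le[OF g g, of K])
    fix s t
    have "dist (f (g s)) (f (g t)) \<le> K * dist (g s) (g t)"
      using K(2)[of "g s - g t"] by (simp add: dist_norm diff mult.commute)
    also have "\<dots> \<le> K * (dist (g s) (g t) + dist (g s) (g t))" using K by (intro mult_left_mono) auto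
    finally show "dist (f (g s)) (f (g t)) \<le> K * (dist (g s) (g t) + dist (g s) (g t))" .
  qed (use K in auto)
qed

lemma abs_continuous_on_bilinear:
  assumes h: "bounded_bilinear h" and f: "abs_continuous_on a b f" and g: "abs_continuous_on a b g"
  shows "abs_continuous_on a b (\<lambda>t. h (f t) (g t))"
proof -
  obtain K where K: "K > 0" "\<And>x y. norm (h x y) \<le> norm x * norm y * K" using bounded_bilinear.pos_bounded[OF h] by blast
  obtain F where F: "F > 0" "\<And>t. t \<in> {a..b} \<Longrightarrow> norm (f t) \<le> F" using abs_continuous_on_bounded[OF f] by blast
  obtain G where G: "G > 0" "\<And>t. t \<in> {a..b} \<Longrightarrow> norm (g t) \<le> G" using abs_continuous_on_bounded[OF g] by blast
  show ?thesis
  proof (rule abs_continuous_on_le[OF f g, of "K * (F + G)"])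
    fix s t assume st: "a \<le> s" "s \<le> t" "t \<le> b"
    have "h (f s) (g s) - h (f t) (g t) = h (f s - f t) (g s) + h (f t) (g s - g t)"
      by (simp add: bounded_bilinear.diff_left[OF h] bounded_bilinear.diff_right[OF h])
    then have "dist (h (f s) (g s)) (h (f t) (g t)) \<le> norm (h (f s - f t) (g s)) + norm (h (f t) (g s - g t))"
      unfolding dist_norm by (metis norm_triangle_ineq)
    also have "\<dots> \<le> norm (f s - f t) * norm (g s) * K + norm (f t) * norm (g s - g t) * K"
      by (intro add_mono K)
    also have "\<dots> \<le> norm (f s - f t) * (F + G) * K + (F + G) * norm (g s - g t) * K"
      using F G K st by (intro add_mono mult_right_mono mult_left_mono) (auto intro: order.trans[OF F(2)] order.trans[OF G(2)])
    also have "\<dots> = K * (F + G) * (dist (f s) (f t) + dist (g s) (g t))"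
      by (simp add: dist_norm algebra_simps)
    finally show "dist (h (f s) (g s)) (h (f t) (g t)) \<le> K * (F + G) * (dist (f s) (f t) + dist (g s) (g t))" .
  qed (use K F G in auto)
qed

lemmas abs_continuous_on_scaleR = abs_continuous_on_bilinear[OF bounded_bilinear_scaleR]
lemmas abs_continuous_on_mult = abs_continuous_on_bilinear[OF bounded_bilinear_mult]

lemma abs_continuous_on_add:
  fixes f g :: "real \<Rightarrow> 'e::real_normed_vector"
  assumes "abs_continuous_on a b f" "abs_continuous_on a b g"
  shows "abs_continuous_on a b (\<lambda>t. f t + g t)"
  by (rule abs_continuous_on_le[OF assms, of 1]) (auto simp: dist_norm intro: norm_diff_triangle_ineq)

lemma abs_continuous_on_sum:
  fixes f :: "'i \<Rightarrow> real \<Rightarrow> 'e::real_normed_vector"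
  assumes "\<And>i. i \<in> I \<Longrightarrow> abs_continuous_on a b (f i)"
  shows "abs_continuous_on a b (\<lambda>t. \<Sum>i\<in>I. f i t)"
  using assms by (induction I rule: infinite_finite_induct) (auto intro: abs_continuous_on_add)

text \<open>Only directional derivatives are assumed continuous. Their bounds on the finitely many
  basis vectors over a compact ball bound the operator norm there, and the ball is convex, so the
  mean value inequality applies.\<close>

lemma locally_lipschitz_if_C1:
  fixes f :: "'e::euclidean_space \<Rightarrow> 'f::real_normed_vector"
  assumes S: "open S" "x \<in> S" and f: "\<And>x. x \<in> S \<Longrightarrow> f differentiable at x"
    and f': "\<And>v. continuous_on S (\<lambda>x. frechet_derivative f (at x) v)"
  obtains r L where "r > 0" "L \<ge> 0" "\<And>y z. y \<in> ball x r \<Longrightarrow> z \<in> ball x r \<Longrightarrow> dist (f y) (f z) \<le> L * dist y z"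
proof -
  obtain r where r: "r > 0" "cball x r \<subseteq> S" using S open_contains_cball_eq by blast
  have "\<exists>B. \<forall>y\<in>cball x r. norm (frechet_derivative f (at y) v) \<le> B" for v
  proof -
    have "continuous_on (cball x r) (\<lambda>x. frechet_derivative f (at x) v)"
      using f' r(2) by (rule continuous_on_subset)
    then have "bounded ((\<lambda>x. frechet_derivative f (at x) v) ` cball x r)"
      by (intro compact_imp_bounded compact_continuous_image) auto
    then show ?thesis unfolding bounded_iff by auto
  qed
  then obtain B where B: "\<And>v y. y \<in> cball x r \<Longrightarrow> norm (frechet_derivative f (at y) v) \<le> B v" by metis
  define L where "L = (\<Sum>i\<in>Basis. \<bar>B i\<bar>)"
  have on: "onorm (frechet_derivative f (at y)) \<le> L" if y: "y \<in> cball x r" for y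
  proof (rule onorm_bound)
    have bl: "bounded_linear (frechet_derivative f (at y))"
      using f y r(2) frechet_derivative_works has_derivative_bounded_linear by blast
    fix v
    have "frechet_derivative f (at y) v = frechet_derivative f (at y) (\<Sum>i\<in>Basis. (v \<bullet> i) *\<^sub>R i)"
      by (simp add: euclidean_representation)
    also have "\<dots> = (\<Sum>i\<in>Basis. (v \<bullet> i) *\<^sub>R frechet_derivative f (at y) i)"
      using bl by (simp add: linear_sum linear_scale bounded_linear.linear)
    also have "norm \<dots> \<le> (\<Sum>i\<in>Basis. \<bar>v \<bullet> i\<bar> * norm (frechet_derivative f (at y) i))"
      by (rule order.trans[OF norm_sum]) simp
    also have "\<dots> \<le> (\<Sum>i\<in>Basis. norm v * \<bar>B i\<bar>)"
      by (intro sum_mono mult_mono Basis_le_norm) (auto intro: order.trans[OF B[OF y]])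
    also have "\<dots> = L * norm v" by (simp add: L_def sum_distrib_left[symmetric])
    finally show "norm (frechet_derivative f (at y) v) \<le> L * norm v" .
  qed (simp add: L_def sum_nonneg)
  show ?thesis
  proof (rule that[of r L])
    fix y z assume yz: "y \<in> ball x r" "z \<in> ball x r"
    have "norm (f y - f z) \<le> L * norm (y - z)"
    proof (rule differentiable_bound[where S="cball x r" and f'="\<lambda>x. frechet_derivative f (at x)"])
      show "(f has_derivative frechet_derivative f (at w)) (at w within cball x r)" if "w \<in> cball x r" for w
        using that r(2) f frechet_derivative_works has_derivative_at_withinI by blast
    qed (use yz on in auto)
    then show "dist (f y) (f z) \<le> L * dist y z" by (simp add: dist_norm)
  qed (use r in \<open>auto simp: L_def sum_nonneg\<close>)
qed

text \<open>Absolute continuity adds up over adjacent intervals, so bisection reduces it to short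
  intervals around each point.\<close>

lemma abs_continuous_on_local:
  fixes f :: "real \<Rightarrow> 'e::euclidean_space"
  assumes ab: "a \<le> b"
    and loc: "\<And>x. x \<in> {a..b} \<Longrightarrow> \<exists>d>0. \<forall>s t. a \<le> s \<and> s \<le> x \<and> x \<le> t \<and> t \<le> b \<and> t - s < d \<longrightarrow> abs_continuous_on s t f"
  shows "abs_continuous_on a b f"
proof -
  have "a \<le> a \<longrightarrow> b \<le> b \<longrightarrow> abs_continuous_on a b f"
    using ab
  proof (induction rule: Bolzano[where P="\<lambda>s t. a \<le> s \<longrightarrow> t \<le> b \<longrightarrow> abs_continuous_on s t f"])
    case (trans r s t)
    then show ?case by (auto intro: abs_continuous_on_combine)
  next
    case (local x)
    then obtain d where "d > 0" "\<forall>s t. a \<le> s \<and> s \<le> x \<and> x \<le> t \<and> t \<le> b \<and> t - s < d \<longrightarrow> abs_continuous_on s t f"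
      using loc[of x] by auto
    then show ?case by (intro exI[of _ d]) auto
  qed
  then show ?thesis by simp
qed

text \<open>Continuity in the form that the local step of \<open>Bolzano\<close> asks for: one
  length that works for all short intervals containing \<open>t\<close>.\<close>

lemma continuous_on_short_intervals:
  fixes x :: "real \<Rightarrow> 'a::topological_space"
  assumes x: "continuous_on {a..b} x" and t: "t \<in> {a..b}" and U: "open U" "x t \<in> U"
  shows "\<exists>d>0. \<forall>s u. a \<le> s \<and> s \<le> t \<and> t \<le> u \<and> u \<le> b \<and> u - s < d \<longrightarrow> x ` {s..u} \<subseteq> U"
proof -
  obtain A where A: "open A" "x -` U \<inter> {a..b} = A \<inter> {a..b}"
    using x U(1) unfolding continuous_on_open_invariant by metis
  then have "t \<in> A" using t U(2) by blast
  then obtain d where d: "d > 0" "ball t d \<subseteq> A" using A(1) open_contains_ball by blast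
  have "x r \<in> U" if "a \<le> s" "s \<le> t" "t \<le> u" "u \<le> b" "u - s < d" "r \<in> {s..u}" for s u r
  proof -
    have "r \<in> ball t d" using that by (auto simp: dist_real_def)
    then have "r \<in> x -` U \<inter> {a..b}" using that d(2) A(2) by auto
    then show ?thesis by simp
  qed
  then show ?thesis using d(1) by (intro exI[of _ d]) auto
qed

lemma abs_continuous_on_compose_C1:
  fixes f :: "'e::euclidean_space \<Rightarrow> 'f::euclidean_space"
  assumes S: "open S" and f: "\<And>x. x \<in> S \<Longrightarrow> f differentiable at x"
    and f': "\<And>v. continuous_on S (\<lambda>x. frechet_derivative f (at x) v)"
    and u: "abs_continuous_on a b u" "u ` {a..b} \<subseteq> S" and ab: "a \<le> b"
  shows "abs_continuous_on a b (\<lambda>t. f (u t))"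
proof (rule abs_continuous_on_local[OF ab])
  fix x assume x: "x \<in> {a..b}"
  obtain r L where rL: "r > 0" "L \<ge> 0" "\<And>y z. y \<in> ball (u x) r \<Longrightarrow> z \<in> ball (u x) r \<Longrightarrow> dist (f y) (f z) \<le> L * dist y z"
    by (rule locally_lipschitz_if_C1[OF S _ f f', of "u x"]) (use u(2) x in auto)
  obtain d where d: "d > 0" "\<And>s t. a \<le> s \<and> s \<le> x \<and> x \<le> t \<and> t \<le> b \<and> t - s < d \<Longrightarrow> u ` {s..t} \<subseteq> ball (u x) r"
    using continuous_on_short_intervals[OF abs_continuous_on_imp_continuous_on[OF u(1)] x, of "ball (u x) r"] rL(1) by auto
  show "\<exists>d>0. \<forall>s t. a \<le> s \<and> s \<le> x \<and> x \<le> t \<and> t \<le> b \<and> t - s < d \<longrightarrow> abs_continuous_on s t (\<lambda>t. f (u t))"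
  proof (intro exI[of _ d] conjI allI impI)
    fix s t assume st: "a \<le> s \<and> s \<le> x \<and> x \<le> t \<and> t \<le> b \<and> t - s < d"
    have us: "abs_continuous_on s t u" using abs_continuous_on_subinterval[OF u(1)] st by auto
    show "abs_continuous_on s t (\<lambda>t. f (u t))"
    proof (rule abs_continuous_on_le[OF us us rL(2)])
      fix p q assume "s \<le> p" "p \<le> q" "q \<le> t"
      then have "u p \<in> ball (u x) r" "u q \<in> ball (u x) r"
        using d(2)[OF st] unfolding image_subset_iff by auto
      then have "dist (f (u p)) (f (u q)) \<le> L * dist (u p) (u q)" by (rule rL(3))
      also have "\<dots> \<le> L * (dist (u p) (u q) + dist (u p) (u q))" using rL by (intro mult_left_mono) auto
      finally show "dist (f (u p)) (f (u q)) \<le> L * (dist (u p) (u q) + dist (u p) (u q))" .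
    qed
  qed (rule d)
qed

text \<open>Picard iteration for \<open>z' = h (B t) z\<close> with merely integrable
  \<open>B\<close>. The integral operator contracts the supremum norm because \<open>K\<close> times
  the integral of \<open>norm (B s)\<close> bounds its effect. The last conclusion keeps the
  solution close to its initial value, which later preserves the invertibility of a matrix
  solution.\<close>

lemma linear_ode_solution:
  fixes h :: "'b::euclidean_space \<Rightarrow> 'z::euclidean_space \<Rightarrow> 'z" and z0 :: 'z and B :: "real \<Rightarrow> 'b"
  assumes h: "bounded_bilinear h" and B: "B absolutely_integrable_on {a..b}" and ab: "a \<le> b"
    and K: "K \<ge> 0" "\<And>x y. norm (h x y) \<le> K * norm x * norm y"
    and small: "K * integral {a..b} (\<lambda>s. norm (B s)) \<le> \<theta>" "\<theta> \<le> 1 / 2"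
  obtains z where "continuous_on {a..b} z" "(\<lambda>s. h (B s) (z s)) absolutely_integrable_on {a..b}"
    "\<And>t. t \<in> {a..b} \<Longrightarrow> z t = z0 + integral {a..t} (\<lambda>s. h (B s) (z s))"
    "\<And>t. t \<in> {a..b} \<Longrightarrow> norm (z t - z0) \<le> 2 * \<theta> * norm z0"
proof -
  \<comment> \<open>Clamping time to \<open>{a..b}\<close> lets the operator act on bounded
    continuous functions on the whole line, a complete space to which the Banach fixed point theorem
    applies.\<close>
  define cl where "cl t = max a (min b t)" for t
  have cl: "cl t \<in> {a..b}" for t using ab by (auto simp: cl_def)
  have cl_id: "cl t = t" if "t \<in> {a..b}" for t using that by (auto simp: cl_def)
  have Bn: "(\<lambda>s. norm (B s)) integrable_on {a..t}" if "t \<le> b" for t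
    using absolutely_integrable_subinterval(1)[OF B, of a t] that by (auto simp: absolutely_integrable_on_def)
  have "bilinear h" using h bilinear_conv_bounded_bilinear by blast
  then have bil: "bilinear (\<lambda>x y. h y x)" unfolding bilinear_def by auto
  have int: "(\<lambda>s. h (B s) (z s)) absolutely_integrable_on {a..b}" if z: "continuous_on {a..b} z" for z
  proof (rule absolutely_integrable_bounded_measurable_product[OF bil _ _ _ B])
    show "z \<in> borel_measurable (lebesgue_on {a..b})"
      by (rule continuous_imp_measurable_on_sets_lebesgue[OF z]) auto
    show "bounded (z ` {a..b})"
      by (intro compact_imp_bounded compact_continuous_image z) auto
  qed auto
  have bound: "norm (integral {a..cl t} (\<lambda>s. h (B s) (z s))) \<le> \<theta> * N"
    if z: "continuous_on {a..b} z" and N: "\<And>s. s \<in> {a..b} \<Longrightarrow> norm (z s) \<le> N" for z N t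
  proof -
    have "N \<ge> 0" using N[of a] ab order.trans[OF norm_ge_zero] by auto
    have le: "norm (h (B s) (z s)) \<le> (K * N) * norm (B s)" if "s \<in> {a..cl t}" for s
    proof -
      have "norm (h (B s) (z s)) \<le> K * norm (B s) * norm (z s)" by (rule K)
      also have "\<dots> \<le> K * norm (B s) * N" using K(1) N[of s] that cl[of t] by (intro mult_left_mono) auto
      finally show ?thesis by (simp add: algebra_simps)
    qed
    have "norm (integral {a..cl t} (\<lambda>s. h (B s) (z s))) \<le> integral {a..cl t} (\<lambda>s. (K * N) * norm (B s))"
      using le cl[of t] Bn[of "cl t"] absolutely_integrable_subinterval(2)[OF int[OF z], of a "cl t"]
      by (intro integral_norm_bound_integral integrable_on_mult_right) auto
    also have "\<dots> = (K * N) * integral {a..cl t} (\<lambda>s. norm (B s))" by simp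
    also have "\<dots> \<le> (K * N) * integral {a..b} (\<lambda>s. norm (B s))"
      using cl[of t] Bn \<open>N \<ge> 0\<close> K(1) by (intro mult_left_mono integral_subset_le) auto
    also have "\<dots> \<le> \<theta> * N" using mult_right_mono[OF small(1) \<open>N \<ge> 0\<close>] by (simp add: algebra_simps)
    finally show ?thesis .
  qed
  define T where "T z = Bcontfun (\<lambda>t. z0 + integral {a..cl t} (\<lambda>s. h (B s) (apply_bcontfun z s)))" for z :: "real \<Rightarrow>\<^sub>C 'z"
  have zc: "continuous_on {a..b} (apply_bcontfun z)" for z :: "real \<Rightarrow>\<^sub>C 'z" by auto
  have T: "apply_bcontfun (T z) t = z0 + integral {a..cl t} (\<lambda>s. h (B s) (apply_bcontfun z s))" for z t
  proof -
    have "continuous_on UNIV (\<lambda>t. z0 + integral {a..cl t} (\<lambda>s. h (B s) (apply_bcontfun z s)))"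
    proof (intro continuous_intros)
      have "continuous_on {a..b} (\<lambda>t. integral {a..t} (\<lambda>s. h (B s) (apply_bcontfun z s)))"
        by (rule indefinite_integral_continuous_1[OF set_lebesgue_integral_eq_integral(1)[OF int[OF zc]]])
      moreover have "continuous_on UNIV cl" unfolding cl_def[abs_def] by (intro continuous_intros)
      ultimately show "continuous_on UNIV (\<lambda>t. integral {a..cl t} (\<lambda>s. h (B s) (apply_bcontfun z s)))"
        by (rule continuous_on_compose2) (use cl in auto)
    qed
    then have "(\<lambda>t. z0 + integral {a..cl t} (\<lambda>s. h (B s) (apply_bcontfun z s))) \<in> bcontfun"
    proof (rule bcontfun_normI)
      fix t
      show "norm (z0 + integral {a..cl t} (\<lambda>s. h (B s) (apply_bcontfun z s))) \<le> norm z0 + \<theta> * norm z"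
        by (rule order.trans[OF norm_triangle_ineq]) (auto intro!: bound zc norm_bounded)
    qed
    then show ?thesis unfolding T_def by (simp add: Bcontfun_inverse)
  qed
  have "dist (T z) (T w) \<le> 1 / 2 * dist z w" for z w
  proof (rule dist_bound)
    fix t
    have I: "(\<lambda>s. h (B s) (apply_bcontfun u s)) integrable_on {a..cl t}" for u
      using absolutely_integrable_subinterval(2)[OF int[OF zc], of a "cl t"] cl[of t] by simp
    have "integral {a..cl t} (\<lambda>s. h (B s) (apply_bcontfun z s - apply_bcontfun w s))
        = integral {a..cl t} (\<lambda>s. h (B s) (apply_bcontfun z s)) - integral {a..cl t} (\<lambda>s. h (B s) (apply_bcontfun w s))"
      unfolding bounded_bilinear.diff_right[OF h] by (rule Henstock_Kurzweil_Integration.integral_diff[OF I I])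
    then have "dist (apply_bcontfun (T z) t) (apply_bcontfun (T w) t)
        = norm (integral {a..cl t} (\<lambda>s. h (B s) (apply_bcontfun z s - apply_bcontfun w s)))"
      unfolding T dist_norm by simp
    also have "\<dots> \<le> \<theta> * dist z w"
      by (rule bound) (auto intro!: continuous_intros dist_bounded simp flip: dist_norm)
    also have "\<dots> \<le> 1 / 2 * dist z w" using small by (intro mult_right_mono) auto
    finally show "dist (apply_bcontfun (T z) t) (apply_bcontfun (T w) t) \<le> 1 / 2 * dist z w" .
  qed
  then obtain z where z: "T z = z"
    using banach_fix_type[of "1/2" T] by auto
  have zt: "apply_bcontfun z t = z0 + integral {a..cl t} (\<lambda>s. h (B s) (apply_bcontfun z s))" for t
    using T[of z t] z by simp
  have d: "norm (apply_bcontfun z t - z0) \<le> \<theta> * norm z" for t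
    using bound[OF zc, of z "norm z" t] zt[of t] by (simp add: norm_bounded)
  have "norm z \<le> norm z0 + \<theta> * norm z"
  proof (rule norm_bound)
    fix t show "norm (apply_bcontfun z t) \<le> norm z0 + \<theta> * norm z"
      using norm_triangle_sub[of "apply_bcontfun z t" z0] d[of t] by linarith
  qed
  moreover have "\<theta> * norm z \<le> 1 / 2 * norm z" using small(2) by (intro mult_right_mono) auto
  \<comment> \<open>The part \<open>\<theta> * norm z\<close> is absorbed because it is at most half
    of \<open>norm z\<close>; this is the origin of the factor \<open>2\<close> in the final
    bound.\<close>
  ultimately have nz: "norm z \<le> 2 * norm z0" by simp
  have "0 \<le> integral {a..b} (\<lambda>s. norm (B s))" by (rule integral_nonneg) (use Bn in auto)
  then have "\<theta> \<ge> 0" using small(1) K(1) by (meson mult_nonneg_nonneg order.trans)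
  show ?thesis
  proof (rule that[of "apply_bcontfun z"])
    show "apply_bcontfun z t = z0 + integral {a..t} (\<lambda>s. h (B s) (apply_bcontfun z s))" if "t \<in> {a..b}" for t
      using zt[of t] cl_id[OF that] by simp
    show "norm (apply_bcontfun z t - z0) \<le> 2 * \<theta> * norm z0" for t
      using order.trans[OF d[of t] mult_left_mono[OF nz \<open>\<theta> \<ge> 0\<close>]] by (simp add: mult.assoc mult.left_commute)
  qed (use int zc in auto)
qed

text \<open>Supplies the smallness hypothesis of \<open>linear_ode_solution\<close> uniformly in the
  position of the interval, by uniform continuity of the indefinite integral.\<close>

lemma short_interval_integral_small:
  fixes B :: "real \<Rightarrow> real"
  assumes B: "B integrable_on {a..b}" and nn: "\<And>t. t \<in> {a..b} \<Longrightarrow> 0 \<le> B t" and e: "e > 0"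
  shows "\<exists>d>0. \<forall>s t. a \<le> s \<and> s \<le> t \<and> t \<le> b \<and> t - s < d \<longrightarrow> integral {s..t} B < e"
proof -
  have "uniformly_continuous_on {a..b} (\<lambda>t. integral {a..t} B)"
    by (intro compact_uniformly_continuous indefinite_integral_continuous_1 B) auto
  then obtain d where d: "d > 0" "\<And>s t. s \<in> {a..b} \<Longrightarrow> t \<in> {a..b} \<Longrightarrow> dist t s < d \<Longrightarrow>
      dist (integral {a..t} B) (integral {a..s} B) < e"
    using e unfolding uniformly_continuous_on_def by metis
  have "integral {s..t} B < e" if st: "a \<le> s" "s \<le> t" "t \<le> b" "t - s < d" for s t
  proof -
    have "integral {a..s} B + integral {s..t} B = integral {a..t} B"
      using st by (intro Henstock_Kurzweil_Integration.integral_combine integrable_on_subinterval[OF B]) auto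
    then show ?thesis using d(2)[of s t] st by (auto simp: dist_real_def)
  qed
  then show ?thesis using d(1) by blast
qed

section \<open>Smooth functions\<close>

text \<open>Valid even where neither function is differentiable: both have the same set of
  derivatives, so \<open>frechet_derivative\<close> makes the same choice.\<close>

lemma frechet_derivative_cong_open:
  assumes "open S" "x \<in> S" "\<And>y. y \<in> S \<Longrightarrow> f y = g y"
  shows "frechet_derivative f (at x) = frechet_derivative g (at x)" "f differentiable at x \<longleftrightarrow> g differentiable at x"
proof -
  have "(f has_derivative D) (at x) \<longleftrightarrow> (g has_derivative D) (at x)" for D
    using has_derivative_transform_within_open[of f D x UNIV S g] has_derivative_transform_within_open[of g D x UNIV S f] assms
    by auto
  then show "frechet_derivative f (at x) = frechet_derivative g (at x)" "f differentiable at x \<longleftrightarrow> g differentiable at x"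
    by (auto simp: frechet_derivative_def differentiable_def)
qed

lemma Ck_on_cong:
  assumes "open S" "\<And>x. x \<in> S \<Longrightarrow> f x = g x"
  shows "Ck_on k S f \<longleftrightarrow> Ck_on k S g"
  using assms(2)
proof (induction k arbitrary: f g)
  case 0
  then show ?case by (simp cong: continuous_on_cong)
next
  case (Suc k)
  have "Ck_on k S (\<lambda>x. frechet_derivative f (at x) v) \<longleftrightarrow> Ck_on k S (\<lambda>x. frechet_derivative g (at x) v)" for v
  proof (rule Suc.IH)
    fix x assume "x \<in> S"
    then show "frechet_derivative f (at x) v = frechet_derivative g (at x) v"
      by (simp only: frechet_derivative_cong_open(1)[OF assms(1) _ Suc.prems])
  qed
  moreover have "f differentiable at x \<longleftrightarrow> g differentiable at x" if "x \<in> S" for x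
    using frechet_derivative_cong_open(2)[OF assms(1) that Suc.prems] .
  ultimately show ?case by auto
qed

lemma Ck_on_SucD: "Ck_on (Suc k) S f \<Longrightarrow> Ck_on k S f"
proof (induction k arbitrary: f)
  case 0
  then show ?case by (auto intro!: differentiable_imp_continuous_on differentiable_at_imp_differentiable_on)
next
  case (Suc k)
  then show ?case using Ck_on.simps(2) by metis
qed

lemma Ck_on_subset: "Ck_on k S f \<Longrightarrow> T \<subseteq> S \<Longrightarrow> Ck_on k T f"
  by (induction k arbitrary: f) (auto intro: continuous_on_subset)

text \<open>Trades the chosen derivative for an explicit formula, so that the product and chain
  rules can be used in inductions on \<open>k\<close>.\<close>

lemma Ck_on_SucI:
  assumes "open S" "\<And>x. x \<in> S \<Longrightarrow> (f has_derivative D x) (at x)" "\<And>v. Ck_on k S (\<lambda>x. D x v)"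
  shows "Ck_on (Suc k) S f"
proof -
  have "frechet_derivative f (at x) = D x" if "x \<in> S" for x
    using frechet_derivative_at[OF assms(2)[OF that]] by simp
  then have "Ck_on k S (\<lambda>x. frechet_derivative f (at x) v) \<longleftrightarrow> Ck_on k S (\<lambda>x. D x v)" for v
    by (intro Ck_on_cong[OF assms(1)]) auto
  moreover have "f differentiable at x" if "x \<in> S" for x
    using assms(2)[OF that] by (auto simp: differentiable_def)
  ultimately show ?thesis using assms(3) by simp
qed

lemma Ck_on_SucE:
  assumes "Ck_on (Suc k) S f"
  shows "x \<in> S \<Longrightarrow> (f has_derivative frechet_derivative f (at x)) (at x)"
    and "Ck_on k S (\<lambda>x. frechet_derivative f (at x) v)"
  using assms frechet_derivative_works by auto

lemma Ck_on_const: "open S \<Longrightarrow> Ck_on k S (\<lambda>_. c)"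
proof (induction k arbitrary: c)
  case (Suc k)
  show ?case by (rule Ck_on_SucI[where D="\<lambda>_ _. 0"]) (use Suc in auto)
qed auto

lemma Ck_on_add:
  assumes "open S" "Ck_on k S f" "Ck_on k S g"
  shows "Ck_on k S (\<lambda>x. f x + g x)"
  using assms(2,3)
proof (induction k arbitrary: f g)
  case (Suc k)
  show ?case
  proof (rule Ck_on_SucI[OF assms(1)])
    show "((\<lambda>x. f x + g x) has_derivative (\<lambda>v. frechet_derivative f (at x) v + frechet_derivative g (at x) v)) (at x)"
      if "x \<in> S" for x
      by (intro has_derivative_add Ck_on_SucE(1)[OF Suc.prems(1) that] Ck_on_SucE(1)[OF Suc.prems(2) that])
    show "Ck_on k S (\<lambda>x. frechet_derivative f (at x) v + frechet_derivative g (at x) v)" for v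
      by (intro Suc.IH Ck_on_SucE(2)[OF Suc.prems(1)] Ck_on_SucE(2)[OF Suc.prems(2)])
  qed
qed (auto intro: continuous_on_add)

lemma Ck_on_bilinear:
  assumes h: "bounded_bilinear h" and "open S" "Ck_on k S f" "Ck_on k S g"
  shows "Ck_on k S (\<lambda>x. h (f x) (g x))"
  using assms(3,4)
proof (induction k arbitrary: f g)
  case 0
  then show ?case by (auto intro: bounded_bilinear.continuous_on[OF h])
next
  case (Suc k)
  show ?case
  proof (rule Ck_on_SucI[OF assms(2)])
    show "((\<lambda>x. h (f x) (g x)) has_derivative
        (\<lambda>v. h (f x) (frechet_derivative g (at x) v) + h (frechet_derivative f (at x) v) (g x))) (at x)" if "x \<in> S" for x
      by (intro bounded_bilinear.FDERIV[OF h] Ck_on_SucE(1)[OF Suc.prems(1) that] Ck_on_SucE(1)[OF Suc.prems(2) that])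
    show "Ck_on k S (\<lambda>x. h (f x) (frechet_derivative g (at x) v) + h (frechet_derivative f (at x) v) (g x))" for v
      by (intro Ck_on_add assms(2) Suc.IH Ck_on_SucE(2)[OF Suc.prems(1)] Ck_on_SucE(2)[OF Suc.prems(2)]
          Ck_on_SucD[OF Suc.prems(1)] Ck_on_SucD[OF Suc.prems(2)])
  qed
qed

lemma Ck_on_bounded_linear:
  assumes h: "bounded_linear h" and "open S" "Ck_on k S f"
  shows "Ck_on k S (\<lambda>x. h (f x))"
  using assms(3)
proof (induction k arbitrary: f)
  case 0
  then show ?case by (auto intro: bounded_linear.continuous_on[OF h])
next
  case (Suc k)
  show ?case
    by (rule Ck_on_SucI[OF assms(2), where D="\<lambda>x v. h (frechet_derivative f (at x) v)"])
      (auto intro!: bounded_linear.has_derivative[OF h] Ck_on_SucE[OF Suc.prems] Suc.IH)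
qed

lemma Ck_on_sum:
  assumes "open S" "\<And>i. i \<in> I \<Longrightarrow> Ck_on k S (f i)"
  shows "Ck_on k S (\<lambda>x. \<Sum>i\<in>I. f i x)"
  using assms(2) by (induction I rule: infinite_finite_induct) (auto intro: Ck_on_add Ck_on_const assms(1))

lemma Ck_on_compose:
  fixes g :: "'a::real_normed_vector \<Rightarrow> 'b::euclidean_space" and f :: "'b \<Rightarrow> 'c::real_normed_vector"
  assumes "open S" "open T" "g ` S \<subseteq> T" "Ck_on k T f" "Ck_on k S g"
  shows "Ck_on k S (\<lambda>x. f (g x))"
  using assms(4,5)
proof (induction k arbitrary: f)
  case 0
  then show ?case using assms(3) by (auto intro: continuous_on_compose2)
next
  case (Suc k)
  show ?case
  proof (rule Ck_on_SucI[OF assms(1)])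
    \<comment> \<open>\<open>Ck_on\<close> speaks of derivatives in a fixed direction, while in the
      chain rule the direction at \<open>g x\<close> moves with \<open>x\<close>. Expansion over
      \<open>Basis\<close> leaves fixed directions with moving scalar coefficients.\<close>
    let ?D = "\<lambda>x v. \<Sum>i\<in>Basis. (frechet_derivative g (at x) v \<bullet> i) *\<^sub>R frechet_derivative f (at (g x)) i"
    show "((\<lambda>x. f (g x)) has_derivative ?D x) (at x)" if x: "x \<in> S" for x
    proof -
      have gx: "(g has_derivative frechet_derivative g (at x)) (at x)"
        by (rule Ck_on_SucE(1)[OF Suc.prems(2) x])
      have fx: "(f has_derivative frechet_derivative f (at (g x))) (at (g x))"
        by (rule Ck_on_SucE(1)[OF Suc.prems(1)]) (use x assms(3) in auto)
      have l: "linear (frechet_derivative f (at (g x)))"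
        using has_derivative_bounded_linear[OF fx] bounded_linear.linear by blast
      have rep: "frechet_derivative f (at (g x)) w = (\<Sum>i\<in>Basis. (w \<bullet> i) *\<^sub>R frechet_derivative f (at (g x)) i)" for w
      proof -
        have "frechet_derivative f (at (g x)) w = frechet_derivative f (at (g x)) (\<Sum>i\<in>Basis. (w \<bullet> i) *\<^sub>R i)"
          by (simp add: euclidean_representation)
        then show ?thesis by (simp add: linear_sum[OF l] linear_scale[OF l])
      qed
      have "?D x = (\<lambda>v. frechet_derivative f (at (g x)) (frechet_derivative g (at x) v))"
        by (rule ext, rule rep[symmetric])
      then show ?thesis using has_derivative_compose[OF gx fx] by simp
    qed
    show "Ck_on k S (\<lambda>x. ?D x v)" for v
      by (intro Ck_on_sum Ck_on_bilinear[OF bounded_bilinear_scaleR] assms(1) Suc.IH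
          Ck_on_bounded_linear[OF bounded_linear_inner_left] Ck_on_SucE(2)[OF Suc.prems(1)]
          Ck_on_SucE(2)[OF Suc.prems(2)] Ck_on_SucD[OF Suc.prems(2)])
  qed
qed

text \<open>The exponent is generalised in the induction because differentiation replaces
  \<open>a\<close> by \<open>a - 1\<close>. The exponent \<open>- 1 / 2\<close> later normalises
  vectors.\<close>

lemma Ck_on_powr:
  fixes f :: "'a::real_normed_vector \<Rightarrow> real"
  assumes "open S" "Ck_on k S f" "\<And>x. x \<in> S \<Longrightarrow> f x > 0"
  shows "Ck_on k S (\<lambda>x. f x powr a)"
  using assms(2)
proof (induction k arbitrary: a)
  case 0
  then show ?case using assms(3) by (auto intro!: continuous_intros simp: less_imp_neq[symmetric])
next
  case (Suc k)
  show ?case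
  proof (rule Ck_on_SucI[OF assms(1)])
    show "((\<lambda>x. f x powr a) has_derivative (\<lambda>v. frechet_derivative f (at x) v *\<^sub>R (a * f x powr (a - 1)))) (at x)"
      if x: "x \<in> S" for x
    proof -
      have fx: "(f has_derivative frechet_derivative f (at x)) (at x)"
        by (rule Ck_on_SucE(1)[OF Suc.prems x])
      have "((\<lambda>y. y powr a) has_real_derivative a * f x powr (a - 1)) (at (f x))"
        using has_real_derivative_powr[OF assms(3)[OF x]] .
      then have "((\<lambda>y. y powr a) has_derivative (\<lambda>v. v *\<^sub>R (a * f x powr (a - 1)))) (at (f x))"
        unfolding has_field_derivative_def by (rule has_derivative_eq_rhs) (simp add: fun_eq_iff)
      then show ?thesis using has_derivative_compose[OF fx] by blast
    qed
    show "Ck_on k S (\<lambda>x. frechet_derivative f (at x) v *\<^sub>R (a * f x powr (a - 1)))" for v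
      by (intro Ck_on_bilinear[OF bounded_bilinear_scaleR] Ck_on_bounded_linear[OF bounded_linear_mult_right]
          assms(1) Suc.IH Ck_on_SucE(2)[OF Suc.prems] Ck_on_SucD[OF Suc.prems])
  qed
qed

lemma smooth_on_cong:
  "open S \<Longrightarrow> smooth_on S f \<Longrightarrow> (\<And>x. x \<in> S \<Longrightarrow> g x = f x) \<Longrightarrow> smooth_on S g"
  using Ck_on_cong[of S f g] unfolding smooth_on_def by fastforce

lemma smooth_on_subset: "smooth_on S f \<Longrightarrow> T \<subseteq> S \<Longrightarrow> smooth_on T f"
  unfolding smooth_on_def by (blast intro: Ck_on_subset)

lemma smooth_on_const: "open S \<Longrightarrow> smooth_on S (\<lambda>_. c)"
  unfolding smooth_on_def by (blast intro: Ck_on_const)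

lemma smooth_on_add: "open S \<Longrightarrow> smooth_on S f \<Longrightarrow> smooth_on S g \<Longrightarrow> smooth_on S (\<lambda>x. f x + g x)"
  unfolding smooth_on_def by (blast intro: Ck_on_add)

lemma smooth_on_bilinear:
  "bounded_bilinear h \<Longrightarrow> open S \<Longrightarrow> smooth_on S f \<Longrightarrow> smooth_on S g \<Longrightarrow> smooth_on S (\<lambda>x. h (f x) (g x))"
  unfolding smooth_on_def by (blast intro: Ck_on_bilinear)

lemmas smooth_on_scaleR = smooth_on_bilinear[OF bounded_bilinear_scaleR]
lemmas smooth_on_mult = smooth_on_bilinear[OF bounded_bilinear_mult]

lemma smooth_on_bounded_linear:
  "bounded_linear h \<Longrightarrow> open S \<Longrightarrow> smooth_on S f \<Longrightarrow> smooth_on S (\<lambda>x. h (f x))"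
  unfolding smooth_on_def by (blast intro: Ck_on_bounded_linear)

lemmas smooth_on_vec_nth = smooth_on_bounded_linear[OF bounded_linear_vec_nth]

lemma smooth_on_minus: "open S \<Longrightarrow> smooth_on S f \<Longrightarrow> smooth_on S (\<lambda>x. - f x)"
  by (rule smooth_on_bounded_linear[OF bounded_linear_minus[OF bounded_linear_ident]])

lemma smooth_on_sum:
  "open S \<Longrightarrow> (\<And>i. i \<in> I \<Longrightarrow> smooth_on S (f i)) \<Longrightarrow> smooth_on S (\<lambda>x. \<Sum>i\<in>I. f i x)"
  unfolding smooth_on_def by (blast intro: Ck_on_sum)

lemma smooth_on_compose:
  fixes g :: "'a::real_normed_vector \<Rightarrow> 'b::euclidean_space"
  shows "open S \<Longrightarrow> open T \<Longrightarrow> g ` S \<subseteq> T \<Longrightarrow> smooth_on T f \<Longrightarrow> smooth_on S g \<Longrightarrow> smooth_on S (\<lambda>x. f (g x))"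
  unfolding smooth_on_def by (blast intro: Ck_on_compose)

lemma smooth_on_powr:
  fixes f :: "'a::real_normed_vector \<Rightarrow> real"
  shows "open S \<Longrightarrow> smooth_on S f \<Longrightarrow> (\<And>x. x \<in> S \<Longrightarrow> f x > 0) \<Longrightarrow> smooth_on S (\<lambda>x. f x powr a)"
  unfolding smooth_on_def by (simp add: Ck_on_powr)

lemma smooth_on_frechet_derivative: "smooth_on S f \<Longrightarrow> smooth_on S (\<lambda>x. frechet_derivative f (at x) v)"
  unfolding smooth_on_def by (metis Ck_on_SucE(2))

lemma smooth_on_imp_has_derivative:
  "smooth_on S f \<Longrightarrow> x \<in> S \<Longrightarrow> (f has_derivative frechet_derivative f (at x)) (at x)"
  unfolding smooth_on_def by (metis Ck_on_SucE(1))

lemma smooth_on_imp_differentiable: "smooth_on S f \<Longrightarrow> x \<in> S \<Longrightarrow> f differentiable at x"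
  using smooth_on_imp_has_derivative by (auto simp: differentiable_def)

lemma smooth_on_imp_continuous_on: "smooth_on S f \<Longrightarrow> continuous_on S f"
  unfolding smooth_on_def by (metis Ck_on.simps(1))

section \<open>Smooth bilinear forms and orthonormalisation\<close>

lemma vec_eq_sum_axis: "(v :: real ^ 'n) = (\<Sum>i\<in>UNIV. (v $ i) *\<^sub>R axis i 1)"
  by (simp add: vec_eq_iff axis_def if_distrib[of "(*) _"] cong: if_cong)

lemma abs_continuous_on_compose_smooth:
  fixes f :: "'e::euclidean_space \<Rightarrow> 'f::euclidean_space"
  assumes "open S" "smooth_on S f" "abs_continuous_on a b u" "u ` {a..b} \<subseteq> S" "a \<le> b"
  shows "abs_continuous_on a b (\<lambda>t. f (u t))"
  by (rule abs_continuous_on_compose_C1[OF assms(1) _ _ assms(3-5)])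
     (auto intro: smooth_on_imp_differentiable[OF assms(2)]
       smooth_on_imp_continuous_on[OF smooth_on_frechet_derivative[OF assms(2)]])

lemma bilinear_eq_sum_axis:
  fixes g :: "real ^ 'n \<Rightarrow> real ^ 'n \<Rightarrow> real"
  assumes "bilinear g"
  shows "g a b = (\<Sum>i\<in>UNIV. \<Sum>j\<in>UNIV. a $ i * (b $ j * g (axis i 1) (axis j 1)))"
proof -
  have "g a b = g (\<Sum>i\<in>UNIV. (a $ i) *\<^sub>R axis i 1) (\<Sum>j\<in>UNIV. (b $ j) *\<^sub>R axis j 1)"
    by (simp flip: vec_eq_sum_axis)
  also have "\<dots> = (\<Sum>i\<in>UNIV. \<Sum>j\<in>UNIV. g ((a $ i) *\<^sub>R axis i 1) ((b $ j) *\<^sub>R axis j 1))"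
    by (simp add: bilinear_sum[OF assms] sum.cartesian_product)
  also have "\<dots> = (\<Sum>i\<in>UNIV. \<Sum>j\<in>UNIV. a $ i * (b $ j * g (axis i 1) (axis j 1)))"
    by (simp add: bilinear_lmul[OF assms] bilinear_rmul[OF assms] mult.left_commute)
  finally show ?thesis .
qed

text \<open>A Riemannian metric is known to be smooth on pairs of coordinate fields only;
  bilinearity writes its value on moving vectors as a sum of products of smooth functions.\<close>

lemma smooth_on_bilinear_form:
  fixes g :: "'m::real_normed_vector \<Rightarrow> real ^ 'n \<Rightarrow> real ^ 'n \<Rightarrow> real"
  assumes S: "open S" and g: "\<And>p. p \<in> S \<Longrightarrow> bilinear (g p)" "\<And>i j. smooth_on S (\<lambda>p. g p (axis i 1) (axis j 1))"
    and a: "smooth_on S a" and b: "smooth_on S b"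
  shows "smooth_on S (\<lambda>p. g p (a p) (b p))"
proof (rule smooth_on_cong[OF S])
  show "smooth_on S (\<lambda>p. \<Sum>i\<in>UNIV. \<Sum>j\<in>UNIV. a p $ i * (b p $ j * g p (axis i 1) (axis j 1)))"
    by (intro smooth_on_sum smooth_on_mult smooth_on_vec_nth S g a b)
qed (rule bilinear_eq_sum_axis[OF g(1)])

text \<open>Gram-Schmidt by adding one index at a time, at all points simultaneously. The span
  condition is carried along to show that the new vector never vanishes and can be
  normalised.\<close>

lemma smooth_gram_schmidt:
  fixes g :: "'m::real_normed_vector \<Rightarrow> real ^ 'n \<Rightarrow> real ^ 'n \<Rightarrow> real"
  assumes S: "open S" and bil: "\<And>p. p \<in> S \<Longrightarrow> bilinear (g p)"
    and sym: "\<And>p v w. p \<in> S \<Longrightarrow> g p v w = g p w v" and pos: "\<And>p v. p \<in> S \<Longrightarrow> v \<noteq> 0 \<Longrightarrow> g p v v > 0"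
    and sm: "\<And>i j. smooth_on S (\<lambda>p. g p (axis i 1) (axis j 1))"
    and "finite I"
  shows "\<exists>u. \<forall>i\<in>I. smooth_on S (u i) \<and> (\<forall>p\<in>S. u i p \<in> span ((\<lambda>i. axis i 1) ` I) \<and>
            (\<forall>j\<in>I. g p (u i p) (u j p) = (if i = j then 1 else 0)))"
  using \<open>finite I\<close>
proof (induction I)
  case (insert j I)
  then obtain u where u0: "\<forall>i\<in>I. smooth_on S (u i) \<and> (\<forall>p\<in>S. u i p \<in> span ((\<lambda>i. axis i 1) ` I) \<and>
      (\<forall>j\<in>I. g p (u i p) (u j p) = (if i = j then 1 else 0)))" by blast
  have u: "smooth_on S (u i)" "p \<in> S \<Longrightarrow> u i p \<in> span ((\<lambda>i. axis i 1) ` I)"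
    "k \<in> I \<Longrightarrow> p \<in> S \<Longrightarrow> g p (u i p) (u k p) = (if i = k then 1 else 0)" if "i \<in> I" for i k p
    using u0 that by auto
  define w where "w p = axis j 1 + (\<Sum>i\<in>I. (- g p (axis j 1) (u i p)) *\<^sub>R u i p)" for p
  have form: "smooth_on S (\<lambda>p. g p (a p) (b p))" if "smooth_on S a" "smooth_on S b" for a b
    by (rule smooth_on_bilinear_form[where g=g and a=a and b=b, OF S bil sm that])
  have "smooth_on S (\<lambda>p. (- g p (axis j 1) (u i p)) *\<^sub>R u i p)" if i: "i \<in> I" for i
    by (rule smooth_on_scaleR[OF S smooth_on_minus[OF S form[OF smooth_on_const[OF S] u(1)[OF i]]] u(1)[OF i]])
  then have wsm: "smooth_on S w"
    unfolding w_def by (intro smooth_on_add[OF S smooth_on_const[OF S]] smooth_on_sum[OF S])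
  have worth: "g p (w p) (u i p) = 0" if "i \<in> I" "p \<in> S" for i p
  proof -
    have "g p (w p) (u i p) = g p (axis j 1) (u i p) + (\<Sum>k\<in>I. - g p (axis j 1) (u k p) * g p (u k p) (u i p))"
      using bil[OF that(2)] by (simp add: w_def bilinear_ladd bilinear_def linear_sum[of "\<lambda>x. g p x (u i p)"] linear_cmul[of "\<lambda>x. g p x (u i p)"] linear_add[of "\<lambda>x. g p x (u i p)"]
            linear_neg[of "\<lambda>x. g p x (u i p)"])
    also have "(\<Sum>k\<in>I. - g p (axis j 1) (u k p) * g p (u k p) (u i p)) = (\<Sum>k\<in>I. if k = i then - g p (axis j 1) (u k p) else 0)"
      using u(3) that by (intro sum.cong refl) auto
    also have "\<dots> = - g p (axis j 1) (u i p)" using that insert.hyps(1) by simp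
    finally show ?thesis by simp
  qed
  \<comment> \<open>The vectors already built have no component along the new axis \<open>j\<close>,
    so that component of \<open>w p\<close> is \<open>1\<close>.\<close>
  have wne: "w p \<noteq> 0" if p: "p \<in> S" for p
  proof
    assume w0: "w p = 0"
    have "span ((\<lambda>i. axis i 1) ` I) \<subseteq> {v :: real ^ 'n. v $ j = 0}"
      by (rule span_minimal) (use insert.hyps(2) in \<open>auto simp: axis_def subspace_def\<close>)
    then have "u i p $ j = 0" if "i \<in> I" for i using u(2)[OF that p] by auto
    then have "w p $ j = 1" by (simp add: w_def axis_def)
    then show False using w0 by simp
  qed
  define e where "e p = (g p (w p) (w p) powr (- 1 / 2)) *\<^sub>R w p" for p
  have esm: "smooth_on S e"
    unfolding e_def
    by (rule smooth_on_scaleR[OF S smooth_on_powr[OF S form[OF wsm wsm]] wsm]) (rule pos[OF _ wne])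
  have eorth: "g p (e p) (u i p) = 0" "g p (u i p) (e p) = 0" if "i \<in> I" "p \<in> S" for i p
    using worth[OF that] bil[OF that(2)] sym[OF that(2)] by (simp_all add: e_def bilinear_lmul bilinear_rmul)
  have enorm: "g p (e p) (e p) = 1" if "p \<in> S" for p
  proof -
    have "g p (w p) (w p) > 0" using pos wne that by simp
    then have "g p (w p) (w p) powr (- 1 / 2) * (g p (w p) (w p) powr (- 1 / 2) * g p (w p) (w p) powr 1) = 1"
      by (simp only: powr_add[symmetric]) simp
    moreover have "g p (w p) (w p) powr 1 = g p (w p) (w p)" using \<open>g p (w p) (w p) > 0\<close> by simp
    ultimately show ?thesis using bil[OF that] by (simp add: e_def bilinear_lmul bilinear_rmul)
  qed
  have espan: "e p \<in> span ((\<lambda>i. axis i 1) ` insert j I)" if p: "p \<in> S" for p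
  proof -
    have "u i p \<in> span ((\<lambda>i. axis i 1) ` insert j I)" if "i \<in> I" for i
      using u(2)[OF that p] by (rule subsetD[OF span_mono, rotated]) auto
    then show ?thesis unfolding e_def w_def
      by (intro span_scale span_add span_sum) (auto intro: span_base)
  qed
  define u' where "u' = u(j := e)"
  have "u' i p \<in> span ((\<lambda>i. axis i 1) ` insert j I)" if "i \<in> insert j I" "p \<in> S" for i p
    using that espan u(2)[of i p] span_mono[of "(\<lambda>i. axis i 1) ` I" "(\<lambda>i. axis i 1) ` insert j I"]
    by (auto simp: u'_def)
  moreover have "smooth_on S (u' i)" if "i \<in> insert j I" for i
    using that esm u(1) by (auto simp: u'_def)
  moreover have "g p (u' i p) (u' k p) = (if i = k then 1 else 0)" if "i \<in> insert j I" "k \<in> insert j I" "p \<in> S" for i k p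
    using that u(3) eorth enorm insert.hyps(2) by (auto simp: u'_def)
  ultimately show ?case by (intro exI[of _ u']) blast
qed auto

section \<open>Tangent vectors\<close>

lemma sum_fun_apply: "(\<Sum>i\<in>I. f i) x = (\<Sum>i\<in>I. f i x)"
  by (induction I rule: infinite_finite_induct) auto

lemma tscale_apply [simp]: "(a *\<^sub>T v) c = a *\<^sub>R v c"
  by (simp add: tscale_def)

locale smooth_manifold =
  fixes M :: "('a::topological_space, 'n::finite) manifold"
  assumes smooth: "oriented_smooth_manifold M"
begin

lemma charts_at_iff: "c \<in> charts_at M x \<longleftrightarrow> c \<in> charts M \<and> x \<in> chart_dom c"
  by (simp add: charts_at_def)

lemma ex_chart_at: "\<exists>c. c \<in> charts_at M x"
proof -
  have "x \<in> (\<Union>c\<in>charts M. chart_dom c)"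
    using smooth unfolding oriented_smooth_manifold_def by (metis UNIV_I)
  then show ?thesis unfolding charts_at_def by blast
qed

lemma chart:
  assumes "c \<in> charts M"
  shows "open (chart_dom c)" "open (chart_map c ` chart_dom c)"
    "homeomorphism (chart_dom c) (chart_map c ` chart_dom c) (chart_map c) (chart_inv c)"
  using smooth assms unfolding oriented_smooth_manifold_def by auto

lemma chart_inv_chart_map [simp]:
  assumes "c \<in> charts M" "x \<in> chart_dom c"
  shows "chart_inv c (chart_map c x) = x"
  using homeomorphism_apply1[OF chart(3)[OF assms(1)] assms(2)] .

lemma open_chart_image:
  assumes "c \<in> charts M" "open U"
  shows "open (chart_map c ` (U \<inter> chart_dom c))"
proof -
  have "openin (top_of_set (chart_dom c)) (U \<inter> chart_dom c)"
    using assms(2) by (auto simp: openin_open)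
  then have "openin (top_of_set (chart_map c ` chart_dom c)) (chart_map c ` (U \<inter> chart_dom c))"
    using homeomorphism_imp_open_map[OF chart(3)[OF assms(1)]] by blast
  then show ?thesis using chart(2)[OF assms(1)] openin_open_trans open_openin by metis
qed

lemma open_chart_image_subset: "c \<in> charts M \<Longrightarrow> open V \<Longrightarrow> V \<subseteq> chart_dom c \<Longrightarrow> open (chart_map c ` V)"
  using open_chart_image[of c V] by (simp add: Int_absorb2)

lemma open_overlap: "c \<in> charts M \<Longrightarrow> c' \<in> charts M \<Longrightarrow> open (chart_map c ` (chart_dom c \<inter> chart_dom c'))"
  using open_chart_image[of c "chart_dom c'"] chart(1)[of c'] by (simp add: Int_commute)

lemma transition_apply [simp]:
  "c \<in> charts M \<Longrightarrow> x \<in> chart_dom c \<Longrightarrow> transition c c' (chart_map c x) = chart_map c' x"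
  by (simp add: transition_def)

lemma smooth_transition:
  "c \<in> charts M \<Longrightarrow> c' \<in> charts M \<Longrightarrow> smooth_on (chart_map c ` (chart_dom c \<inter> chart_dom c')) (transition c c')"
  using smooth unfolding oriented_smooth_manifold_def by auto

definition jac :: "('a, 'n) chart \<Rightarrow> ('a, 'n) chart \<Rightarrow> 'a \<Rightarrow> real ^ 'n \<Rightarrow> real ^ 'n" where
  "jac c c' x = frechet_derivative (transition c c') (at (chart_map c x))"

lemma jac_has_derivative:
  assumes "c \<in> charts_at M x" "c' \<in> charts_at M x"
  shows "(transition c c' has_derivative jac c c' x) (at (chart_map c x))"
  unfolding jac_def
  by (rule smooth_on_imp_has_derivative[OF smooth_transition]) (use assms in \<open>auto simp: charts_at_iff\<close>)

lemma jac_bounded_linear: "c \<in> charts_at M x \<Longrightarrow> c' \<in> charts_at M x \<Longrightarrow> bounded_linear (jac c c' x)"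
  using jac_has_derivative has_derivative_bounded_linear by blast

lemma jac_linear: "c \<in> charts_at M x \<Longrightarrow> c' \<in> charts_at M x \<Longrightarrow> linear (jac c c' x)"
  using jac_bounded_linear bounded_linear.linear by blast

lemma jac_det:
  assumes "c \<in> charts_at M x" "c' \<in> charts_at M x"
  shows "det (matrix (jac c c' x)) > 0"
  using smooth assms unfolding oriented_smooth_manifold_def jac_def charts_at_iff by blast

lemma jac_self:
  assumes c: "c \<in> charts_at M x"
  shows "jac c c x w = w"
proof -
  have "frechet_derivative (transition c c) (at (chart_map c x)) = frechet_derivative (\<lambda>p. p) (at (chart_map c x))"
    by (rule frechet_derivative_cong_open(1)[OF chart(2)[of c]]) (use c in \<open>auto simp: charts_at_iff\<close>)
  also have "\<dots> = (\<lambda>p. p)" using frechet_derivative_at[OF has_derivative_ident] by metis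
  finally show ?thesis by (simp add: jac_def)
qed

lemma jac_compose:
  assumes c: "c \<in> charts_at M x" "c' \<in> charts_at M x" "c'' \<in> charts_at M x"
  shows "jac c' c'' x (jac c c' x w) = jac c c'' x w"
proof -
  have 1: "(transition c c' has_derivative jac c c' x) (at (chart_map c x))"
    using jac_has_derivative c by blast
  have 2: "(transition c' c'' has_derivative jac c' c'' x) (at (transition c c' (chart_map c x)))"
    using jac_has_derivative[OF c(2,3)] c by (simp add: charts_at_iff)
  have 3: "((\<lambda>p. transition c' c'' (transition c c' p)) has_derivative (\<lambda>w. jac c' c'' x (jac c c' x w))) (at (chart_map c x))"
    by (rule has_derivative_compose[OF 1 2])
  have "(transition c c'' has_derivative (\<lambda>w. jac c' c'' x (jac c c' x w))) (at (chart_map c x))"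
  proof (rule has_derivative_transform_within_open[OF 3])
    show "open (chart_map c ` (chart_dom c' \<inter> chart_dom c))"
      using open_chart_image c chart(1) by (auto simp: charts_at_iff)
  qed (use c in \<open>auto simp: charts_at_iff\<close>)
  from has_derivative_unique[OF this jac_has_derivative[OF c(1,3)]] show ?thesis by metis
qed

lemma tangent_space_jac:
  "v \<in> tangent_space M x \<longleftrightarrow>
    (\<forall>c\<in>charts_at M x. \<forall>c'\<in>charts_at M x. v c' = jac c c' x (v c)) \<and> (\<forall>c. c \<notin> charts_at M x \<longrightarrow> v c = 0)"
  by (simp add: tangent_space_def jac_def)

lemma tangent_spaceI:
  "(\<And>c c'. c \<in> charts_at M x \<Longrightarrow> c' \<in> charts_at M x \<Longrightarrow> v c' = jac c c' x (v c)) \<Longrightarrow>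
   (\<And>c. c \<notin> charts_at M x \<Longrightarrow> v c = 0) \<Longrightarrow> v \<in> tangent_space M x"
  unfolding tangent_space_jac by blast

lemma tangent_vec_change:
  "v \<in> tangent_space M x \<Longrightarrow> c \<in> charts_at M x \<Longrightarrow> c' \<in> charts_at M x \<Longrightarrow> v c' = jac c c' x (v c)"
  unfolding tangent_space_jac by blast

lemma tangent_vec_outside: "v \<in> tangent_space M x \<Longrightarrow> c \<notin> charts_at M x \<Longrightarrow> v c = 0"
  unfolding tangent_space_jac by blast

lemma tangent_vec_eqI:
  assumes v: "v \<in> tangent_space M x" and w: "w \<in> tangent_space M x" and c: "c \<in> charts_at M x" and eq: "v c = w c"
  shows "v = w"
proof
  fix c' show "v c' = w c'"
  proof (cases "c' \<in> charts_at M x")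
    case True
    show ?thesis
      unfolding tangent_vec_change[OF v c True] tangent_vec_change[OF w c True] eq ..
  qed (simp add: tangent_vec_outside[OF v] tangent_vec_outside[OF w])
qed

lemma tangent_space_0 [simp]: "0 \<in> tangent_space M x"
  by (rule tangent_spaceI) (simp_all add: linear_0[OF jac_linear])

lemma tangent_space_add:
  assumes v: "v \<in> tangent_space M x" and w: "w \<in> tangent_space M x"
  shows "v + w \<in> tangent_space M x"
proof (rule tangent_spaceI)
  fix c c' assume c: "c \<in> charts_at M x" "c' \<in> charts_at M x"
  show "(v + w) c' = jac c c' x ((v + w) c)"
    using tangent_vec_change[OF v c] tangent_vec_change[OF w c] by (simp only: plus_fun_apply linear_add[OF jac_linear[OF c]])
qed (simp add: tangent_vec_outside[OF v] tangent_vec_outside[OF w])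

lemma tangent_space_tscale:
  assumes v: "v \<in> tangent_space M x"
  shows "a *\<^sub>T v \<in> tangent_space M x"
proof (rule tangent_spaceI)
  fix c c' assume c: "c \<in> charts_at M x" "c' \<in> charts_at M x"
  show "(a *\<^sub>T v) c' = jac c c' x ((a *\<^sub>T v) c)"
    using tangent_vec_change[OF v c] by (simp only: tscale_apply linear_cmul[OF jac_linear[OF c]])
qed (simp add: tangent_vec_outside[OF v])

lemma tangent_space_sum: "(\<And>i. i \<in> I \<Longrightarrow> v i \<in> tangent_space M x) \<Longrightarrow> (\<Sum>i\<in>I. v i) \<in> tangent_space M x"
  by (induction I rule: infinite_finite_induct) (auto intro: tangent_space_add)

lemma coord_vec_apply: "coord_vec M c x w c' = (if c' \<in> charts_at M x then jac c c' x w else 0)"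
  by (simp add: coord_vec_def jac_def)

lemma coord_vec_in_tangent_space: "c \<in> charts_at M x \<Longrightarrow> coord_vec M c x w \<in> tangent_space M x"
  by (rule tangent_spaceI) (simp_all add: coord_vec_apply jac_compose)

lemma coord_vec_self: "c \<in> charts_at M x \<Longrightarrow> coord_vec M c x w c = w"
  by (simp add: coord_vec_apply jac_self)

lemma coord_vec_components: "c \<in> charts_at M x \<Longrightarrow> v \<in> tangent_space M x \<Longrightarrow> coord_vec M c x (v c) = v"
  by (rule tangent_vec_eqI[of _ x _ c]) (auto simp: coord_vec_in_tangent_space coord_vec_self)

lemma coord_vec_linear:
  "c \<in> charts_at M x \<Longrightarrow> coord_vec M c x (a *\<^sub>R v + b *\<^sub>R w) = a *\<^sub>T coord_vec M c x v + b *\<^sub>T coord_vec M c x w"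
  by (rule tangent_vec_eqI[of _ x _ c])
     (auto simp: coord_vec_in_tangent_space coord_vec_self tangent_space_add tangent_space_tscale)

lemma coord_field_in_tangent_space: "c \<in> charts_at M x \<Longrightarrow> coord_field M c j x \<in> tangent_space M x"
  by (simp add: coord_field_def coord_vec_in_tangent_space)

lemma coord_field_self: "c \<in> charts_at M x \<Longrightarrow> coord_field M c j x c = axis j 1"
  by (simp add: coord_field_def coord_vec_self)

lemma tangent_vec_eq_sum_coord:
  assumes "c \<in> charts_at M x" "v \<in> tangent_space M x"
  shows "v = (\<Sum>k\<in>UNIV. (v c $ k) *\<^sub>T coord_field M c k x)"
  by (rule tangent_vec_eqI[OF assms(2) _ assms(1)])
     (auto intro!: tangent_space_sum tangent_space_tscale coord_field_in_tangent_space assms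
       simp: sum_fun_apply coord_field_self[OF assms(1)] vec_eq_sum_axis[symmetric])

section \<open>Smooth functions and fields, tested in a single chart\<close>

lemma smooth_function_onI:
  assumes c: "c \<in> charts M" and V: "open V" "V \<subseteq> chart_dom c" and f: "smooth_on (chart_map c ` V) (f \<circ> chart_inv c)"
  shows "smooth_function_on M V f"
  unfolding smooth_function_on_def
proof
  fix c' assume c': "c' \<in> charts M"
  have op: "open (chart_map c' ` (V \<inter> chart_dom c'))" by (rule open_chart_image[OF c' V(1)])
  have "smooth_on (chart_map c' ` (V \<inter> chart_dom c')) (\<lambda>p. (f \<circ> chart_inv c) (transition c' c p))"
  proof (rule smooth_on_compose[OF op open_chart_image_subset[OF c V] _ f])
    show "transition c' c ` chart_map c' ` (V \<inter> chart_dom c') \<subseteq> chart_map c ` V" using c' by auto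
    show "smooth_on (chart_map c' ` (V \<inter> chart_dom c')) (transition c' c)"
      by (rule smooth_on_subset[OF smooth_transition[OF c' c]]) (use V in auto)
  qed
  then show "smooth_on (chart_map c' ` (V \<inter> chart_dom c')) (f \<circ> chart_inv c')"
    by (rule smooth_on_cong[OF op]) (use c c' V in auto)
qed

lemma smooth_field_onI:
  assumes c: "c \<in> charts M" and V: "open V" "V \<subseteq> chart_dom c"
    and Y: "\<And>x. x \<in> V \<Longrightarrow> Y x \<in> tangent_space M x" and sm: "smooth_on (chart_map c ` V) (\<lambda>p. Y (chart_inv c p) c)"
  shows "smooth_field_on M V Y"
  unfolding smooth_field_on_def
proof (intro conjI ballI)
  fix c' assume c': "c' \<in> charts M"
  let ?W = "V \<inter> chart_dom c'"
  have opc': "open (chart_map c' ` ?W)" by (rule open_chart_image[OF c' V(1)])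
  have opc: "open (chart_map c ` ?W)"
    by (rule open_chart_image_subset[OF c]) (use V chart(1)[OF c'] in auto)
  \<comment> \<open>The components in \<open>c'\<close> as a function of the coordinates of
    \<open>c\<close>. The Jacobian is applied column by column because its values on fixed vectors
    depend smoothly on the point.\<close>
  define H where "H q = (\<Sum>k\<in>UNIV. (Y (chart_inv c q) c $ k) *\<^sub>R frechet_derivative (transition c c') (at q) (axis k 1))" for q
  have Hs: "smooth_on (chart_map c ` ?W) H"
    unfolding H_def
    by (intro smooth_on_sum smooth_on_scaleR smooth_on_vec_nth opc smooth_on_frechet_derivative
        smooth_on_subset[OF sm] smooth_on_subset[OF smooth_transition[OF c c']]) (use V in auto)
  have ts: "smooth_on (chart_map c' ` ?W) (transition c' c)"
    by (rule smooth_on_subset[OF smooth_transition[OF c' c]]) (use V in auto)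
  have "smooth_on (chart_map c' ` ?W) (\<lambda>p. H (transition c' c p))"
    by (rule smooth_on_compose[OF opc' opc _ Hs ts]) (use c' in auto)
  then show "smooth_on (chart_map c' ` ?W) (\<lambda>p. Y (chart_inv c' p) c')"
  proof (rule smooth_on_cong[OF opc'])
    fix p assume "p \<in> chart_map c' ` ?W"
    then obtain x where x: "x \<in> V" "x \<in> chart_dom c'" "p = chart_map c' x" by auto
    then have at: "c \<in> charts_at M x" "c' \<in> charts_at M x" using c c' V by (auto simp: charts_at_iff)
    have "Y x c' = jac c c' x (\<Sum>k\<in>UNIV. (Y x c $ k) *\<^sub>R axis k 1)"
      using tangent_vec_change[OF Y[OF x(1)] at] by (simp flip: vec_eq_sum_axis)
    also have "\<dots> = (\<Sum>k\<in>UNIV. (Y x c $ k) *\<^sub>R jac c c' x (axis k 1))"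
      by (simp add: linear_sum[OF jac_linear[OF at]] linear_cmul[OF jac_linear[OF at]])
    finally show "Y (chart_inv c' p) c' = H (transition c' c p)"
      using x at by (simp add: H_def jac_def charts_at_iff)
  qed
qed (rule Y)

lemma smooth_field_on_subset: "smooth_field_on M U Y \<Longrightarrow> V \<subseteq> U \<Longrightarrow> smooth_field_on M V Y"
  unfolding smooth_field_on_def by (blast intro: smooth_on_subset)

lemma smooth_field_on_chart:
  "smooth_field_on M U Y \<Longrightarrow> c \<in> charts M \<Longrightarrow> smooth_on (chart_map c ` (U \<inter> chart_dom c)) (\<lambda>p. Y (chart_inv c p) c)"
  unfolding smooth_field_on_def by blast

lemma smooth_field_on_tangent: "smooth_field_on M U Y \<Longrightarrow> x \<in> U \<Longrightarrow> Y x \<in> tangent_space M x"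
  unfolding smooth_field_on_def by blast

lemma smooth_field_on_add:
  assumes "open U" "smooth_field_on M U Y" "smooth_field_on M U Z"
  shows "smooth_field_on M U (\<lambda>x. Y x + Z x)"
  using assms(2,3) unfolding smooth_field_on_def
  by (auto intro!: tangent_space_add smooth_on_add open_chart_image assms(1))

lemma smooth_field_on_tscale:
  assumes "open U" "smooth_function_on M U f" "smooth_field_on M U Z"
  shows "smooth_field_on M U (\<lambda>x. f x *\<^sub>T Z x)"
  using assms(2,3) unfolding smooth_field_on_def smooth_function_on_def
  by (auto intro!: tangent_space_tscale smooth_on_scaleR open_chart_image assms(1) simp: o_def)

lemma smooth_function_on_const: "open U \<Longrightarrow> smooth_function_on M U (\<lambda>_. k)"
  unfolding smooth_function_on_def o_def by (auto intro!: smooth_on_const open_chart_image)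

lemma smooth_field_on_0: "open U \<Longrightarrow> smooth_field_on M U (\<lambda>_. 0)"
  unfolding smooth_field_on_def by (auto intro!: smooth_on_const open_chart_image)

lemma smooth_field_on_sum:
  "open U \<Longrightarrow> (\<And>i. i \<in> I \<Longrightarrow> smooth_field_on M U (Y i)) \<Longrightarrow> smooth_field_on M U (\<lambda>x. \<Sum>i\<in>I. Y i x)"
  by (induction I rule: infinite_finite_induct) (auto intro: smooth_field_on_0 smooth_field_on_add)

lemma smooth_coord_field:
  assumes c: "c \<in> charts M"
  shows "smooth_field_on M (chart_dom c) (coord_field M c k)"
proof (rule smooth_field_onI[OF c chart(1)[OF c]])
  show "smooth_on (chart_map c ` chart_dom c) (\<lambda>p. coord_field M c k (chart_inv c p) c)"
    by (rule smooth_on_cong[OF _ smooth_on_const[of _ "axis k 1"]])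
       (use chart(2)[OF c] c in \<open>auto simp: coord_field_self charts_at_iff\<close>)
qed (use c in \<open>auto simp: coord_field_in_tangent_space charts_at_iff\<close>)

lemma smooth_component_function:
  assumes c: "c \<in> charts M" and V: "open V" "V \<subseteq> chart_dom c" and Y: "smooth_field_on M V Y"
  shows "smooth_function_on M V (\<lambda>x. Y x c $ k)"
proof (rule smooth_function_onI[OF c V])
  have "smooth_on (chart_map c ` V) (\<lambda>p. Y (chart_inv c p) c $ k)"
    by (rule smooth_on_vec_nth[OF open_chart_image_subset[OF c V]])
       (use smooth_field_on_chart[OF Y c] V(2) in \<open>simp add: Int_absorb2\<close>)
  then show "smooth_on (chart_map c ` V) ((\<lambda>x. Y x c $ k) \<circ> chart_inv c)" by (simp add: o_def)
qed

text \<open>\<open>dir_deriv\<close> uses an arbitrarily chosen chart at \<open>x\<close>. The chain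
  rule along the transition to \<open>c\<close> is compensated by the transformation law of
  \<open>v\<close>.\<close>

lemma dir_deriv_chart:
  assumes c: "c \<in> charts_at M x" and V: "open V" "x \<in> V"
    and f: "(f \<circ> chart_inv c has_derivative f') (at (chart_map c x))" and v: "v \<in> tangent_space M x"
  shows "dir_deriv M x v f = f' (v c)"
proof -
  define c0 where "c0 = (SOME c. c \<in> charts_at M x)"
  have c0: "c0 \<in> charts_at M x" unfolding c0_def using ex_chart_at someI_ex by metis
  have 1: "(transition c0 c has_derivative jac c0 c x) (at (chart_map c0 x))"
    by (rule jac_has_derivative[OF c0 c])
  have "((\<lambda>p. (f \<circ> chart_inv c) (transition c0 c p)) has_derivative (\<lambda>w. f' (jac c0 c x w))) (at (chart_map c0 x))"
    by (rule has_derivative_compose[OF 1]) (use f c0 in \<open>simp add: charts_at_iff o_def\<close>)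
  then have "(f \<circ> chart_inv c0 has_derivative (\<lambda>w. f' (jac c0 c x w))) (at (chart_map c0 x))"
    by (rule has_derivative_transform_within_open[where s="chart_map c0 ` (chart_dom c0 \<inter> chart_dom c)"])
       (use c c0 open_overlap in \<open>auto simp: charts_at_iff\<close>)
  then have "frechet_derivative (f \<circ> chart_inv c0) (at (chart_map c0 x)) = (\<lambda>w. f' (jac c0 c x w))"
    using frechet_derivative_at by metis
  then show ?thesis
    unfolding dir_deriv_def Let_def c0_def[symmetric] using tangent_vec_change[OF v c0 c] by simp
qed

lemma dir_deriv_const_on:
  assumes V: "open V" "x \<in> V" and f: "\<And>y. y \<in> V \<Longrightarrow> f y = k" and v: "v \<in> tangent_space M x"
  shows "dir_deriv M x v f = 0"
proof -
  obtain c where c: "c \<in> charts_at M x" using ex_chart_at by blast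
  have "((\<lambda>_. k) has_derivative (\<lambda>_. 0)) (at (chart_map c x))" by simp
  then have "(f \<circ> chart_inv c has_derivative (\<lambda>_. 0)) (at (chart_map c x))"
    by (rule has_derivative_transform_within_open[where s="chart_map c ` (V \<inter> chart_dom c)"])
       (use c V f open_chart_image in \<open>auto simp: charts_at_iff\<close>)
  then show ?thesis using dir_deriv_chart[OF c V _ v] by simp
qed

end

section \<open>Orthonormal frames\<close>

text \<open>The pointwise rules would make the simplifier expand sums of tangent vectors into abstractions.\<close>

lemmas [simp del] = plus_fun_apply zero_fun_apply tscale_apply

lemma tscale_simps:
  "0 *\<^sub>T v = 0" "1 *\<^sub>T v = v" "a *\<^sub>T 0 = 0" "a *\<^sub>T (b *\<^sub>T v) = (a * b) *\<^sub>T v"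
  "a *\<^sub>T (v + w) = a *\<^sub>T v + a *\<^sub>T w" "(a + b) *\<^sub>T v = a *\<^sub>T v + b *\<^sub>T v"
  by (auto simp: fun_eq_iff scaleR_add_right scaleR_add_left tscale_apply plus_fun_apply zero_fun_apply)

locale riemannian_manifold = smooth_manifold M
  for M :: "('a::topological_space, 'n::finite) manifold" +
  assumes metric: "riemannian_metric M"
begin

lemma rmetric_linear:
  assumes "u \<in> tangent_space M x" "v \<in> tangent_space M x" "w \<in> tangent_space M x"
  shows "rmetric M x (a *\<^sub>T u + b *\<^sub>T v) w = a * rmetric M x u w + b * rmetric M x v w"
  using metric assms unfolding riemannian_metric_def by blast

lemma rmetric_commute:
  "v \<in> tangent_space M x \<Longrightarrow> w \<in> tangent_space M x \<Longrightarrow> rmetric M x v w = rmetric M x w v"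
  using metric unfolding riemannian_metric_def by blast

lemma rmetric_pos: "v \<in> tangent_space M x \<Longrightarrow> v \<noteq> 0 \<Longrightarrow> rmetric M x v v > 0"
  using metric unfolding riemannian_metric_def by blast

lemma rmetric_add_left:
  assumes "u \<in> tangent_space M x" "v \<in> tangent_space M x" "w \<in> tangent_space M x"
  shows "rmetric M x (u + v) w = rmetric M x u w + rmetric M x v w"
  using rmetric_linear[OF assms, of 1 1] by (simp add: tscale_simps)

lemma rmetric_tscale_left:
  assumes "u \<in> tangent_space M x" "w \<in> tangent_space M x"
  shows "rmetric M x (a *\<^sub>T u) w = a * rmetric M x u w"
  using rmetric_linear[OF assms(1,1,2), of a 0] by (simp add: tscale_simps)

lemma rmetric_sum_left:
  assumes "\<And>i. i \<in> I \<Longrightarrow> v i \<in> tangent_space M x" "w \<in> tangent_space M x"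
  shows "rmetric M x (\<Sum>i\<in>I. v i) w = (\<Sum>i\<in>I. rmetric M x (v i) w)"
proof -
  have zero: "rmetric M x 0 w = 0"
    using rmetric_tscale_left[OF tangent_space_0 assms(2), of 0] by (simp only: tscale_simps mult_zero_left)
  show ?thesis
    using assms(1)
  proof (induction I rule: infinite_finite_induct)
  case (insert i I)
    then show ?case by (simp add: rmetric_add_left assms(2) tangent_space_sum)
  qed (simp_all add: zero)
qed

lemma rmetric_sum_right:
  assumes "\<And>i. i \<in> I \<Longrightarrow> v i \<in> tangent_space M x" "w \<in> tangent_space M x"
  shows "rmetric M x w (\<Sum>i\<in>I. v i) = (\<Sum>i\<in>I. rmetric M x w (v i))"
  using rmetric_sum_left[OF assms] rmetric_commute[OF assms(2)] assms
  by (simp add: tangent_space_sum cong: sum.cong)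

lemma rmetric_tscale_right:
  assumes "u \<in> tangent_space M x" "w \<in> tangent_space M x"
  shows "rmetric M x w (a *\<^sub>T u) = a * rmetric M x w u"
  using rmetric_tscale_left[OF assms] rmetric_commute assms by (simp add: tangent_space_tscale)

definition gform :: "('a, 'n) chart \<Rightarrow> 'a \<Rightarrow> real ^ 'n \<Rightarrow> real ^ 'n \<Rightarrow> real" where
  "gform c x v w = rmetric M x (coord_vec M c x v) (coord_vec M c x w)"

lemma gform_sym: "c \<in> charts_at M x \<Longrightarrow> gform c x v w = gform c x w v"
  unfolding gform_def by (intro rmetric_commute coord_vec_in_tangent_space)

lemma gform_bilinear:
  assumes c: "c \<in> charts_at M x"
  shows "bilinear (gform c x)"
proof -
  have *: "gform c x (a *\<^sub>R u + b *\<^sub>R v) w = a * gform c x u w + b * gform c x v w" for a b u v w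
    unfolding gform_def coord_vec_linear[OF c] by (intro rmetric_linear coord_vec_in_tangent_space c)
  have "linear (\<lambda>u. gform c x u w)" for w
    by (rule linearI) (use *[of 1 _ 1 _ w] *[of _ _ 0 0 w] in auto)
  then show ?thesis unfolding bilinear_def using gform_sym[OF c] by simp
qed

lemma gform_pos:
  assumes c: "c \<in> charts_at M x" and v: "v \<noteq> 0"
  shows "gform c x v v > 0"
  unfolding gform_def
proof (rule rmetric_pos[OF coord_vec_in_tangent_space[OF c]])
  show "coord_vec M c x v \<noteq> 0" using coord_vec_self[OF c, of v] v by (metis zero_fun_apply)
qed

lemma rmetric_gform:
  "c \<in> charts_at M x \<Longrightarrow> v \<in> tangent_space M x \<Longrightarrow> w \<in> tangent_space M x \<Longrightarrow> rmetric M x v w = gform c x (v c) (w c)"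
  by (simp add: gform_def coord_vec_components)

lemma smooth_gform:
  "c \<in> charts M \<Longrightarrow> smooth_on (chart_map c ` chart_dom c) (\<lambda>p. gform c (chart_inv c p) (axis i 1) (axis j 1))"
  using metric unfolding riemannian_metric_def gform_def coord_field_def by blast

lemma smooth_rmetric_fields:
  assumes c: "c \<in> charts M" and U: "open U" and Y: "smooth_field_on M U Y" "smooth_field_on M U Z"
  shows "smooth_on (chart_map c ` (U \<inter> chart_dom c)) (\<lambda>p. rmetric M (chart_inv c p) (Y (chart_inv c p)) (Z (chart_inv c p)))"
proof -
  have op: "open (chart_map c ` (U \<inter> chart_dom c))" by (rule open_chart_image[OF c U])
  have "smooth_on (chart_map c ` (U \<inter> chart_dom c))
      (\<lambda>p. gform c (chart_inv c p) (Y (chart_inv c p) c) (Z (chart_inv c p) c))"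
  proof (rule smooth_on_bilinear_form[where g="\<lambda>p. gform c (chart_inv c p)", OF op])
    show "smooth_on (chart_map c ` (U \<inter> chart_dom c)) (\<lambda>p. gform c (chart_inv c p) (axis i 1) (axis j 1))" for i j
      by (rule smooth_on_subset[OF smooth_gform[OF c]]) auto
    show "bilinear (gform c (chart_inv c p))" if "p \<in> chart_map c ` (U \<inter> chart_dom c)" for p
      by (rule gform_bilinear) (use that c in \<open>auto simp: charts_at_iff\<close>)
  qed (rule smooth_field_on_chart[OF Y(1) c] smooth_field_on_chart[OF Y(2) c])+
  then show ?thesis
    by (rule smooth_on_cong[OF op])
       (use c smooth_field_on_tangent[OF Y(1)] smooth_field_on_tangent[OF Y(2)] in \<open>auto simp: charts_at_iff intro!: rmetric_gform\<close>)
qed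

text \<open>A change of charts multiplies the component matrix by a Jacobian with positive
  determinant, so one chart decides the orientation.\<close>

lemma positive_basisI:
  assumes b: "\<And>j. b j \<in> tangent_space M x" and c: "c \<in> charts_at M x" and det: "det ((\<chi> i j. b j c $ i) :: real ^ 'n ^ 'n) > 0"
  shows "positive_basis M x b"
  unfolding positive_basis_def
proof (intro conjI allI ballI)
  fix c' assume c': "c' \<in> charts_at M x"
  have "((\<chi> i j. b j c' $ i) :: real ^ 'n ^ 'n) = matrix (jac c c' x) ** (\<chi> i j. b j c $ i)"
  proof -
    have "b j c' = matrix (jac c c' x) *v b j c" for j
      using tangent_vec_change[OF b c c'] matrix_works[OF linear_matrix_vector_mul_eq[THEN iffD2, OF jac_linear[OF c c']]] by simp
    then have "b j c' $ i = (\<Sum>k\<in>UNIV. matrix (jac c c' x) $ i $ k * b j c $ k)" for i j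
      by (simp add: matrix_vector_mult_def)
    then show ?thesis by (simp add: vec_eq_iff matrix_matrix_mult_def)
  qed
  then show "det ((\<chi> i j. b j c' $ i) :: real ^ 'n ^ 'n) > 0"
    using det jac_det[OF c c'] by (simp add: det_mul)
qed (rule b)

text \<open>Gram-Schmidt in a chart gives orthonormal fields of unknown orientation. One of them is
  multiplied by the sign of the determinant at \<open>x0\<close>, and the domain is shrunk to the
  points where the corrected determinant is positive.\<close>

lemma frame_exists:
  "\<exists>U e. x0 \<in> U \<and> positive_orthonormal_frame M U e"
proof -
  obtain c where c0: "c \<in> charts_at M x0" using ex_chart_at by blast
  then have c: "c \<in> charts M" "x0 \<in> chart_dom c" by (auto simp: charts_at_iff)
  define S where "S = chart_map c ` chart_dom c"
  have S: "open S" unfolding S_def by (rule chart(2)[OF c(1)])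
  have at: "c \<in> charts_at M (chart_inv c p)" if "p \<in> S" for p
    using that c by (auto simp: S_def charts_at_iff)
  have ic: "chart_map c (chart_inv c p) = p" if "p \<in> S" for p
    using that c by (auto simp: S_def)
  let ?g = "\<lambda>p. gform c (chart_inv c p)"
  have gs: "smooth_on S (\<lambda>p. ?g p (axis i 1) (axis j 1))" for i j
    unfolding S_def by (rule smooth_gform[OF c(1)])
  have "\<exists>u. \<forall>i\<in>(UNIV :: 'n set). smooth_on S (u i) \<and> (\<forall>p\<in>S. u i p \<in> span ((\<lambda>i. axis i 1) ` UNIV) \<and>
            (\<forall>j\<in>UNIV. ?g p (u i p) (u j p) = (if i = j then 1 else 0)))"
    by (rule smooth_gram_schmidt[OF S]) (use at gform_bilinear gform_sym gform_pos gs in auto)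
  then obtain u where u0: "\<forall>i::'n. smooth_on S (u i) \<and> (\<forall>p\<in>S. u i p \<in> span ((\<lambda>i. axis i 1) ` UNIV) \<and>
            (\<forall>j. ?g p (u i p) (u j p) = (if i = j then 1 else 0)))" unfolding ball_UNIV by blast
  have u: "smooth_on S (u i)" "p \<in> S \<Longrightarrow> ?g p (u i p) (u j p) = (if i = j then 1 else 0)" for i j p
    using u0 by (blast, simp)
  define A where "A p = ((\<chi> k i. u i p $ k) :: real ^ 'n ^ 'n)" for p
  \<comment> \<open>Orthonormal vectors are independent: pairing a vanishing combination with
    \<open>u j p\<close> isolates its coefficient at \<open>j\<close>.\<close>
  have detA: "det (A p) \<noteq> 0" if p: "p \<in> S" for p
  proof -
    have "w = 0" if "A p *v w = 0" for w
    proof -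
      have "(\<Sum>i\<in>UNIV. (w $ i) *\<^sub>R u i p) = A p *v w"
        by (simp add: vec_eq_iff A_def matrix_vector_mult_def mult.commute)
      then have 0: "(\<Sum>i\<in>UNIV. (w $ i) *\<^sub>R u i p) = 0" using that by simp
      have "w $ j = 0" for j
      proof -
        have lin: "linear (\<lambda>v. ?g p v (u j p))" using gform_bilinear[OF at[OF p]] by (simp add: bilinear_def)
        have "?g p (\<Sum>i\<in>UNIV. (w $ i) *\<^sub>R u i p) (u j p) = (\<Sum>i\<in>UNIV. w $ i * ?g p (u i p) (u j p))"
          by (simp add: linear_sum[OF lin] linear_cmul[OF lin])
        also have "\<dots> = (\<Sum>i\<in>UNIV. if i = j then w $ i else 0)"
          by (rule sum.cong) (auto simp: u(2)[OF p])
        also have "\<dots> = w $ j" by simp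
        finally show ?thesis using 0 linear_0[OF lin] by simp
      qed
      then show "w = 0" by (simp add: vec_eq_iff)
    qed
    then show ?thesis
      using matrix_left_invertible_ker[of "A p"] invertible_left_inverse[of "A p"] invertible_det_nz[of "A p"] by blast
  qed
  \<comment> \<open>An index whose vector may be reversed; types are inhabited, so the dimension is
    at least one.\<close>
  obtain j0 :: 'n where True by blast
  define s where "s = sgn (det (A (chart_map c x0)))"
  have s: "s * s = 1" "s * det (A (chart_map c x0)) > 0"
    using detA[of "chart_map c x0"] c by (auto simp: s_def S_def sgn_if)
  define \<sigma> where "\<sigma> i = (if i = j0 then s else 1)" for i
  have \<sigma>: "\<sigma> i * \<sigma> i = 1" for i using s by (simp add: \<sigma>_def)
  define w where "w i p = \<sigma> i *\<^sub>R u i p" for i p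
  define B where "B p = ((\<chi> k i. w i p $ k) :: real ^ 'n ^ 'n)" for p
  have detB: "det (B p) = s * det (A p)" for p
  proof -
    have "B p = A p ** (\<chi> i j. if i = j then \<sigma> i else 0)"
      by (simp add: vec_eq_iff B_def A_def w_def matrix_matrix_mult_def if_distrib[of "(*) _"] cong: if_cong)
    moreover have "det ((\<chi> i j. if i = j then \<sigma> i else 0) :: real ^ 'n ^ 'n) = s"
      by (subst det_diagonal) (auto simp: \<sigma>_def)
    ultimately show ?thesis by (simp add: det_mul)
  qed
  have ws: "smooth_on S (w i)" for i unfolding w_def by (intro smooth_on_scaleR smooth_on_const S u)
  have wg: "?g p (w i p) (w j p) = (if i = j then 1 else 0)" if "p \<in> S" for i j p
    using gform_bilinear[OF at[OF that]] u(2)[OF that] \<sigma> by (simp add: w_def bilinear_lmul bilinear_rmul)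
  have contB: "continuous_on S (\<lambda>p. det (B p))"
    unfolding B_def det_def
    by (intro continuous_intros) (auto intro!: smooth_on_imp_continuous_on[OF ws])
  define W where "W = S \<inter> (\<lambda>p. det (B p)) -` {0<..}"
  have W: "open W" unfolding W_def by (rule continuous_open_preimage[OF contB S]) auto
  define U where "U = chart_dom c \<inter> chart_map c -` W"
  have "continuous_on (chart_dom c) (chart_map c)" using chart(3)[OF c(1)] by (simp add: homeomorphism_def)
  then have U: "open U" unfolding U_def by (intro continuous_open_preimage chart(1) c W)
  have "x0 \<in> U" using c s(2) detB by (auto simp: U_def W_def S_def)
  define e where "e i y = coord_vec M c y (w i (chart_map c y))" for i y
  have "positive_orthonormal_frame M U e"
    unfolding positive_orthonormal_frame_def
  proof (intro conjI allI ballI U)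
    have aty: "c \<in> charts_at M y" "chart_map c y \<in> S" if "y \<in> U" for y
      using that c by (auto simp: U_def S_def charts_at_iff)
    show "smooth_field_on M U (e j)" for j
    proof (rule smooth_field_onI[OF c(1) U])
      have US: "chart_map c ` U \<subseteq> S" by (auto simp: U_def S_def)
      show "smooth_on (chart_map c ` U) (\<lambda>p. e j (chart_inv c p) c)"
        by (rule smooth_on_cong[OF open_chart_image_subset[OF c(1) U] smooth_on_subset[OF ws US]])
           (use aty c in \<open>auto simp: e_def coord_vec_self U_def\<close>)
    qed (use aty in \<open>auto simp: e_def coord_vec_in_tangent_space U_def\<close>)
    fix y assume y: "y \<in> U"
    show "positive_basis M y (\<lambda>j. e j y)"
    proof (rule positive_basisI[OF _ aty(1)[OF y]])
      have "((\<chi> i j. e j y c $ i) :: real ^ 'n ^ 'n) = B (chart_map c y)"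
        by (simp add: e_def B_def coord_vec_self[OF aty(1)[OF y]])
      then show "det ((\<chi> i j. e j y c $ i) :: real ^ 'n ^ 'n) > 0" using y by (simp add: U_def W_def)
    qed (use aty[OF y] in \<open>auto simp: e_def coord_vec_in_tangent_space\<close>)
    show "rmetric M y (e i y) (e j y) = (if i = j then 1 else 0)" for i j
      using wg[OF aty(2)[OF y], of i j] aty[OF y] c by (simp add: e_def gform_def charts_at_iff)
  qed
  then show ?thesis using \<open>x0 \<in> U\<close> by blast
qed

section \<open>Coordinates with respect to an orthonormal frame\<close>

definition frame_vec :: "('n \<Rightarrow> 'a \<Rightarrow> ('a, 'n) tvec) \<Rightarrow> 'a \<Rightarrow> real ^ 'n \<Rightarrow> ('a, 'n) tvec" where
  "frame_vec e x w = (\<Sum>j\<in>UNIV. (w $ j) *\<^sub>T e j x)"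

definition frame_coords :: "('n \<Rightarrow> 'a \<Rightarrow> ('a, 'n) tvec) \<Rightarrow> 'a \<Rightarrow> ('a, 'n) tvec \<Rightarrow> real ^ 'n" where
  "frame_coords e x v = (\<chi> i. rmetric M x v (e i x))"

lemma frame_vec_apply: "frame_vec e x w c = (\<Sum>j\<in>UNIV. (w $ j) *\<^sub>R e j x c)"
  by (simp add: frame_vec_def sum_fun_apply tscale_apply)

lemma frame_vec_0: "frame_vec e x 0 = 0"
  by (simp add: frame_vec_def tscale_simps)

text \<open>Serves every linear operation known on frame vectors through the columns of its matrix:
  rotations and connection matrices alike.\<close>

lemma sum_frame_vec_column:
  "(\<Sum>j\<in>UNIV. (w $ j) *\<^sub>T frame_vec e x (column j A)) = frame_vec e x (A *v w)"
proof
  fix c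
  have "(\<Sum>j\<in>UNIV. (w $ j) *\<^sub>T frame_vec e x (column j A)) c = (\<Sum>j\<in>UNIV. \<Sum>i\<in>UNIV. (A $ i $ j * w $ j) *\<^sub>R e i x c)"
    by (simp add: sum_fun_apply tscale_apply frame_vec_apply column_def scaleR_sum_right mult.commute)
  also have "\<dots> = frame_vec e x (A *v w) c"
    by (subst sum.swap) (simp add: frame_vec_apply matrix_vector_mult_def scaleR_sum_left)
  finally show "(\<Sum>j\<in>UNIV. (w $ j) *\<^sub>T frame_vec e x (column j A)) c = frame_vec e x (A *v w) c" .
qed

context
  fixes U e
  assumes pf: "positive_orthonormal_frame M U e"
begin

lemma frame_open: "open U" and frame_smooth: "smooth_field_on M U (e j)"
  and frame_orthonormal: "x \<in> U \<Longrightarrow> rmetric M x (e i x) (e j x) = (if i = j then 1 else 0)"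
  and frame_basis: "x \<in> U \<Longrightarrow> positive_basis M x (\<lambda>j. e j x)"
  using pf unfolding positive_orthonormal_frame_def by auto

lemma frame_tangent: "x \<in> U \<Longrightarrow> e j x \<in> tangent_space M x"
  using smooth_field_on_tangent[OF frame_smooth] .

lemma frame_vec_tangent: "x \<in> U \<Longrightarrow> frame_vec e x w \<in> tangent_space M x"
  unfolding frame_vec_def by (intro tangent_space_sum tangent_space_tscale frame_tangent)

lemma frame_coords_frame_vec:
  assumes x: "x \<in> U"
  shows "frame_coords e x (frame_vec e x w) = w"
proof -
  have "rmetric M x (frame_vec e x w) (e i x) = (\<Sum>j\<in>UNIV. w $ j * rmetric M x (e j x) (e i x))" for i
    unfolding frame_vec_def
    by (subst rmetric_sum_left) (auto simp: frame_tangent[OF x] tangent_space_tscale rmetric_tscale_left)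
  moreover have "(\<Sum>j\<in>UNIV. w $ j * rmetric M x (e j x) (e i x)) = (\<Sum>j\<in>UNIV. if j = i then w $ j else 0)" for i
    by (rule sum.cong) (auto simp: frame_orthonormal[OF x])
  ultimately show ?thesis by (simp add: frame_coords_def vec_eq_iff)
qed

text \<open>Orthonormality recovers the coordinates of a given combination. That the frame spans
  comes from the nonzero determinant of its components in a chart, which exhibits \<open>v\<close>
  as a combination in the first place.\<close>

lemma frame_vec_frame_coords:
  assumes x: "x \<in> U" and v: "v \<in> tangent_space M x"
  shows "frame_vec e x (frame_coords e x v) = v"
proof -
  obtain c where c: "c \<in> charts_at M x" using ex_chart_at by blast
  define E where "E = ((\<chi> i j. e j x c $ i) :: real ^ 'n ^ 'n)"
  have "det E \<noteq> 0" using frame_basis[OF x] c unfolding positive_basis_def E_def by force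
  then obtain B where B: "E ** B = mat 1"
    using invertible_det_nz[of E] invertible_right_inverse[of E] by blast
  define w where "w = B *v v c"
  have "E *v w = v c" by (simp add: w_def matrix_vector_mul_assoc B)
  moreover have "frame_vec e x w c = E *v w"
    by (simp add: frame_vec_apply vec_eq_iff E_def matrix_vector_mult_def mult.commute)
  ultimately have "v = frame_vec e x w"
    by (intro tangent_vec_eqI[OF v frame_vec_tangent[OF x] c]) simp
  then show ?thesis using frame_coords_frame_vec[OF x] by simp
qed

lemma rmetric_frame_vec:
  assumes x: "x \<in> U"
  shows "rmetric M x (frame_vec e x v) (frame_vec e x w) = v \<bullet> w"
proof -
  have "rmetric M x (frame_vec e x v) (frame_vec e x w) = (\<Sum>j\<in>UNIV. w $ j * rmetric M x (frame_vec e x v) (e j x))"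
    by (subst (2) frame_vec_def, subst rmetric_sum_right)
       (auto simp: frame_tangent[OF x] frame_vec_tangent[OF x] tangent_space_tscale rmetric_tscale_right)
  also have "\<dots> = (\<Sum>j\<in>UNIV. w $ j * frame_coords e x (frame_vec e x v) $ j)" by (simp add: frame_coords_def)
  also have "\<dots> = v \<bullet> w" by (simp add: frame_coords_frame_vec[OF x] inner_vec_def mult.commute)
  finally show ?thesis .
qed

lemma frame_vec_inject: "x \<in> U \<Longrightarrow> frame_vec e x v = frame_vec e x w \<longleftrightarrow> v = w"
  by (metis frame_coords_frame_vec)

lemma frame_det_pos:
  assumes "x \<in> U" "c \<in> charts_at M x"
  shows "det ((\<chi> i j. e j x c $ i) :: real ^ 'n ^ 'n) > 0"
  using frame_basis[OF assms(1)] assms(2) unfolding positive_basis_def by blast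

text \<open>Separates the components of \<open>v\<close> from coefficients that are smooth in the
  base point. Along a curve the former may be merely absolutely continuous.\<close>

lemma frame_coords_components:
  assumes x: "x \<in> U" and c: "c \<in> charts_at M x" and v: "v \<in> tangent_space M x"
  shows "frame_coords e x v $ i = (\<Sum>k\<in>UNIV. v c $ k * gform c x (axis k 1) (e i x c))"
proof -
  have lin: "linear (\<lambda>u. gform c x u (e i x c))" using gform_bilinear[OF c] by (simp add: bilinear_def)
  have "frame_coords e x v $ i = gform c x (\<Sum>k\<in>UNIV. (v c $ k) *\<^sub>R axis k 1) (e i x c)"
    using rmetric_gform[OF c v frame_tangent[OF x]] by (simp add: frame_coords_def flip: vec_eq_sum_axis)
  then show ?thesis by (simp add: linear_sum[OF lin] linear_cmul[OF lin])
qed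

end

end

section \<open>The Levi-Civita connection along curves\<close>

lemma has_vector_derivative_compose:
  assumes u: "(u has_vector_derivative u') (at t)" and f: "(f has_derivative f') (at (u t))"
  shows "((\<lambda>s. f (u s)) has_vector_derivative f' u') (at t)"
proof -
  have "linear f'" using has_derivative_bounded_linear[OF f] bounded_linear.linear by blast
  moreover have "((\<lambda>s. f (u s)) has_derivative (\<lambda>h. f' (h *\<^sub>R u'))) (at t)"
    using has_derivative_compose[OF u[unfolded has_vector_derivative_def] f] .
  ultimately show ?thesis unfolding has_vector_derivative_def by (simp add: linear_cmul)
qed

lemma isCont_open_neighbourhood:
  assumes "isCont x t" "open U" "x t \<in> U"
  obtains A where "open A" "t \<in> A" "\<And>s. s \<in> A \<Longrightarrow> x s \<in> U"
proof -
  have "\<exists>A. open A \<and> t \<in> A \<and> (\<forall>s\<in>A. x s \<in> U)"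
    using assms(1)[unfolded continuous_at_open, THEN spec, of U] assms(2,3) by simp
  then show ?thesis using that by blast
qed

text \<open>The union of two null sets is null, so bisection passes from short intervals around each
  time to the whole interval.\<close>

lemma AE_local:
  fixes a b :: real
  assumes ab: "a \<le> b"
    and loc: "\<And>x. x \<in> {a..b} \<Longrightarrow> \<exists>d>0. \<forall>s u. a \<le> s \<and> s \<le> x \<and> x \<le> u \<and> u \<le> b \<and> u - s < d \<longrightarrow>
      (AE t\<in>{s..u} in lebesgue. P t)"
  shows "AE t\<in>{a..b} in lebesgue. P t"
proof -
  have "a \<le> a \<longrightarrow> b \<le> b \<longrightarrow> (AE t\<in>{a..b} in lebesgue. P t)"
    using ab
  proof (induction rule: Bolzano[where P="\<lambda>s u. a \<le> s \<longrightarrow> u \<le> b \<longrightarrow> (AE t\<in>{s..u} in lebesgue. P t)"])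
    case (trans r s u)
    show ?case
    proof (intro impI)
      assume "a \<le> r" "u \<le> b"
      then have "AE t\<in>{r..s} in lebesgue. P t" "AE t\<in>{s..u} in lebesgue. P t" using trans by auto
      then show "AE t\<in>{r..u} in lebesgue. P t" by eventually_elim auto
    qed
  next
    case (local x)
    then obtain d where "d > 0" "\<forall>s u. a \<le> s \<and> s \<le> x \<and> x \<le> u \<and> u \<le> b \<and> u - s < d \<longrightarrow> (AE t\<in>{s..u} in lebesgue. P t)"
      using loc[of x] by (metis atLeastAtMost_iff)
    then show ?case by (intro exI[of _ d]) blast
  qed
  then show ?thesis by simp
qed

text \<open>Discards endpoints, where two-sided derivatives are not controlled; with
  \<open>a = b\<close> it removes a single junction.\<close>

lemma AE_interior: "AE t in lebesgue. t \<noteq> (a::real) \<and> t \<noteq> b"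
proof -
  have "AE t in lebesgue. t \<notin> {a, b}"
    by (rule AE_not_in) (simp flip: negligible_iff_null_sets)
  then show ?thesis by eventually_elim auto
qed

context smooth_manifold
begin

text \<open>Continuity is asked separately because chart maps have arbitrary values outside their
  domains, so a differentiable coordinate representation does not keep the curve in the chart. One
  chart suffices by \<open>curve_change_chart\<close>.\<close>

definition differentiable_curve_at :: "(real \<Rightarrow> 'a) \<Rightarrow> real \<Rightarrow> bool" where
  "differentiable_curve_at x t \<longleftrightarrow> isCont x t \<and> (\<exists>c\<in>charts_at M (x t). (\<lambda>s. chart_map c (x s)) differentiable (at t))"

lemma curve_change_chart:
  assumes x: "isCont x t" and c0: "c0 \<in> charts_at M (x t)" and c: "c \<in> charts_at M (x t)"
    and w: "((\<lambda>s. chart_map c0 (x s)) has_vector_derivative w) (at t)"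
  shows "((\<lambda>s. chart_map c (x s)) has_vector_derivative jac c0 c (x t) w) (at t)"
proof -
  have "open (chart_dom c0)" using c0 chart by (auto simp: charts_at_iff)
  then obtain A where A: "open A" "t \<in> A" "\<And>s. s \<in> A \<Longrightarrow> x s \<in> chart_dom c0"
    using isCont_open_neighbourhood[OF x] c0 by (metis charts_at_iff)
  have "((\<lambda>s. transition c0 c (chart_map c0 (x s))) has_vector_derivative jac c0 c (x t) w) (at t)"
    by (rule has_vector_derivative_compose[OF w jac_has_derivative[OF c0 c]])
  then show ?thesis
    by (rule has_vector_derivative_transform_within_open[OF _ A(1,2)])
       (use A c0 in \<open>auto simp: charts_at_iff\<close>)
qed

text \<open>At other times the components in different charts may be unrelated choices of
  \<open>vector_derivative\<close>; tangency of the velocity depends on the chain rule between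
  charts.\<close>

lemma differentiable_curve_velocity:
  assumes d: "differentiable_curve_at x t"
  shows "c \<in> charts_at M (x t) \<Longrightarrow> ((\<lambda>s. chart_map c (x s)) has_vector_derivative velocity M x t c) (at t)"
    and "velocity M x t \<in> tangent_space M (x t)"
proof -
  have x: "isCont x t" using d unfolding differentiable_curve_at_def by blast
  obtain c0 w where c0: "c0 \<in> charts_at M (x t)" and w: "((\<lambda>s. chart_map c0 (x s)) has_vector_derivative w) (at t)"
    using d unfolding differentiable_curve_at_def by (meson vector_derivative_works)
  have v: "velocity M x t c = jac c0 c (x t) w" if "c \<in> charts_at M (x t)" for c
    using vector_derivative_at[OF curve_change_chart[OF x c0 that w]] that by (simp add: velocity_def)
  show "((\<lambda>s. chart_map c (x s)) has_vector_derivative velocity M x t c) (at t)" if c: "c \<in> charts_at M (x t)" for c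
    using curve_change_chart[OF x c0 c w] v[OF c] by simp
  show "velocity M x t \<in> tangent_space M (x t)"
    by (rule tangent_spaceI) (auto simp: v jac_compose c0, simp add: velocity_def)
qed

lemma differentiable_curve_compose:
  assumes d: "differentiable_curve_at x t" and c: "c \<in> charts_at M (x t)"
    and F: "(F \<circ> chart_inv c has_derivative F') (at (chart_map c (x t)))"
  shows "((\<lambda>s. F (x s)) has_vector_derivative F' (velocity M x t c)) (at t)"
proof -
  have x: "isCont x t" using d unfolding differentiable_curve_at_def by blast
  have "open (chart_dom c)" using c chart by (auto simp: charts_at_iff)
  then obtain A where A: "open A" "t \<in> A" "\<And>s. s \<in> A \<Longrightarrow> x s \<in> chart_dom c"
    using isCont_open_neighbourhood[OF x] c by (metis charts_at_iff)
  have "((\<lambda>s. (F \<circ> chart_inv c) (chart_map c (x s))) has_vector_derivative F' (velocity M x t c)) (at t)"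
    by (rule has_vector_derivative_compose[OF differentiable_curve_velocity(1)[OF d c] F])
  then show ?thesis
    by (rule has_vector_derivative_transform_within_open[OF _ A(1,2)]) (use A c in \<open>auto simp: charts_at_iff\<close>)
qed

lemma ac_curve_isCont:
  assumes "ac_curve M \<tau> x" "0 < t" "t < \<tau>"
  shows "isCont x t"
proof -
  have "continuous_on {0<..<\<tau>} x"
    using assms(1) by (auto simp: ac_curve_def intro: continuous_on_subset)
  then show ?thesis using assms(2,3) by (simp add: continuous_on_eq_continuous_at)
qed

lemma ac_curve_chart:
  assumes "ac_curve M \<tau> x" "c \<in> charts M" "0 \<le> a" "a \<le> b" "b \<le> \<tau>" "x ` {a..b} \<subseteq> chart_dom c"
  shows "abs_continuous_on a b (\<lambda>t. chart_map c (x t))"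
  using assms unfolding ac_curve_def by blast

text \<open>A chart contains the curve for a short time only, which gives differentiable coordinates
  almost everywhere there. Continuity of the curve on both sides is available at interior
  times.\<close>

lemma AE_differentiable_curve:
  assumes x: "ac_curve M \<tau> x" and \<tau>: "0 \<le> \<tau>"
  shows "AE t\<in>{0..\<tau>} in lebesgue. differentiable_curve_at x t"
proof (rule AE_local[OF \<tau>])
  fix t0 assume t0: "t0 \<in> {0..\<tau>}"
  obtain c where c: "c \<in> charts_at M (x t0)" using ex_chart_at by blast
  then have cM: "c \<in> charts M" by (simp add: charts_at_iff)
  obtain d where d: "d > 0" "\<And>s u. 0 \<le> s \<and> s \<le> t0 \<and> t0 \<le> u \<and> u \<le> \<tau> \<and> u - s < d \<Longrightarrow> x ` {s..u} \<subseteq> chart_dom c"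
    using continuous_on_short_intervals[of 0 \<tau> x t0 "chart_dom c"] x t0 c chart(1)[OF cM]
    by (auto simp: ac_curve_def charts_at_iff)
  show "\<exists>d>0. \<forall>s u. 0 \<le> s \<and> s \<le> t0 \<and> t0 \<le> u \<and> u \<le> \<tau> \<and> u - s < d \<longrightarrow>
      (AE t\<in>{s..u} in lebesgue. differentiable_curve_at x t)"
  proof (intro exI[of _ d] conjI allI impI)
    fix s u assume su: "0 \<le> s \<and> s \<le> t0 \<and> t0 \<le> u \<and> u \<le> \<tau> \<and> u - s < d"
    note dom = d(2)[OF su]
    have "abs_continuous_on s u (\<lambda>t. chart_map c (x t))"
      by (rule ac_curve_chart[OF x cM _ _ _ dom]) (use su in auto)
    then obtain g where "AE t\<in>{s..u} in lebesgue. ((\<lambda>t. chart_map c (x t)) has_vector_derivative g t) (at t)"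
      using su by (elim abs_continuous_on_AE_derivative[rotated]) auto
    then show "AE t\<in>{s..u} in lebesgue. differentiable_curve_at x t"
      using AE_interior[of 0 \<tau>]
    proof (eventually_elim, intro impI)
      fix t assume t: "t \<in> {s..u} \<longrightarrow> ((\<lambda>t. chart_map c (x t)) has_vector_derivative g t) (at t)"
        "t \<noteq> 0 \<and> t \<noteq> \<tau>" "t \<in> {s..u}"
      have "isCont x t" by (rule ac_curve_isCont[OF x]) (use t su in auto)
      moreover have "c \<in> charts_at M (x t)" using dom t(3) cM by (auto simp: charts_at_iff)
      moreover have "(\<lambda>s. chart_map c (x s)) differentiable (at t)"
        using t has_vector_derivative_def differentiableI by blast
      ultimately show "differentiable_curve_at x t" unfolding differentiable_curve_at_def by blast
    qed
  qed (rule d)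
qed

end

section \<open>The connection in charts and in orthonormal frames\<close>

locale levi_civita_manifold = riemannian_manifold M
  for M :: "('a::topological_space, 'n::finite) manifold" +
  fixes nabla :: "('a, 'n) connection"
  assumes levi_civita: "levi_civita M nabla"
begin

context
  fixes U Y x v
  assumes U: "open U" and Y: "smooth_field_on M U Y" and x: "x \<in> U" and v: "v \<in> tangent_space M x"
begin

lemmas nabla_affine =
  levi_civita[unfolded levi_civita_def affine_connection_def, THEN conjunct1, THEN spec[of _ U], THEN spec[of _ Y],
    THEN mp, OF conjI[OF U Y], THEN conjunct1, THEN bspec[OF _ x], THEN bspec[OF _ v]]

lemma nabla_tangent: "nabla x v Y \<in> tangent_space M x"
  using nabla_affine by (rule conjunct1)

lemma nabla_linear:
  "w \<in> tangent_space M x \<Longrightarrow> nabla x (a *\<^sub>T v + b *\<^sub>T w) Y = a *\<^sub>T nabla x v Y + b *\<^sub>T nabla x w Y"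
  using nabla_affine[THEN conjunct2, THEN conjunct1, THEN bspec, of w] by simp

lemma nabla_add: "smooth_field_on M U Y' \<Longrightarrow> nabla x v (\<lambda>y. Y y + Y' y) = nabla x v Y + nabla x v Y'"
  using nabla_affine[THEN conjunct2, THEN conjunct2, THEN conjunct1, THEN spec[of _ Y']] by simp

lemma nabla_tscale:
  "smooth_function_on M U f \<Longrightarrow> nabla x v (\<lambda>y. f y *\<^sub>T Y y) = dir_deriv M x v f *\<^sub>T Y x + f x *\<^sub>T nabla x v Y"
  using nabla_affine[THEN conjunct2, THEN conjunct2, THEN conjunct2, THEN conjunct1, THEN spec[of _ f]] by simp

lemma nabla_cong: "(\<And>y. y \<in> U \<Longrightarrow> Y' y = Y y) \<Longrightarrow> nabla x v Y' = nabla x v Y"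
  using nabla_affine[THEN conjunct2, THEN conjunct2, THEN conjunct2, THEN conjunct2, THEN spec[of _ Y']] by blast

end

lemma smooth_nabla:
  "open U \<Longrightarrow> smooth_field_on M U Y \<Longrightarrow> smooth_field_on M U X \<Longrightarrow> smooth_field_on M U (\<lambda>x. nabla x (X x) Y)"
  using levi_civita[unfolded levi_civita_def affine_connection_def, THEN conjunct1, THEN spec[of _ U], THEN spec[of _ Y],
    THEN mp, OF conjI, THEN conjunct2, THEN spec[of _ X]] by blast

lemma metric_compatible:
  "open U \<Longrightarrow> smooth_field_on M U Y \<Longrightarrow> smooth_field_on M U Z \<Longrightarrow> x \<in> U \<Longrightarrow> v \<in> tangent_space M x \<Longrightarrow>
   dir_deriv M x v (\<lambda>y. rmetric M y (Y y) (Z y)) = rmetric M x (nabla x v Y) (Z x) + rmetric M x (Y x) (nabla x v Z)"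
  using levi_civita[unfolded levi_civita_def metric_compatible_def, THEN conjunct2, THEN conjunct2, THEN spec[of _ U],
    THEN spec[of _ Y], THEN spec[of _ Z]] by simp

lemma nabla_0:
  assumes "open U" "x \<in> U" "v \<in> tangent_space M x"
  shows "nabla x v (\<lambda>_. 0) = 0"
  using nabla_tscale[OF assms(1) smooth_field_on_0[OF assms(1)] assms(2,3) smooth_function_on_const[OF assms(1), of 0]]
  by (simp add: tscale_simps)

lemma nabla_sum:
  assumes U: "open U" "x \<in> U" and v: "v \<in> tangent_space M x" and "finite I"
    and f: "\<And>k. k \<in> I \<Longrightarrow> smooth_function_on M U (f k)" and Y: "\<And>k. k \<in> I \<Longrightarrow> smooth_field_on M U (Y k)"
  shows "nabla x v (\<lambda>y. \<Sum>k\<in>I. f k y *\<^sub>T Y k y) = (\<Sum>k\<in>I. dir_deriv M x v (f k) *\<^sub>T Y k x + f k x *\<^sub>T nabla x v (Y k))"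
  using \<open>finite I\<close> f Y
proof (induction I)
  case empty
  then show ?case using nabla_0[OF U v] by simp
next
  case (insert k I)
  have s1: "smooth_field_on M U (\<lambda>y. f k y *\<^sub>T Y k y)"
    by (rule smooth_field_on_tscale) (use U insert.prems in auto)
  have s2: "smooth_field_on M U (\<lambda>y. \<Sum>k\<in>I. f k y *\<^sub>T Y k y)"
    by (intro smooth_field_on_sum smooth_field_on_tscale U) (use insert.prems in auto)
  have "nabla x v (\<lambda>y. \<Sum>k\<in>insert k I. f k y *\<^sub>T Y k y)
      = nabla x v (\<lambda>y. f k y *\<^sub>T Y k y) + nabla x v (\<lambda>y. \<Sum>k\<in>I. f k y *\<^sub>T Y k y)"
    using nabla_add[OF U(1) s1 U(2) v s2] insert.hyps by simp
  also have "nabla x v (\<lambda>y. f k y *\<^sub>T Y k y) = dir_deriv M x v (f k) *\<^sub>T Y k x + f k x *\<^sub>T nabla x v (Y k)"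
    by (rule nabla_tscale[OF U(1) _ U(2) v]) (use insert.prems in auto)
  also have "nabla x v (\<lambda>y. \<Sum>k\<in>I. f k y *\<^sub>T Y k y) = (\<Sum>k\<in>I. dir_deriv M x v (f k) *\<^sub>T Y k x + f k x *\<^sub>T nabla x v (Y k))"
    by (rule insert.IH) (use insert.prems in auto)
  finally show ?case using insert.hyps by simp
qed

text \<open>Expanding \<open>Y\<close> in the coordinate fields and applying the Leibniz rule gives
  the derivative of the components plus Christoffel terms, the shape in which
  \<open>cov_deriv\<close> is defined.\<close>

lemma nabla_chart:
  assumes U: "open U" "x \<in> U" and Y: "smooth_field_on M U Y" and c: "c \<in> charts_at M x" and v: "v \<in> tangent_space M x"
  shows "nabla x v Y c = frechet_derivative (\<lambda>p. Y (chart_inv c p) c) (at (chart_map c x)) (v c)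
    + (\<Sum>k\<in>UNIV. (Y x c $ k) *\<^sub>R nabla x v (coord_field M c k) c)"
proof -
  have cM: "c \<in> charts M" "x \<in> chart_dom c" using c by (auto simp: charts_at_iff)
  \<comment> \<open>Coordinate fields are smooth fields on the chart domain, so the expansion takes
    place on the overlap.\<close>
  define V where "V = U \<inter> chart_dom c"
  have V: "open V" "x \<in> V" "V \<subseteq> chart_dom c" "V \<subseteq> U" using U chart(1)[OF cM(1)] cM by (auto simp: V_def)
  have YV: "smooth_field_on M V Y" by (rule smooth_field_on_subset[OF Y V(4)])
  let ?F = "\<lambda>p. Y (chart_inv c p) c"
  have F: "(?F has_derivative frechet_derivative ?F (at (chart_map c x))) (at (chart_map c x))"
    by (rule smooth_on_imp_has_derivative[OF smooth_field_on_chart[OF YV cM(1)]]) (use V cM in auto)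
  have dd: "dir_deriv M x v (\<lambda>y. Y y c $ k) = frechet_derivative ?F (at (chart_map c x)) (v c) $ k" for k
    using dir_deriv_chart[OF c V(1,2) _ v, of "\<lambda>y. Y y c $ k" "\<lambda>w. frechet_derivative ?F (at (chart_map c x)) w $ k"]
      bounded_linear.has_derivative[OF bounded_linear_vec_nth[of k] F] by (simp add: o_def)
  have sf: "smooth_function_on M V (\<lambda>y. Y y c $ k)" for k
    by (rule smooth_component_function[OF cM(1) V(1,3) YV])
  have sc: "smooth_field_on M V (coord_field M c k)" for k
    by (rule smooth_field_on_subset[OF smooth_coord_field[OF cM(1)] V(3)])
  have "nabla x v Y = nabla x v (\<lambda>y. \<Sum>k\<in>UNIV. (Y y c $ k) *\<^sub>T coord_field M c k y)"
  proof (rule nabla_cong[OF V(1) _ V(2) v])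
    show "smooth_field_on M V (\<lambda>y. \<Sum>k\<in>UNIV. (Y y c $ k) *\<^sub>T coord_field M c k y)"
      by (intro smooth_field_on_sum smooth_field_on_tscale V sf sc)
    show "Y y = (\<Sum>k\<in>UNIV. (Y y c $ k) *\<^sub>T coord_field M c k y)" if "y \<in> V" for y
      by (rule tangent_vec_eq_sum_coord) (use that V cM smooth_field_on_tangent[OF YV] in \<open>auto simp: charts_at_iff\<close>)
  qed
  also have "\<dots> = (\<Sum>k\<in>UNIV. dir_deriv M x v (\<lambda>y. Y y c $ k) *\<^sub>T coord_field M c k x
      + (Y x c $ k) *\<^sub>T nabla x v (coord_field M c k))"
    by (rule nabla_sum[OF V(1,2) v _ sf sc]) simp
  finally show ?thesis
    by (simp add: dd sum_fun_apply tscale_apply plus_fun_apply coord_field_self[OF c] sum.distrib flip: vec_eq_sum_axis)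
qed

lemma nabla_sum_direction:
  assumes U: "open U" "x \<in> U" and Y: "smooth_field_on M U Y" and w: "\<And>k. k \<in> I \<Longrightarrow> w k \<in> tangent_space M x"
  shows "nabla x (\<Sum>k\<in>I. a k *\<^sub>T w k) Y = (\<Sum>k\<in>I. a k *\<^sub>T nabla x (w k) Y)"
proof -
  have 0: "nabla x 0 Y = 0"
    using nabla_linear[OF U(1) Y U(2) tangent_space_0 tangent_space_0, of 0 0] by (simp add: tscale_simps)
  show ?thesis
    using w
  proof (induction I rule: infinite_finite_induct)
    case (insert k I)
    have s: "(\<Sum>k\<in>I. a k *\<^sub>T w k) \<in> tangent_space M x"
      by (intro tangent_space_sum tangent_space_tscale) (use insert.prems in auto)
    have "nabla x (a k *\<^sub>T w k + 1 *\<^sub>T (\<Sum>k\<in>I. a k *\<^sub>T w k)) Y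
        = a k *\<^sub>T nabla x (w k) Y + 1 *\<^sub>T nabla x (\<Sum>k\<in>I. a k *\<^sub>T w k) Y"
      by (rule nabla_linear[OF U(1) Y U(2) _ s]) (use insert.prems in auto)
    then show ?case using insert by (simp add: tscale_simps)
  qed (simp_all add: 0)
qed

text \<open>The connection form of the frame evaluated on \<open>v\<close>: column \<open>j\<close>
  is meant to hold the frame coordinates of the derivative of \<open>e j\<close>.\<close>

definition connection_matrix :: "('n \<Rightarrow> 'a \<Rightarrow> ('a, 'n) tvec) \<Rightarrow> 'a \<Rightarrow> ('a, 'n) tvec \<Rightarrow> real ^ 'n ^ 'n" where
  "connection_matrix e x v = (\<chi> i j. rmetric M x (nabla x v (e j)) (e i x))"

context
  fixes U e
  assumes pf: "positive_orthonormal_frame M U e"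
begin

lemma nabla_frame:
  assumes "x \<in> U" "v \<in> tangent_space M x"
  shows "nabla x v (e j) = frame_vec e x (column j (connection_matrix e x v))"
proof -
  have "nabla x v (e j) \<in> tangent_space M x" by (rule nabla_tangent[OF frame_open[OF pf] frame_smooth[OF pf] assms])
  then have "frame_vec e x (frame_coords e x (nabla x v (e j))) = nabla x v (e j)"
    by (rule frame_vec_frame_coords[OF pf assms(1)])
  moreover have "frame_coords e x (nabla x v (e j)) = column j (connection_matrix e x v)"
    by (simp add: vec_eq_iff frame_coords_def column_def connection_matrix_def)
  ultimately show ?thesis by simp
qed

text \<open>Differentiate the constant inner products of the frame fields, using metric
  compatibility.\<close>

lemma connection_matrix_skew:
  assumes "x \<in> U" "v \<in> tangent_space M x"
  shows "connection_matrix e x v $ i $ j = - connection_matrix e x v $ j $ i"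
proof -
  have "dir_deriv M x v (\<lambda>y. rmetric M y (e i y) (e j y)) = 0"
    by (rule dir_deriv_const_on[OF frame_open[OF pf] assms(1) frame_orthonormal[OF pf] assms(2)])
  then have "rmetric M x (nabla x v (e i)) (e j x) + rmetric M x (e i x) (nabla x v (e j)) = 0"
    using metric_compatible[OF frame_open[OF pf] frame_smooth[OF pf] frame_smooth[OF pf] assms] by metis
  moreover have "rmetric M x (e i x) (nabla x v (e j)) = rmetric M x (nabla x v (e j)) (e i x)"
    by (rule rmetric_commute[OF frame_tangent[OF pf assms(1)] nabla_tangent[OF frame_open[OF pf] frame_smooth[OF pf] assms]])
  ultimately show ?thesis by (simp add: connection_matrix_def)
qed

text \<open>Linearity in the direction isolates the velocity. Along an absolutely continuous curve
  the matrix becomes a sum of continuous functions times integrable velocity components, hence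
  integrable.\<close>

lemma connection_matrix_components:
  assumes x: "x \<in> U" and v: "v \<in> tangent_space M x" and c: "c \<in> charts_at M x"
  shows "connection_matrix e x v $ i $ j = (\<Sum>k\<in>UNIV. v c $ k * connection_matrix e x (coord_field M c k x) $ i $ j)"
proof -
  have t: "coord_field M c k x \<in> tangent_space M x" for k by (rule coord_field_in_tangent_space[OF c])
  have n: "nabla x (coord_field M c k x) (e j) \<in> tangent_space M x" for k
    by (rule nabla_tangent[OF frame_open[OF pf] frame_smooth[OF pf] x t])
  have "nabla x v (e j) = nabla x (\<Sum>k\<in>UNIV. (v c $ k) *\<^sub>T coord_field M c k x) (e j)"
    using tangent_vec_eq_sum_coord[OF c v] by metis
  also have "\<dots> = (\<Sum>k\<in>UNIV. (v c $ k) *\<^sub>T nabla x (coord_field M c k x) (e j))"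
    by (rule nabla_sum_direction[OF frame_open[OF pf] x frame_smooth[OF pf] t])
  finally show ?thesis
    unfolding connection_matrix_def
    by (simp add: rmetric_sum_left rmetric_tscale_left tangent_space_tscale n frame_tangent[OF pf x])
qed

lemma smooth_connection_matrix:
  assumes c: "c \<in> charts M"
  shows "smooth_on (chart_map c ` (U \<inter> chart_dom c))
    (\<lambda>p. connection_matrix e (chart_inv c p) (coord_field M c k (chart_inv c p)) $ i $ j)"
proof -
  define V where "V = U \<inter> chart_dom c"
  have V: "open V" "V \<subseteq> chart_dom c" "V \<subseteq> U" using frame_open[OF pf] chart(1)[OF c] by (auto simp: V_def)
  have s: "smooth_field_on M V (e l)" for l by (rule smooth_field_on_subset[OF frame_smooth[OF pf] V(3)])
  have "smooth_field_on M V (\<lambda>x. nabla x (coord_field M c k x) (e j))"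
    by (rule smooth_nabla[OF V(1) s smooth_field_on_subset[OF smooth_coord_field[OF c] V(2)]])
  from smooth_rmetric_fields[OF c V(1) this s[of i]] show ?thesis
    by (simp add: connection_matrix_def V_def Int_assoc)
qed

text \<open>\<open>cov_deriv\<close> is defined by coordinate fields. Differentiating
  \<open>e j\<close> along the curve and adding its Christoffel terms reassembles
  \<open>nabla\<close> of \<open>e j\<close>, whose frame coordinates are a column of the connection
  matrix. The representation of \<open>Z\<close> is asked on an open set of times because the
  derivatives are two-sided.\<close>

lemma cov_deriv_frame:
  assumes d: "differentiable_curve_at x t" and x: "x t \<in> U"
    and A: "open A" "t \<in> A" "\<And>s. s \<in> A \<Longrightarrow> Z s = frame_vec e (x s) (z s)"
    and z: "(z has_vector_derivative z') (at t)"
  shows "cov_deriv M nabla x Z t = frame_vec e (x t) (z' + connection_matrix e (x t) (velocity M x t) *v z t)"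
proof
  fix c
  let ?v = "velocity M x t" and ?\<Omega> = "connection_matrix e (x t) (velocity M x t)"
  have v: "?v \<in> tangent_space M (x t)" by (rule differentiable_curve_velocity(2)[OF d])
  show "cov_deriv M nabla x Z t c = frame_vec e (x t) (z' + ?\<Omega> *v z t) c"
  proof (cases "c \<in> charts_at M (x t)")
    case False
    then show ?thesis
      using tangent_vec_outside[OF frame_vec_tangent[OF pf x] False] by (simp add: cov_deriv_def)
  next
    case True
    then have c: "c \<in> charts M" "x t \<in> chart_dom c" by (auto simp: charts_at_iff)
    define De where "De j = frechet_derivative (\<lambda>p. e j (chart_inv c p) c) (at (chart_map c (x t))) (?v c)" for j
    define N where "N k = nabla (x t) ?v (coord_field M c k) c" for k
    have De: "((\<lambda>s. e j (x s) c) has_vector_derivative De j) (at t)" for j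
      unfolding De_def
    proof (rule differentiable_curve_compose[OF d True, of "\<lambda>y. e j y c"])
      show "((\<lambda>y. e j y c) \<circ> chart_inv c has_derivative frechet_derivative (\<lambda>p. e j (chart_inv c p) c) (at (chart_map c (x t))))
          (at (chart_map c (x t)))"
        unfolding o_def
        by (rule smooth_on_imp_has_derivative[OF smooth_field_on_chart[OF frame_smooth[OF pf] c(1)]]) (use x c in auto)
    qed
    have zj: "((\<lambda>s. z s $ j) has_vector_derivative z' $ j) (at t)" for j
      using bounded_linear.has_vector_derivative[OF bounded_linear_vec_nth z] .
    have "((\<lambda>s. \<Sum>j\<in>UNIV. (z s $ j) *\<^sub>R e j (x s) c) has_vector_derivative
        (\<Sum>j\<in>UNIV. (z t $ j) *\<^sub>R De j + (z' $ j) *\<^sub>R e j (x t) c)) (at t)"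
      by (intro has_vector_derivative_sum bounded_bilinear.has_vector_derivative[OF bounded_bilinear_scaleR] zj De)
    then have "((\<lambda>s. Z s c) has_vector_derivative (\<Sum>j\<in>UNIV. (z t $ j) *\<^sub>R De j + (z' $ j) *\<^sub>R e j (x t) c)) (at t)"
      by (rule has_vector_derivative_transform_within_open[OF _ A(1,2)]) (simp add: A(3) frame_vec_apply)
    then have vd: "vector_derivative (\<lambda>s. Z s c) (at t) = (\<Sum>j\<in>UNIV. (z t $ j) *\<^sub>R De j + (z' $ j) *\<^sub>R e j (x t) c)"
      by (rule vector_derivative_at)
    have ne: "nabla (x t) ?v (e j) c = De j + (\<Sum>k\<in>UNIV. (e j (x t) c $ k) *\<^sub>R N k)" for j
      unfolding De_def N_def by (rule nabla_chart[OF frame_open[OF pf] x frame_smooth[OF pf] True v])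
    have Zk: "Z t c $ k = (\<Sum>j\<in>UNIV. z t $ j * e j (x t) c $ k)" for k
      by (simp add: A frame_vec_apply)
    have "cov_deriv M nabla x Z t c = (\<Sum>j\<in>UNIV. (z t $ j) *\<^sub>R De j + (z' $ j) *\<^sub>R e j (x t) c) + (\<Sum>k\<in>UNIV. (Z t c $ k) *\<^sub>R N k)"
      using True by (simp add: cov_deriv_def vd N_def)
    also have "(\<Sum>k\<in>UNIV. (Z t c $ k) *\<^sub>R N k) = (\<Sum>k\<in>UNIV. \<Sum>j\<in>UNIV. (z t $ j * e j (x t) c $ k) *\<^sub>R N k)"
      by (simp add: Zk scaleR_sum_left)
    also have "\<dots> = (\<Sum>j\<in>UNIV. \<Sum>k\<in>UNIV. (z t $ j * e j (x t) c $ k) *\<^sub>R N k)"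
      by (rule sum.swap)
    also have "\<dots> = (\<Sum>j\<in>UNIV. (z t $ j) *\<^sub>R (\<Sum>k\<in>UNIV. (e j (x t) c $ k) *\<^sub>R N k))"
      by (simp add: scaleR_sum_right)
    also have "(\<Sum>j\<in>UNIV. (z t $ j) *\<^sub>R De j + (z' $ j) *\<^sub>R e j (x t) c)
        + (\<Sum>j\<in>UNIV. (z t $ j) *\<^sub>R (\<Sum>k\<in>UNIV. (e j (x t) c $ k) *\<^sub>R N k))
        = (\<Sum>j\<in>UNIV. (z' $ j) *\<^sub>R e j (x t) c + (z t $ j) *\<^sub>R nabla (x t) ?v (e j) c)"
      unfolding ne by (simp add: sum.distrib scaleR_add_right)
    also have "\<dots> = (\<Sum>j\<in>UNIV. (z' $ j) *\<^sub>R e j (x t) c) + (\<Sum>j\<in>UNIV. \<Sum>i\<in>UNIV. (z t $ j * ?\<Omega> $ i $ j) *\<^sub>R e i (x t) c)"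
      unfolding nabla_frame[OF x v] frame_vec_apply
      by (simp add: sum.distrib column_def scaleR_sum_right)
    also have "(\<Sum>j\<in>UNIV. \<Sum>i\<in>UNIV. (z t $ j * ?\<Omega> $ i $ j) *\<^sub>R e i (x t) c)
        = (\<Sum>i\<in>UNIV. (?\<Omega> *v z t) $ i *\<^sub>R e i (x t) c)"
      by (subst sum.swap) (simp add: matrix_vector_mult_def scaleR_sum_left mult.commute)
    also have "(\<Sum>j\<in>UNIV. (z' $ j) *\<^sub>R e j (x t) c) + (\<Sum>i\<in>UNIV. (?\<Omega> *v z t) $ i *\<^sub>R e i (x t) c)
        = frame_vec e (x t) (z' + ?\<Omega> *v z t) c"
      by (simp add: frame_vec_apply scaleR_add_left sum.distrib)
    finally show ?thesis .
  qed
qed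

end

end

section \<open>Parallel frames\<close>

lemma abs_continuous_on_vec:
  fixes f :: "real \<Rightarrow> real ^ 'n"
  assumes "\<And>i. abs_continuous_on a b (\<lambda>t. f t $ i)"
  shows "abs_continuous_on a b f"
proof -
  have "abs_continuous_on a b (\<lambda>t. \<Sum>i\<in>UNIV. (f t $ i) *\<^sub>R (axis i 1 :: real ^ 'n))"
    by (intro abs_continuous_on_sum abs_continuous_on_scaleR abs_continuous_on_const assms)
  then show ?thesis by (rule abs_continuous_on_cong) (rule vec_eq_sum_axis)
qed

lemma abs_continuous_on_matrix_vector:
  fixes A :: "real \<Rightarrow> real ^ 'm ^ 'n"
  assumes "abs_continuous_on a b A" "abs_continuous_on a b z"
  shows "abs_continuous_on a b (\<lambda>t. A t *v z t)"
proof (rule abs_continuous_on_vec)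
  fix i
  have "abs_continuous_on a b (\<lambda>t. A t $ i $ j)" for j
    by (intro bounded_linear.abs_continuous_on[OF bounded_linear_vec_nth] assms)
  moreover have "abs_continuous_on a b (\<lambda>t. z t $ j)" for j
    by (intro bounded_linear.abs_continuous_on[OF bounded_linear_vec_nth] assms)
  ultimately show "abs_continuous_on a b (\<lambda>t. (A t *v z t) $ i)"
    unfolding matrix_vector_mult_def by (simp add: abs_continuous_on_sum abs_continuous_on_mult)
qed

lemma bounded_bilinear_matrix_matrix_mult:
  "bounded_bilinear ((**) :: real ^ 'm ^ 'n \<Rightarrow> real ^ 'k ^ 'm \<Rightarrow> real ^ 'k ^ 'n)"
  unfolding bilinear_conv_bounded_bilinear[symmetric] bilinear_def
  by (intro conjI allI linearI)
     (simp_all add: matrix_matrix_mult_def vec_eq_iff sum.distrib[symmetric] algebra_simps sum_distrib_left)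

lemma bounded_linear_column: "bounded_linear (column k :: real ^ 'n ^ 'm \<Rightarrow> real ^ 'm)"
  unfolding linear_conv_bounded_linear[symmetric] by (intro linearI) (simp_all add: column_def vec_eq_iff)

lemma column_matrix_mult: "column k (A ** B) = A *v column k B"
  by (simp add: column_def matrix_matrix_mult_def matrix_vector_mult_def vec_eq_iff)

text \<open>Takes the place of an evolution equation for the determinant in keeping a parallel frame
  independent on short intervals.\<close>

lemma det_nonzero_near_id: "\<exists>\<delta>>0. \<forall>A :: real ^ 'n ^ 'n. norm (A - mat 1) < \<delta> \<longrightarrow> det A \<noteq> 0"
proof -
  have "continuous_on UNIV (det :: real ^ 'n ^ 'n \<Rightarrow> real)"
    unfolding det_def[abs_def] by (intro continuous_intros)
  then have "isCont (det :: real ^ 'n ^ 'n \<Rightarrow> real) (mat 1)"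
    by (simp add: continuous_on_eq_continuous_at)
  then obtain \<delta> where "\<delta> > 0" "\<And>A :: real ^ 'n ^ 'n. dist A (mat 1) < \<delta> \<Longrightarrow> dist (det A) (det (mat 1 :: real ^ 'n ^ 'n)) < 1"
    unfolding continuous_at_eps_delta by (metis zero_less_one)
  then show ?thesis by (intro exI[of _ \<delta>]) (force simp: dist_norm)
qed

lemma vector_derivative_cong_open:
  assumes "open A" "t \<in> A" "\<And>s. s \<in> A \<Longrightarrow> f s = g s"
  shows "vector_derivative f (at t) = vector_derivative g (at t)"
proof -
  have "(f has_vector_derivative D) (at t) \<longleftrightarrow> (g has_vector_derivative D) (at t)" for D
    using has_vector_derivative_transform_within_open[of f D t A g]
      has_vector_derivative_transform_within_open[of g D t A f] assms by auto
  then show ?thesis unfolding vector_derivative_def by simp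
qed

text \<open>Lets a concatenated field be differentiated away from its junction.\<close>

lemma cov_deriv_cong_open:
  assumes "open A" "t \<in> A" "\<And>s. s \<in> A \<Longrightarrow> Z s = Z' s"
  shows "cov_deriv M nabla x Z t = cov_deriv M nabla x Z' t"
  using vector_derivative_cong_open[OF assms(1,2), of "\<lambda>s. Z s c" "\<lambda>s. Z' s c" for c] assms
  by (simp add: cov_deriv_def fun_eq_iff)

section \<open>Fields along a curve in frame coordinates\<close>

context riemannian_manifold
begin

lemma smooth_gform_frame:
  assumes pf: "positive_orthonormal_frame M U e" and c: "c \<in> charts M"
  shows "smooth_on (chart_map c ` (U \<inter> chart_dom c)) (\<lambda>p. gform c (chart_inv c p) (axis k 1) (e i (chart_inv c p) c))"
proof (rule smooth_on_bilinear_form[where g="\<lambda>p. gform c (chart_inv c p)" and a="\<lambda>_. axis k 1"])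
  show op: "open (chart_map c ` (U \<inter> chart_dom c))" by (rule open_chart_image[OF c frame_open[OF pf]])
  show "bilinear (gform c (chart_inv c p))" if "p \<in> chart_map c ` (U \<inter> chart_dom c)" for p
    by (rule gform_bilinear) (use that c in \<open>auto simp: charts_at_iff\<close>)
  show "smooth_on (chart_map c ` (U \<inter> chart_dom c)) (\<lambda>p. gform c (chart_inv c p) (axis i 1) (axis j 1))" for i j
    by (rule smooth_on_subset[OF smooth_gform[OF c]]) auto
  show "smooth_on (chart_map c ` (U \<inter> chart_dom c)) (\<lambda>_. axis k 1)" by (rule smooth_on_const[OF op])
  show "smooth_on (chart_map c ` (U \<inter> chart_dom c)) (\<lambda>p. e i (chart_inv c p) c)"
    by (rule smooth_field_on_chart[OF frame_smooth[OF pf] c])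
qed

context
  fixes U e \<tau> x a b c
  assumes pf: "positive_orthonormal_frame M U e" and x: "ac_curve M \<tau> x"
    and ab: "0 \<le> a" "a \<le> b" "b \<le> \<tau>" and c: "c \<in> charts M" and dom: "x ` {a..b} \<subseteq> U \<inter> chart_dom c"
begin

lemma ac_smooth_along:
  fixes F :: "'a \<Rightarrow> 'f::euclidean_space"
  assumes "smooth_on (chart_map c ` (U \<inter> chart_dom c)) (\<lambda>p. F (chart_inv c p))"
  shows "abs_continuous_on a b (\<lambda>t. F (x t))"
proof -
  have "abs_continuous_on a b (\<lambda>t. F (chart_inv c (chart_map c (x t))))"
    by (rule abs_continuous_on_compose_smooth[OF open_chart_image[OF c frame_open[OF pf]] assms])
       (use dom ab ac_curve_chart[OF x c ab] in auto)
  then show ?thesis by (rule abs_continuous_on_cong) (use dom c in \<open>simp add: image_subset_iff\<close>)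
qed

lemma ac_frame_along: "abs_continuous_on a b (\<lambda>t. e j (x t) c)"
  by (rule ac_smooth_along[OF smooth_field_on_chart[OF frame_smooth[OF pf] c]])

lemma ac_frame_vec:
  assumes z: "abs_continuous_on a b z"
  shows "abs_continuous_on a b (\<lambda>t. frame_vec e (x t) (z t) c)"
  unfolding frame_vec_apply
  by (intro abs_continuous_on_sum abs_continuous_on_scaleR ac_frame_along
      bounded_linear.abs_continuous_on[OF bounded_linear_vec_nth] z)

lemma ac_frame_coords:
  assumes Z: "\<And>t. t \<in> {a..b} \<Longrightarrow> Z t \<in> tangent_space M (x t)" and ac: "abs_continuous_on a b (\<lambda>t. Z t c)"
  shows "abs_continuous_on a b (\<lambda>t. frame_coords e (x t) (Z t))"
proof (rule abs_continuous_on_vec)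
  fix i
  have "abs_continuous_on a b (\<lambda>t. gform c (x t) (axis k 1) (e i (x t) c))" for k
    by (rule ac_smooth_along[OF smooth_gform_frame[OF pf c]])
  then have "abs_continuous_on a b (\<lambda>t. \<Sum>k\<in>UNIV. Z t c $ k * gform c (x t) (axis k 1) (e i (x t) c))"
    by (intro abs_continuous_on_sum abs_continuous_on_mult bounded_linear.abs_continuous_on[OF bounded_linear_vec_nth] ac)
  then show "abs_continuous_on a b (\<lambda>t. frame_coords e (x t) (Z t) $ i)"
  proof (rule abs_continuous_on_cong)
    fix t assume t: "t \<in> {a..b}"
    then have "x t \<in> U" "c \<in> charts_at M (x t)" using dom c by (auto simp: charts_at_iff)
    then show "frame_coords e (x t) (Z t) $ i = (\<Sum>k\<in>UNIV. Z t c $ k * gform c (x t) (axis k 1) (e i (x t) c))"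
      by (rule frame_coords_components[OF pf _ _ Z[OF t]])
  qed
qed

end

end

section \<open>Parallel transport\<close>

context levi_civita_manifold
begin

text \<open>The notion \<open>parallel_along\<close> on an arbitrary interval, so that solutions on
  pieces can be concatenated.\<close>

definition parallel_on :: "(real \<Rightarrow> 'a) \<Rightarrow> real \<Rightarrow> real \<Rightarrow> (real \<Rightarrow> ('a, 'n) tvec) \<Rightarrow> bool" where
  "parallel_on x a b Z \<longleftrightarrow> (\<forall>t\<in>{a..b}. Z t \<in> tangent_space M (x t)) \<and>
     (\<forall>c\<in>charts M. \<forall>s u. a \<le> s \<and> s \<le> u \<and> u \<le> b \<and> x ` {s..u} \<subseteq> chart_dom c \<longrightarrow> abs_continuous_on s u (\<lambda>t. Z t c)) \<and>
     (AE t\<in>{a..b} in lebesgue. cov_deriv M nabla x Z t = 0)"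

lemma parallel_along_iff: "parallel_along M nabla \<tau> x Z \<longleftrightarrow> parallel_on x 0 \<tau> Z"
  unfolding parallel_along_def parallel_on_def ac_field_along_def field_along_def by blast

definition nondegenerate :: "'a \<Rightarrow> ('n \<Rightarrow> ('a, 'n) tvec) \<Rightarrow> bool" where
  "nondegenerate y v \<longleftrightarrow> (\<forall>c\<in>charts_at M y. det ((\<chi> i k. v k c $ i) :: real ^ 'n ^ 'n) \<noteq> 0)"

lemma frame_matrix:
  assumes pf: "positive_orthonormal_frame M U e" and y: "y \<in> U"
  shows "((\<chi> i k. frame_vec e y (column k C) c $ i) :: real ^ 'n ^ 'n) = (\<chi> i j. e j y c $ i) ** C"
  by (simp add: frame_vec_apply vec_eq_iff matrix_matrix_mult_def column_def mult.commute)

lemma nondegenerate_frame_vec: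
  assumes pf: "positive_orthonormal_frame M U e" and y: "y \<in> U"
  shows "nondegenerate y (\<lambda>k. frame_vec e y (column k C)) \<longleftrightarrow> det C \<noteq> 0"
proof -
  have "det ((\<chi> i k. frame_vec e y (column k C) c $ i) :: real ^ 'n ^ 'n) \<noteq> 0 \<longleftrightarrow> det C \<noteq> 0"
    if "c \<in> charts_at M y" for c
    using frame_det_pos[OF pf y that] unfolding frame_matrix[OF pf y] by (simp add: det_mul)
  then show ?thesis unfolding nondegenerate_def using ex_chart_at by blast
qed

text \<open>Agreement at \<open>s\<close> lets absolute continuity add up across the junction. The
  covariant derivative is local away from \<open>s\<close>, and the time \<open>s\<close> itself is
  a null set.\<close>

lemma parallel_on_combine:
  assumes Z: "parallel_on x r s Z" and W: "parallel_on x s u W" and rs: "r \<le> s" "s \<le> u" and eq: "W s = Z s"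
  shows "parallel_on x r u (\<lambda>t. if t \<le> s then Z t else W t)"
    (is "parallel_on x r u ?Y")
  unfolding parallel_on_def
proof (intro conjI ballI allI impI)
  show "?Y t \<in> tangent_space M (x t)" if "t \<in> {r..u}" for t
    using that Z W by (auto simp: parallel_on_def)
  fix c p q assume c: "c \<in> charts M" and pq: "r \<le> p \<and> p \<le> q \<and> q \<le> u \<and> x ` {p..q} \<subseteq> chart_dom c"
  have 1: "abs_continuous_on p' q' (\<lambda>t. ?Y t c)" if "p \<le> p'" "p' \<le> q'" "q' \<le> q" "q' \<le> s" for p' q'
  proof (rule abs_continuous_on_cong)
    have "x ` {p'..q'} \<subseteq> chart_dom c" using pq that by (meson atLeastatMost_subset_iff image_mono order.trans)
    then show "abs_continuous_on p' q' (\<lambda>t. Z t c)" using Z c pq that unfolding parallel_on_def by auto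
  qed (use that in auto)
  have 2: "abs_continuous_on p' q' (\<lambda>t. ?Y t c)" if "p \<le> p'" "p' \<le> q'" "q' \<le> q" "s \<le> p'" for p' q'
  proof (rule abs_continuous_on_cong)
    have "x ` {p'..q'} \<subseteq> chart_dom c" using pq that by (meson atLeastatMost_subset_iff image_mono order.trans)
    then show "abs_continuous_on p' q' (\<lambda>t. W t c)" using W c pq that unfolding parallel_on_def by auto
    show "?Y t c = W t c" if "t \<in> {p'..q'}" for t
      using that \<open>s \<le> p'\<close> eq by (cases "t = s") auto
  qed
  show "abs_continuous_on p q (\<lambda>t. ?Y t c)"
  proof (cases "q \<le> s \<or> s \<le> p")
    case True
    then show ?thesis using 1[of p q] 2[of p q] pq by auto
  next
    case False
    then show ?thesis
      using 1[of p s] 2[of s q] pq by (intro abs_continuous_on_combine[of p s q]) auto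
  qed
next
  have "AE t\<in>{r..s} in lebesgue. cov_deriv M nabla x Z t = 0" "AE t\<in>{s..u} in lebesgue. cov_deriv M nabla x W t = 0"
    using Z W by (auto simp: parallel_on_def)
  then show "AE t\<in>{r..u} in lebesgue. cov_deriv M nabla x ?Y t = 0"
    using AE_interior[of s s]
  proof (eventually_elim, intro impI)
    fix t assume t: "t \<in> {r..s} \<longrightarrow> cov_deriv M nabla x Z t = 0" "t \<in> {s..u} \<longrightarrow> cov_deriv M nabla x W t = 0"
      "t \<noteq> s \<and> t \<noteq> s" "t \<in> {r..u}"
    show "cov_deriv M nabla x ?Y t = 0"
    proof (cases "t < s")
      case True
      have "cov_deriv M nabla x ?Y t = cov_deriv M nabla x Z t"
        by (rule cov_deriv_cong_open[of "{..<s}"]) (use True in auto)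
      then show ?thesis using t True by auto
    next
      case False
      have "cov_deriv M nabla x ?Y t = cov_deriv M nabla x W t"
        by (rule cov_deriv_cong_open[of "{s<..}"]) (use False t in auto)
      then show ?thesis using t False by auto
    qed
  qed
qed

text \<open>In an orthonormal frame, parallel transport along the curve is the linear equation
  \<open>z' = - \<Omega> z\<close>, whose coefficients are only integrable.\<close>

lemma connection_matrix_along:
  assumes pf: "positive_orthonormal_frame M U e" and x: "ac_curve M \<tau> x"
    and ab: "0 \<le> a" "a \<le> b" "b \<le> \<tau>" and c: "c \<in> charts M" and dom: "x ` {a..b} \<subseteq> U \<inter> chart_dom c"
  obtains B where "B absolutely_integrable_on {a..b}"
    "AE t\<in>{a..b} in lebesgue. differentiable_curve_at x t \<and> connection_matrix e (x t) (velocity M x t) = - B t"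
proof -
  have "x ` {a..b} \<subseteq> chart_dom c" using dom by auto
  then obtain g where g: "g absolutely_integrable_on {a..b}"
    "AE t\<in>{a..b} in lebesgue. ((\<lambda>t. chart_map c (x t)) has_vector_derivative g t) (at t)"
    using abs_continuous_on_AE_derivative[OF ab(2) ac_curve_chart[OF x c ab]] by metis
  define om where "om k i j y = connection_matrix e y (coord_field M c k y) $ i $ j" for k i j y
  \<comment> \<open>Minus the connection matrix, with the velocity replaced by the density
    \<open>g\<close> of the curve in the chart. The density is integrable on \<open>{a..b}\<close>
    and is the velocity almost everywhere.\<close>
  define B where "B t = (\<chi> i j. \<Sum>k\<in>UNIV. (- om k i j (x t)) * g t $ k)" for t
  have omc: "continuous_on {a..b} (\<lambda>t. om k i j (x t))" for k i j
    unfolding om_def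
    by (intro abs_continuous_on_imp_continuous_on ac_smooth_along[OF pf x ab c dom] smooth_connection_matrix[OF pf c])
  have gk: "(\<lambda>t. g t $ k) absolutely_integrable_on {a..b}" for k
    using absolutely_integrable_linear[OF g(1) bounded_linear_vec_nth] by (simp add: o_def)
  have prod: "(\<lambda>t. (- om k i j (x t)) * g t $ k) absolutely_integrable_on {a..b}" for k i j
    by (intro absolutely_integrable_bounded_measurable_product_real gk
        continuous_imp_measurable_on_sets_lebesgue continuous_on_minus omc compact_imp_bounded compact_continuous_image) auto
  have entry: "(\<lambda>t. B t $ i $ j) absolutely_integrable_on {a..b}" for i j
    unfolding B_def by (simp only: vec_lambda_beta) (intro absolutely_integrable_sum prod finite)
  have "B absolutely_integrable_on {a..b}"
    by (rule absolutely_integrable_componentwise) (auto simp: Basis_vec_def inner_axis intro: entry)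
  moreover have "AE t\<in>{0..\<tau>} in lebesgue. differentiable_curve_at x t"
    using AE_differentiable_curve[OF x] ab by simp
  then have "AE t\<in>{a..b} in lebesgue. differentiable_curve_at x t \<and> connection_matrix e (x t) (velocity M x t) = - B t"
    using g(2)
  proof (eventually_elim, intro impI)
    fix t assume t: "t \<in> {0..\<tau>} \<longrightarrow> differentiable_curve_at x t"
      "t \<in> {a..b} \<longrightarrow> ((\<lambda>t. chart_map c (x t)) has_vector_derivative g t) (at t)" "t \<in> {a..b}"
    have d: "differentiable_curve_at x t" using t ab by auto
    have ct: "x t \<in> U" "c \<in> charts_at M (x t)" using dom t(3) c by (auto simp: charts_at_iff)
    have "velocity M x t c = g t"
      using vector_derivative_unique_at[OF differentiable_curve_velocity(1)[OF d ct(2)]] t by blast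
    then show "differentiable_curve_at x t \<and> connection_matrix e (x t) (velocity M x t) = - B t"
      using connection_matrix_components[OF pf ct(1) differentiable_curve_velocity(2)[OF d] ct(2)] d
      by (simp add: vec_eq_iff B_def om_def sum_negf mult.commute)
  qed
  ultimately show ?thesis using that by blast
qed

text \<open>One fundamental matrix \<open>\<Phi>\<close> with value \<open>mat 1\<close> at
  \<open>s\<close> serves all initial bases: the fields are the columns of its product with the
  coordinate matrix of the basis. Hence \<open>d\<close> depends neither on the basis nor on the
  interval, as bisection requires.\<close>

lemma parallel_basis_local:
  assumes x: "ac_curve M \<tau> x" and t0: "t0 \<in> {0..\<tau>}"
  shows "\<exists>d>0. \<forall>s u. 0 \<le> s \<and> s \<le> t0 \<and> t0 \<le> u \<and> u \<le> \<tau> \<and> u - s < d \<longrightarrow>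
    (\<forall>v. (\<forall>k. v k \<in> tangent_space M (x s)) \<and> nondegenerate (x s) v \<longrightarrow>
      (\<exists>Z. (\<forall>k. parallel_on x s u (Z k) \<and> Z k s = v k) \<and> (\<forall>t\<in>{s..u}. nondegenerate (x t) (\<lambda>k. Z k t))))"
proof -
  obtain U e where U: "x t0 \<in> U" and pf: "positive_orthonormal_frame M U e" using frame_exists by blast
  obtain c where "c \<in> charts_at M (x t0)" using ex_chart_at by blast
  then have c: "c \<in> charts M" "x t0 \<in> chart_dom c" by (auto simp: charts_at_iff)
  have xc: "continuous_on {0..\<tau>} x" using x by (simp add: ac_curve_def)
  have "open (U \<inter> chart_dom c)" using frame_open[OF pf] chart(1)[OF c(1)] by blast
  then obtain d1 where d1: "d1 > 0"
    "\<And>s u. 0 \<le> s \<and> s \<le> t0 \<and> t0 \<le> u \<and> u \<le> \<tau> \<and> u - s < d1 \<Longrightarrow> x ` {s..u} \<subseteq> U \<inter> chart_dom c"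
    using continuous_on_short_intervals[OF xc t0, of "U \<inter> chart_dom c"] U c(2) by auto
  \<comment> \<open>A window of length at most \<open>2 * d1 / 3\<close>, hence still inside frame
    and chart. Every interval around \<open>t0\<close> shorter than \<open>d1 / 3\<close> fits into
    it, so one integrable \<open>B\<close> serves them all.\<close>
  define a where "a = max 0 (t0 - d1 / 3)"
  define b where "b = min \<tau> (t0 + d1 / 3)"
  have ab: "0 \<le> a" "a \<le> t0" "t0 \<le> b" "b \<le> \<tau>" "b - a < d1" "a \<le> b"
    using t0 d1(1) by (auto simp: a_def b_def max_def min_def)
  have dom: "x ` {a..b} \<subseteq> U \<inter> chart_dom c" by (rule d1(2)) (use ab in auto)
  obtain B where B: "B absolutely_integrable_on {a..b}"
    "AE t\<in>{a..b} in lebesgue. differentiable_curve_at x t \<and> connection_matrix e (x t) (velocity M x t) = - B t"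
    by (rule connection_matrix_along[OF pf x ab(1) ab(6) ab(4) c(1) dom])
  obtain \<delta> where \<delta>: "\<delta> > 0" "\<And>A :: real ^ 'n ^ 'n. norm (A - mat 1) < \<delta> \<Longrightarrow> det A \<noteq> 0"
    using det_nonzero_near_id by blast
  obtain K where K: "K > 0" "\<And>(X :: real ^ 'n ^ 'n) (Y :: real ^ 'n ^ 'n). norm (X ** Y) \<le> norm X * norm Y * K"
    using bounded_bilinear.pos_bounded[OF bounded_bilinear_matrix_matrix_mult] by blast
  have Kb: "norm (X ** Y) \<le> K * norm X * norm Y" for X :: "real ^ 'n ^ 'n" and Y :: "real ^ 'n ^ 'n"
    using K(2)[of X Y] by (simp add: mult_ac)
  \<comment> \<open>The first bound makes the iteration contract. The second keeps the fundamental
    matrix within \<open>\<delta>\<close> of the identity, through the last conclusion of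
    \<open>linear_ode_solution\<close>; \<open>+ 1\<close> keeps the denominator positive.\<close>
  define \<theta> where "\<theta> = min (1 / 2) (\<delta> / (4 * (norm (mat 1 :: real ^ 'n ^ 'n) + 1)))"
  have \<theta>: "\<theta> > 0" "\<theta> \<le> 1 / 2" "2 * \<theta> * norm (mat 1 :: real ^ 'n ^ 'n) < \<delta>"
  proof -
    let ?m = "norm (mat 1 :: real ^ 'n ^ 'n)"
    have m: "?m + 1 > 0" by (smt (verit) norm_ge_zero)
    show "\<theta> > 0" using m \<delta>(1) by (simp add: \<theta>_def)
    show "\<theta> \<le> 1 / 2" unfolding \<theta>_def by (rule min.cobounded1)
    have "2 * \<theta> * ?m \<le> 2 * (\<delta> / (4 * (?m + 1))) * ?m"
      by (intro mult_right_mono mult_left_mono) (auto simp: \<theta>_def)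
    also have "\<dots> < \<delta>" using m \<delta>(1) by (simp add: field_simps add_strict_increasing)
    finally show "2 * \<theta> * ?m < \<delta>" .
  qed
  have "(\<lambda>s. norm (B s)) integrable_on {a..b}" using B(1) by (simp add: absolutely_integrable_on_def)
  then obtain d2 where d2: "d2 > 0" "\<And>s u. a \<le> s \<Longrightarrow> s \<le> u \<Longrightarrow> u \<le> b \<Longrightarrow> u - s < d2 \<Longrightarrow> integral {s..u} (\<lambda>s. norm (B s)) < \<theta> / K"
    using short_interval_integral_small[of "\<lambda>s. norm (B s)" a b "\<theta> / K"] \<theta>(1) K(1) by auto
  show ?thesis
  proof (intro exI[of _ "min d2 (d1 / 3)"] conjI allI impI)
    show "min d2 (d1 / 3) > 0" using d1 d2 by simp
    fix s u v assume su': "0 \<le> s \<and> s \<le> t0 \<and> t0 \<le> u \<and> u \<le> \<tau> \<and> u - s < min d2 (d1 / 3)"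
      and v: "(\<forall>k. v k \<in> tangent_space M (x s)) \<and> nondegenerate (x s) v"
    then have su: "s \<le> u" "a \<le> s" "u \<le> b" "u - s < d2" by (auto simp: a_def b_def)
    have domU: "x t \<in> U" if "t \<in> {s..u}" for t using dom that su by auto
    have Bsu: "B absolutely_integrable_on {s..u}" by (rule absolutely_integrable_subinterval(1)[OF B(1) su(2,3)])
    have small: "K * integral {s..u} (\<lambda>s. norm (B s)) \<le> \<theta>"
      using d2(2)[OF su(2,1,3,4)] K(1) by (simp add: field_simps)
    obtain \<Phi> :: "real \<Rightarrow> real ^ 'n ^ 'n" where "continuous_on {s..u} \<Phi>" and \<Phi>: "(\<lambda>s. B s ** \<Phi> s) absolutely_integrable_on {s..u}"
      "\<And>t. t \<in> {s..u} \<Longrightarrow> \<Phi> t = mat 1 + integral {s..t} (\<lambda>s. B s ** \<Phi> s)"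
      "\<And>t. t \<in> {s..u} \<Longrightarrow> norm (\<Phi> t - mat 1) \<le> 2 * \<theta> * norm (mat 1 :: real ^ 'n ^ 'n)"
      by (rule linear_ode_solution[OF bounded_bilinear_matrix_matrix_mult Bsu su(1) less_imp_le[OF K(1)] Kb small \<theta>(2),
            where ?z0.0="mat 1 :: real ^ 'n ^ 'n"]) blast
    have \<Phi>s: "\<Phi> s = mat 1" using \<Phi>(2)[of s] su(1) by simp
    have \<Phi>ac: "abs_continuous_on s u \<Phi>"
      by (rule abs_continuous_on_indefinite_integral[OF \<Phi>(1)]) (use \<Phi>(2) \<Phi>s in simp)
    have \<Phi>d: "AE t\<in>{s..u} in lebesgue. (\<Phi> has_vector_derivative B t ** \<Phi> t) (at t)"
      by (rule AE_has_vector_derivative_integral_form[OF \<Phi>(1) \<Phi>(2)])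
    have \<Phi>det: "det (\<Phi> t) \<noteq> 0" if "t \<in> {s..u}" for t
      using \<delta>(2) order.strict_trans1[OF \<Phi>(3)[OF that] \<theta>(3)] by blast
    define C where "C = ((\<chi> i k. frame_coords e (x s) (v k) $ i) :: real ^ 'n ^ 'n)"
    have xs: "x s \<in> U" using domU su by auto
    have vC: "frame_vec e (x s) (column k C) = v k" for k
    proof -
      have "column k C = frame_coords e (x s) (v k)" by (simp add: C_def column_def vec_eq_iff)
      then show ?thesis using frame_vec_frame_coords[OF pf xs] v by simp
    qed
    have Cdet: "det C \<noteq> 0"
      using nondegenerate_frame_vec[OF pf xs, of C] v by (simp add: vC)
    define z where "z k t = column k (\<Phi> t ** C)" for k t
    define Z where "Z k t = frame_vec e (x t) (z k t)" for k t
    have blz: "bounded_linear (\<lambda>X. column k (X ** C))" for k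
      by (rule bounded_linear_compose[OF bounded_linear_column
            bounded_bilinear.bounded_linear_left[OF bounded_bilinear_matrix_matrix_mult]])
    have zac: "abs_continuous_on s u (z k)" for k
      unfolding z_def by (rule bounded_linear.abs_continuous_on[OF blz \<Phi>ac])
    have "parallel_on x s u (Z k)" for k
      unfolding parallel_on_def
    proof (intro conjI ballI allI impI)
      show "Z k t \<in> tangent_space M (x t)" if "t \<in> {s..u}" for t
        unfolding Z_def by (rule frame_vec_tangent[OF pf domU[OF that]])
      fix c' p q assume c': "c' \<in> charts M" and pq: "s \<le> p \<and> p \<le> q \<and> q \<le> u \<and> x ` {p..q} \<subseteq> chart_dom c'"
      show "abs_continuous_on p q (\<lambda>t. Z k t c')"
        unfolding Z_def
      proof (rule ac_frame_vec[OF pf x _ _ _ c'])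
        show "x ` {p..q} \<subseteq> U \<inter> chart_dom c'" using pq domU by auto
        show "abs_continuous_on p q (z k)" by (rule abs_continuous_on_subinterval[OF zac]) (use pq in auto)
      qed (use pq su' in auto)
    next
      show "AE t\<in>{s..u} in lebesgue. cov_deriv M nabla x (Z k) t = 0"
        using \<Phi>d B(2) AE_interior[of s u]
      proof (eventually_elim, intro impI)
        fix t assume t: "t \<in> {s..u} \<longrightarrow> (\<Phi> has_vector_derivative B t ** \<Phi> t) (at t)"
          "t \<in> {a..b} \<longrightarrow> differentiable_curve_at x t \<and> connection_matrix e (x t) (velocity M x t) = - B t"
          "t \<noteq> s \<and> t \<noteq> u" "t \<in> {s..u}"
        have d: "differentiable_curve_at x t" and om: "connection_matrix e (x t) (velocity M x t) = - B t"
          using t su by auto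
        have "(z k has_vector_derivative column k ((B t ** \<Phi> t) ** C)) (at t)"
          unfolding z_def by (rule bounded_linear.has_vector_derivative[OF blz]) (use t in auto)
        then have "cov_deriv M nabla x (Z k) t
            = frame_vec e (x t) (column k ((B t ** \<Phi> t) ** C) + connection_matrix e (x t) (velocity M x t) *v z k t)"
          by (intro cov_deriv_frame[OF pf d domU[OF t(4)], of "{s<..<u}"]) (use t in \<open>auto simp: Z_def\<close>)
        \<comment> \<open>The matrix equation multiplied on the right by the constant
          \<open>C\<close> and read columnwise is \<open>z' = B z\<close>, and \<open>B\<close> is
          minus the connection matrix.\<close>
        also have "column k ((B t ** \<Phi> t) ** C) + connection_matrix e (x t) (velocity M x t) *v z k t = 0"
        proof -
          have "column k ((B t ** \<Phi> t) ** C) = B t *v z k t"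
            unfolding z_def by (simp add: column_matrix_mult flip: matrix_mul_assoc)
          moreover have "(- B t) *v z k t = - (B t *v z k t)"
            by (simp add: matrix_vector_mult_def vec_eq_iff sum_negf)
          ultimately show ?thesis by (simp add: om)
        qed
        finally show "cov_deriv M nabla x (Z k) t = 0" by (simp add: frame_vec_0)
      qed
    qed
    moreover have "Z k s = v k" for k by (simp add: Z_def z_def \<Phi>s vC)
    moreover have "nondegenerate (x t) (\<lambda>k. Z k t)" if "t \<in> {s..u}" for t
      unfolding Z_def z_def nondegenerate_frame_vec[OF pf domU[OF that]]
      using \<Phi>det[OF that] Cdet by (simp add: det_mul)
    ultimately show "\<exists>Z. (\<forall>k. parallel_on x s u (Z k) \<and> Z k s = v k) \<and> (\<forall>t\<in>{s..u}. nondegenerate (x t) (\<lambda>k. Z k t))"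
      by blast
  qed
qed

text \<open>The bisection runs over all initial bases at the left end, because the basis with which
  one piece ends has to be the initial basis of the next. Nondegeneracy at all times is carried
  along for the same reason.\<close>

lemma parallel_basis_exists:
  assumes x: "ac_curve M \<tau> x" and \<tau>: "0 \<le> \<tau>"
  obtains Z :: "'n \<Rightarrow> real \<Rightarrow> ('a, 'n) tvec" where "\<And>k. parallel_along M nabla \<tau> x (Z k)"
    "\<And>t. t \<in> {0..\<tau>} \<Longrightarrow> nondegenerate (x t) (\<lambda>k. Z k t)"
proof -
  let ?Q = "\<lambda>s u. 0 \<le> s \<longrightarrow> u \<le> \<tau> \<longrightarrow> (\<forall>v. (\<forall>k. v k \<in> tangent_space M (x s)) \<and> nondegenerate (x s) v \<longrightarrow>
      (\<exists>Z :: 'n \<Rightarrow> real \<Rightarrow> ('a, 'n) tvec. (\<forall>k. parallel_on x s u (Z k) \<and> Z k s = v k) \<and> (\<forall>t\<in>{s..u}. nondegenerate (x t) (\<lambda>k. Z k t))))"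
  have Q: "?Q 0 \<tau>"
  proof (rule Bolzano[where P="?Q", OF \<tau>])
    fix r s u assume rs: "?Q r s" and su: "?Q s u" and le: "r \<le> s" "s \<le> u"
    show "?Q r u"
    proof (intro impI allI)
      fix v assume r: "0 \<le> r" "u \<le> \<tau>" and v: "(\<forall>k. v k \<in> tangent_space M (x r)) \<and> nondegenerate (x r) v"
      have "s \<le> \<tau>" "0 \<le> s" using r le by auto
      obtain Z where Z0: "(\<forall>k. parallel_on x r s (Z k) \<and> Z k r = v k) \<and> (\<forall>t\<in>{r..s}. nondegenerate (x t) (\<lambda>k. Z k t))"
        using rs[rule_format, OF r(1) \<open>s \<le> \<tau>\<close> v] by blast
      then have Z: "parallel_on x r s (Z k)" "Z k r = v k" "t \<in> {r..s} \<Longrightarrow> nondegenerate (x t) (\<lambda>k. Z k t)" for k t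
        by blast+
      have Zs: "(\<forall>k. Z k s \<in> tangent_space M (x s)) \<and> nondegenerate (x s) (\<lambda>k. Z k s)"
        using Z(1,3) le by (auto simp: parallel_on_def)
      obtain W where W0: "(\<forall>k. parallel_on x s u (W k) \<and> W k s = Z k s) \<and> (\<forall>t\<in>{s..u}. nondegenerate (x t) (\<lambda>k. W k t))"
        using su[rule_format, OF \<open>0 \<le> s\<close> r(2) Zs] by blast
      then have W: "parallel_on x s u (W k)" "W k s = Z k s" "t \<in> {s..u} \<Longrightarrow> nondegenerate (x t) (\<lambda>k. W k t)" for k t
        by blast+
      show "\<exists>Z. (\<forall>k. parallel_on x r u (Z k) \<and> Z k r = v k) \<and> (\<forall>t\<in>{r..u}. nondegenerate (x t) (\<lambda>k. Z k t))"
      proof (intro exI[of _ "\<lambda>k t. if t \<le> s then Z k t else W k t"] conjI allI ballI)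
        show "parallel_on x r u (\<lambda>t. if t \<le> s then Z k t else W k t)" for k
          by (rule parallel_on_combine[OF Z(1) W(1) le W(2)])
        show "(if r \<le> s then Z k r else W k r) = v k" for k using le Z(2) by simp
        show "nondegenerate (x t) (\<lambda>k. if t \<le> s then Z k t else W k t)" if "t \<in> {r..u}" for t
          using that Z(3)[of t] W(3)[of t] by (cases "t \<le> s") auto
      qed
    qed
  next
    fix t0 assume "0 \<le> t0" "t0 \<le> \<tau>"
    then obtain d where "d > 0" "\<forall>s u. 0 \<le> s \<and> s \<le> t0 \<and> t0 \<le> u \<and> u \<le> \<tau> \<and> u - s < d \<longrightarrow>
      (\<forall>v. (\<forall>k. v k \<in> tangent_space M (x s)) \<and> nondegenerate (x s) v \<longrightarrow>
        (\<exists>Z. (\<forall>k. parallel_on x s u (Z k) \<and> Z k s = v k) \<and> (\<forall>t\<in>{s..u}. nondegenerate (x t) (\<lambda>k. Z k t))))"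
      using parallel_basis_local[OF x, of t0] by auto
    then show "\<exists>d>0. \<forall>s u. s \<le> t0 \<and> t0 \<le> u \<and> u - s < d \<longrightarrow> ?Q s u"
      by (intro exI[of _ d]) blast
  qed
  obtain U e where U: "x 0 \<in> U" and pf: "positive_orthonormal_frame M U e" using frame_exists by blast
  have init: "(\<forall>k. e k (x 0) \<in> tangent_space M (x 0)) \<and> nondegenerate (x 0) (\<lambda>k. e k (x 0))"
    using frame_tangent[OF pf U] frame_det_pos[OF pf U] unfolding nondegenerate_def by force
  obtain Z :: "'n \<Rightarrow> real \<Rightarrow> ('a, 'n) tvec" where
    "(\<forall>k. parallel_on x 0 \<tau> (Z k) \<and> Z k 0 = e k (x 0)) \<and> (\<forall>t\<in>{0..\<tau>}. nondegenerate (x t) (\<lambda>k. Z k t))"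
    using Q[rule_format, OF order_refl order_refl init] by blast
  then show ?thesis using that[of Z] unfolding parallel_along_iff by blast
qed

end

section \<open>Rolling\<close>

lemma differentiable_vec_iff:
  fixes f :: "real \<Rightarrow> real ^ 'n"
  shows "f differentiable (at t) \<longleftrightarrow> (\<forall>i. (\<lambda>s. f s $ i) differentiable (at t))"
  using differentiable_componentwise_within[of f t UNIV] by (auto simp: Basis_vec_def inner_axis)

lemma differentiable_matrix_iff:
  fixes f :: "real \<Rightarrow> real ^ 'm ^ 'n"
  shows "f differentiable (at t) \<longleftrightarrow> (\<forall>i j. (\<lambda>s. f s $ i $ j) differentiable (at t))"
  using differentiable_componentwise_within[of f t UNIV] by (auto simp: Basis_vec_def inner_axis)

lemma bounded_bilinear_matrix_vector_mult:
  "bounded_bilinear ((*v) :: real ^ 'm ^ 'n \<Rightarrow> real ^ 'm \<Rightarrow> real ^ 'n)"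
  unfolding bilinear_conv_bounded_bilinear[symmetric] bilinear_def
  by (intro conjI allI linearI)
     (simp_all add: matrix_vector_mult_def vec_eq_iff sum.distrib[symmetric] algebra_simps sum_distrib_left)

lemma bounded_linear_transpose: "bounded_linear (transpose :: real ^ 'm ^ 'n \<Rightarrow> real ^ 'n ^ 'm)"
  unfolding linear_conv_bounded_linear[symmetric] by (intro linearI) (simp_all add: transpose_def vec_eq_iff)

lemma transpose_mult_component: "(transpose A *v w) $ i = w \<bullet> column i (A :: real ^ 'n ^ 'm)"
  by (simp add: matrix_vector_mult_def transpose_def inner_vec_def column_def mult.commute)

lemma skew_inner:
  fixes P :: "real ^ 'n ^ 'n"
  assumes P: "\<And>i j. P $ i $ j = - P $ j $ i"
  shows "(P *v u) \<bullet> v = - ((P *v v) \<bullet> u)"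
proof -
  have *: "(P *v u) \<bullet> v = (\<Sum>i\<in>UNIV. \<Sum>j\<in>UNIV. P $ i $ j * (u $ j * v $ i))" for u v
    by (simp add: matrix_vector_mult_def inner_vec_def sum_distrib_right mult.assoc)
  have "(\<Sum>i\<in>UNIV. \<Sum>j\<in>UNIV. P $ i $ j * (u $ j * v $ i)) = (\<Sum>j\<in>UNIV. \<Sum>i\<in>UNIV. P $ i $ j * (u $ j * v $ i))"
    by (rule sum.swap)
  also have "\<dots> = (\<Sum>j\<in>UNIV. \<Sum>i\<in>UNIV. - (P $ j $ i * (v $ i * u $ j)))"
    by (intro sum.cong refl) (subst P, simp)
  finally show ?thesis by (simp add: * sum_negf)
qed

lemma matrix_eq_if_columns:
  fixes D :: "real ^ 'n ^ 'm" and W :: "real ^ 'n ^ 'n"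
  assumes W: "det W \<noteq> 0" and D: "\<And>k. D *v column k W = 0"
  shows "D = 0"
proof -
  obtain W' where W': "W ** W' = mat 1"
    using W invertible_det_nz[of W] invertible_right_inverse[of W] by blast
  have "column k (D ** W) = 0" for k by (simp add: column_matrix_mult D)
  then have "D ** W = 0" by (simp add: column_def vec_eq_iff)
  then have "(D ** W) ** W' = 0" by (simp add: matrix_matrix_mult_def vec_eq_iff)
  then show ?thesis by (simp add: W' flip: matrix_mul_assoc)
qed

lemma Wfield_component:
  "Wfield i j A $ r $ s = (if j = s then A $ r $ i else 0) - (if i = s then A $ r $ j else 0)"
proof -
  have "Wfield i j A $ r $ s = (\<Sum>r'\<in>UNIV. if r' = r then (if j = s then A $ r $ i else 0) - (if i = s then A $ r $ j else 0) else 0)"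
    unfolding Wfield_def sum_component by (intro sum.cong refl) (auto simp: mat_unit_def axis_def)
  then show ?thesis by simp
qed

text \<open>\<open>Wfield i j A\<close> is \<open>A\<close> times the elementary skew matrix with
  entry \<open>1\<close> at \<open>(i, j)\<close> and \<open>-1\<close> at \<open>(j, i)\<close>.
  Over \<open>i < j\<close> these matrices form a basis of the skew matrices, and the coordinates of
  \<open>K\<close> are its entries above the diagonal.\<close>

lemma sum_Wfield:
  fixes K A :: "real ^ 'n::{finite, linorder} ^ 'n::{finite, linorder}"
  assumes K: "\<And>i j. K $ i $ j = - K $ j $ i"
  shows "(\<Sum>(i, j) | i < j. (K $ i $ j) *\<^sub>R Wfield i j A) = A ** K"
proof -
  have "(\<Sum>(i, j) | i < j. (K $ i $ j) *\<^sub>R Wfield i j A) $ r $ s = (A ** K) $ r $ s" for r s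
  proof -
    have "(\<Sum>(i, j) | i < j. (K $ i $ j) *\<^sub>R Wfield i j A) $ r $ s
        = (\<Sum>p | fst p < snd p. K $ fst p $ snd p * Wfield (fst p) (snd p) A $ r $ s)"
      by (simp add: case_prod_beta case_prod_beta' sum_component)
    also have "\<dots> = (\<Sum>p\<in>UNIV. if fst p < snd p then K $ fst p $ snd p * Wfield (fst p) (snd p) A $ r $ s else 0)"
      by (rule sum.mono_neutral_cong_left) auto
    also have "\<dots> = (\<Sum>i\<in>UNIV. \<Sum>j\<in>UNIV. if i < j then K $ i $ j * Wfield i j A $ r $ s else 0)"
      unfolding UNIV_Times_UNIV[symmetric] by (simp add: sum.cartesian_product case_prod_beta)
    also have "\<dots> = (\<Sum>i\<in>UNIV. \<Sum>j\<in>UNIV. if j = s then (if i < j then K $ i $ j * A $ r $ i else 0) else 0)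
        - (\<Sum>i\<in>UNIV. \<Sum>j\<in>UNIV. if i = s then (if i < j then K $ i $ j * A $ r $ j else 0) else 0)"
      unfolding sum_subtractf[symmetric] by (intro sum.cong refl) (auto simp: Wfield_component algebra_simps)
    also have "(\<Sum>i\<in>UNIV. \<Sum>j\<in>UNIV. if j = s then (if i < j then K $ i $ j * A $ r $ i else 0) else 0)
        = (\<Sum>i\<in>UNIV. if i < s then K $ i $ s * A $ r $ i else 0)" by simp
    also have "(\<Sum>i\<in>UNIV. \<Sum>j\<in>UNIV. if i = s then (if i < j then K $ i $ j * A $ r $ j else 0) else 0)
        = (\<Sum>j\<in>UNIV. \<Sum>i\<in>UNIV. if i = s then (if i < j then K $ i $ j * A $ r $ j else 0) else 0)"
      by (rule sum.swap)
    also have "\<dots> = (\<Sum>j\<in>UNIV. if s < j then K $ s $ j * A $ r $ j else 0)" by simp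
    also have "(\<Sum>i\<in>UNIV. if i < s then K $ i $ s * A $ r $ i else 0) - (\<Sum>j\<in>UNIV. if s < j then K $ s $ j * A $ r $ j else 0)
        = (\<Sum>i\<in>UNIV. A $ r $ i * K $ i $ s)"
      unfolding sum_subtractf[symmetric]
    proof (intro sum.cong refl)
      \<comment> \<open>Entries below the diagonal come from the negative terms through skewness,
        and the diagonal entries of a skew matrix vanish.\<close>
      fix i show "(if i < s then K $ i $ s * A $ r $ i else 0) - (if s < i then K $ s $ i * A $ r $ i else 0) = A $ r $ i * K $ i $ s"
        using K[of i s] K[of i i] by (cases i s rule: linorder_cases) auto
    qed
    finally show ?thesis by (simp add: matrix_matrix_mult_def)
  qed
  then show ?thesis by (simp add: vec_eq_iff)
qed

section \<open>Differentiability of inner products and frame coordinates along curves\<close>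

context riemannian_manifold
begin

lemma differentiable_rmetric_along:
  assumes d: "differentiable_curve_at x t" and U: "open U" "x t \<in> U"
    and YZ: "smooth_field_on M U Y" "smooth_field_on M U Z"
  shows "(\<lambda>s. rmetric M (x s) (Y (x s)) (Z (x s))) differentiable (at t)"
proof -
  obtain c where c: "c \<in> charts_at M (x t)" using ex_chart_at by blast
  then have cM: "c \<in> charts M" "x t \<in> chart_dom c" by (auto simp: charts_at_iff)
  let ?F = "\<lambda>y. rmetric M y (Y y) (Z y)"
  have "(?F \<circ> chart_inv c has_derivative frechet_derivative (?F \<circ> chart_inv c) (at (chart_map c (x t)))) (at (chart_map c (x t)))"
    unfolding o_def
    by (rule smooth_on_imp_has_derivative[OF smooth_rmetric_fields[OF cM(1) U(1) YZ]]) (use cM U in auto)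
  from differentiable_curve_compose[OF d c this] show ?thesis
    by (rule differentiableI_vector)
qed

lemma AE_field_differentiable:
  assumes x: "ac_curve M \<tau> x" and Z: "ac_field_along M \<tau> x Z" and \<tau>: "0 \<le> \<tau>"
  shows "AE t\<in>{0..\<tau>} in lebesgue. \<exists>c\<in>charts_at M (x t). (\<lambda>s. Z s c) differentiable (at t)"
proof (rule AE_local[OF \<tau>])
  fix t0 assume t0: "t0 \<in> {0..\<tau>}"
  obtain c where "c \<in> charts_at M (x t0)" using ex_chart_at by blast
  then have c: "c \<in> charts M" "x t0 \<in> chart_dom c" by (auto simp: charts_at_iff)
  have xc: "continuous_on {0..\<tau>} x" using x by (simp add: ac_curve_def)
  obtain d where d: "d > 0" "\<And>s u. 0 \<le> s \<and> s \<le> t0 \<and> t0 \<le> u \<and> u \<le> \<tau> \<and> u - s < d \<Longrightarrow> x ` {s..u} \<subseteq> chart_dom c"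
    using continuous_on_short_intervals[OF xc t0 chart(1)[OF c(1)] c(2)] by blast
  show "\<exists>d>0. \<forall>s u. 0 \<le> s \<and> s \<le> t0 \<and> t0 \<le> u \<and> u \<le> \<tau> \<and> u - s < d \<longrightarrow>
      (AE t\<in>{s..u} in lebesgue. \<exists>c\<in>charts_at M (x t). (\<lambda>s. Z s c) differentiable (at t))"
  proof (intro exI[of _ d] conjI allI impI)
    fix s u assume su: "0 \<le> s \<and> s \<le> t0 \<and> t0 \<le> u \<and> u \<le> \<tau> \<and> u - s < d"
    note dom = d(2)[OF su]
    have "abs_continuous_on s u (\<lambda>t. Z t c)"
      using Z c(1) dom su unfolding ac_field_along_def by auto
    then obtain g where "AE t\<in>{s..u} in lebesgue. ((\<lambda>t. Z t c) has_vector_derivative g t) (at t)"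
      using su by (elim abs_continuous_on_AE_derivative[rotated]) auto
    then show "AE t\<in>{s..u} in lebesgue. \<exists>c\<in>charts_at M (x t). (\<lambda>s. Z s c) differentiable (at t)"
    proof (eventually_elim, intro impI)
      fix t assume t: "t \<in> {s..u} \<longrightarrow> ((\<lambda>t. Z t c) has_vector_derivative g t) (at t)" "t \<in> {s..u}"
      have "c \<in> charts_at M (x t)" using dom t(2) c(1) by (auto simp: charts_at_iff)
      moreover have "(\<lambda>s. Z s c) differentiable (at t)" using t differentiableI_vector by blast
      ultimately show "\<exists>c\<in>charts_at M (x t). (\<lambda>s. Z s c) differentiable (at t)" by blast
    qed
  qed (rule d)
qed

text \<open>The coordinates are products of components of \<open>Z\<close> in one chart with smooth
  functions of the point. This formula is used on times near \<open>t\<close> inside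
  \<open>{0<..<\<tau>}\<close>, because tangency of \<open>Z\<close> is known on
  \<open>{0..\<tau>}\<close> only.\<close>

lemma differentiable_frame_coords:
  assumes d: "differentiable_curve_at x t" and t: "0 < t" "t < \<tau>" and Z: "field_along M \<tau> x Z"
    and c: "c \<in> charts_at M (x t)" "(\<lambda>s. Z s c) differentiable (at t)"
    and pf: "positive_orthonormal_frame M U e" and U: "x t \<in> U"
  shows "(\<lambda>s. frame_coords e (x s) (Z s)) differentiable (at t)"
  unfolding differentiable_vec_iff
proof
  fix i
  have x: "isCont x t" using d by (simp add: differentiable_curve_at_def)
  have cM: "c \<in> charts M" "x t \<in> chart_dom c" using c(1) by (auto simp: charts_at_iff)
  let ?F = "\<lambda>k y. gform c y (axis k 1) (e i y c)"
  have "(?F k \<circ> chart_inv c has_derivative frechet_derivative (?F k \<circ> chart_inv c) (at (chart_map c (x t)))) (at (chart_map c (x t)))" for k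
    unfolding o_def
    by (rule smooth_on_imp_has_derivative[OF smooth_gform_frame[OF pf cM(1)]]) (use cM U in auto)
  then have Fd: "(\<lambda>s. ?F k (x s)) differentiable (at t)" for k
    using differentiable_curve_compose[OF d c(1)] differentiableI_vector by blast
  have Zd: "(\<lambda>s. Z s c $ k) differentiable (at t)" for k
    using c(2) by (simp add: differentiable_vec_iff)
  have "open (U \<inter> chart_dom c)" using frame_open[OF pf] chart(1)[OF cM(1)] by blast
  then obtain A where A: "open A" "t \<in> A" "\<And>s. s \<in> A \<Longrightarrow> x s \<in> U \<inter> chart_dom c"
    using isCont_open_neighbourhood[OF x, of "U \<inter> chart_dom c"] U cM(2) by blast
  have "(\<lambda>s. \<Sum>k\<in>UNIV. Z s c $ k * ?F k (x s)) differentiable (at t)"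
    by (intro differentiable_sum differentiable_mult ballI finite Zd Fd)
  moreover have "frame_coords e (x s) (Z s) $ i = (\<Sum>k\<in>UNIV. Z s c $ k * ?F k (x s))" if "s \<in> A \<inter> {0<..<\<tau>}" for s
    by (rule frame_coords_components[OF pf]) (use that A(3)[of s] cM Z in \<open>auto simp: charts_at_iff field_along_def\<close>)
  ultimately show "(\<lambda>s. frame_coords e (x s) (Z s) $ i) differentiable (at t)"
    using frechet_derivative_cong_open(2)[of "A \<inter> {0<..<\<tau>}" t "\<lambda>s. frame_coords e (x s) (Z s) $ i" "\<lambda>s. \<Sum>k\<in>UNIV. Z s c $ k * ?F k (x s)"]
      A(1,2) t by (auto simp: open_Int)
qed

end

section \<open>The configuration space in a trivialization\<close>

locale rolling_pair = M: levi_civita_manifold M nablaM + N: levi_civita_manifold N nablaN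
  for M :: "('a::topological_space, 'n::{finite, linorder}) manifold" and nablaM
    and N :: "('b::topological_space, 'n) manifold" and nablaN
begin

lemma triv_frames:
  assumes "T \<in> trivs_at M N q"
  shows "positive_orthonormal_frame M (dom1 T) (frame1 T)" "positive_orthonormal_frame N (dom2 T) (frame2 T)"
    "base1 q \<in> dom1 T" "base2 q \<in> dom2 T"
  using assms by (auto simp: trivs_at_def trivializations_def)

context
  fixes q :: "('a, 'b, 'n) config"
  assumes q: "q \<in> config_space M N"
begin

lemma config_linear:
  "v \<in> tangent_space M (base1 q) \<Longrightarrow> w \<in> tangent_space M (base1 q) \<Longrightarrow>
    qmap q (a *\<^sub>T v + b *\<^sub>T w) = a *\<^sub>T qmap q v + b *\<^sub>T qmap q w"
  using q by (cases q) (simp add: config_space_def)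

lemma config_tangent: "v \<in> tangent_space M (base1 q) \<Longrightarrow> qmap q v \<in> tangent_space N (base2 q)"
  using q by (cases q) (auto simp: config_space_def)

lemma config_isometry:
  "v \<in> tangent_space M (base1 q) \<Longrightarrow> w \<in> tangent_space M (base1 q) \<Longrightarrow>
    rmetric N (base2 q) (qmap q v) (qmap q w) = rmetric M (base1 q) v w"
  using q by (cases q) (simp add: config_space_def)

lemma config_sum:
  assumes v: "\<And>i. i \<in> I \<Longrightarrow> v i \<in> tangent_space M (base1 q)"
  shows "qmap q (\<Sum>i\<in>I. a i *\<^sub>T v i) = (\<Sum>i\<in>I. a i *\<^sub>T qmap q (v i))"
proof -
  have 0: "qmap q 0 = 0"
    using config_linear[OF M.tangent_space_0 M.tangent_space_0, of 0 0] by (simp add: tscale_simps)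
  show ?thesis
    using v
  proof (induction I rule: infinite_finite_induct)
    case (insert i I)
    have "(\<Sum>i\<in>I. a i *\<^sub>T v i) \<in> tangent_space M (base1 q)"
      using insert.prems by (intro M.tangent_space_sum M.tangent_space_tscale) auto
    then have "qmap q (a i *\<^sub>T v i + 1 *\<^sub>T (\<Sum>i\<in>I. a i *\<^sub>T v i)) = a i *\<^sub>T qmap q (v i) + 1 *\<^sub>T qmap q (\<Sum>i\<in>I. a i *\<^sub>T v i)"
      using insert.prems by (intro config_linear) auto
    then show ?case using insert by (simp add: tscale_simps)
  qed (simp_all add: 0)
qed

context
  fixes T
  assumes T: "T \<in> trivs_at M N q"
begin

lemmas frames = triv_frames[OF T]

lemma config_frame:
  "qmap q (frame1 T j (base1 q)) = N.frame_vec (frame2 T) (base2 q) (column j (triv_matrix N T q))"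
proof -
  have "N.frame_coords (frame2 T) (base2 q) (qmap q (frame1 T j (base1 q))) = column j (triv_matrix N T q)"
    by (simp add: N.frame_coords_def triv_matrix_def column_def vec_eq_iff)
  then show ?thesis
    using N.frame_vec_frame_coords[OF frames(2,4) config_tangent[OF M.frame_tangent[OF frames(1,3)]]] by metis
qed

lemma config_frame_vec:
  "qmap q (M.frame_vec (frame1 T) (base1 q) w) = N.frame_vec (frame2 T) (base2 q) (triv_matrix N T q *v w)"
proof -
  have "qmap q (M.frame_vec (frame1 T) (base1 q) w) = (\<Sum>j\<in>UNIV. (w $ j) *\<^sub>T qmap q (frame1 T j (base1 q)))"
    unfolding M.frame_vec_def by (rule config_sum) (rule M.frame_tangent[OF frames(1,3)])
  then show ?thesis unfolding config_frame by (simp add: N.sum_frame_vec_column)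
qed

text \<open>The columns are the coordinates of the images of an orthonormal frame under an
  isometry.\<close>

lemma triv_matrix_orthogonal:
  "transpose (triv_matrix N T q) ** triv_matrix N T q = mat 1"
  "triv_matrix N T q ** transpose (triv_matrix N T q) = mat 1"
proof -
  have "column i (triv_matrix N T q) \<bullet> column j (triv_matrix N T q) = (if i = j then 1 else 0)" for i j
    using N.rmetric_frame_vec[OF frames(2,4)] M.frame_orthonormal[OF frames(1,3), of i j]
      config_isometry[OF M.frame_tangent[OF frames(1,3)] M.frame_tangent[OF frames(1,3)], of i j]
    by (simp add: config_frame)
  then show *: "transpose (triv_matrix N T q) ** triv_matrix N T q = mat 1"
    by (simp add: vec_eq_iff matrix_matrix_mult_def transpose_def column_def inner_vec_def mat_def)
  then show "triv_matrix N T q ** transpose (triv_matrix N T q) = mat 1"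
    using matrix_left_right_inverse by blast
qed

lemma triv_matrix_inj: "triv_matrix N T q *v w = 0 \<longleftrightarrow> w = 0"
proof
  assume "triv_matrix N T q *v w = 0"
  then have "transpose (triv_matrix N T q) *v (triv_matrix N T q *v w) = 0" by simp
  then show "w = 0" by (simp add: matrix_vector_mul_assoc triv_matrix_orthogonal)
qed simp

text \<open>The coefficients of the \<open>Wfield\<close> terms are the entries of the skew matrix
  \<open>\<Omega> - transpose A ** \<Psi> ** A\<close>. Multiplication by \<open>A\<close> on the
  left, as in \<open>sum_Wfield\<close>, cancels the transpose by orthogonality.\<close>

lemma vertical_part_eq:
  assumes X: "X \<in> tangent_space M (base1 q)"
  shows "vertical_part M N nablaM nablaN T q X
    = triv_matrix N T q ** M.connection_matrix (frame1 T) (base1 q) X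
      - N.connection_matrix (frame2 T) (base2 q) (qmap q X) ** triv_matrix N T q"
proof -
  let ?A = "triv_matrix N T q" and ?\<Omega> = "M.connection_matrix (frame1 T) (base1 q) X"
    and ?\<Psi> = "N.connection_matrix (frame2 T) (base2 q) (qmap q X)"
  define K where "K = ?\<Omega> - transpose ?A ** ?\<Psi> ** ?A"
  have qX: "qmap q X \<in> tangent_space N (base2 q)" by (rule config_tangent[OF X])
  note op2 = N.frame_open[OF frames(2)]
  \<comment> \<open>The transported field has constant coefficients, so the Leibniz rule leaves no
    derivatives of coefficients, only a combination of columns of \<open>?\<Psi>\<close>.\<close>
  have nt: "nablaN (base2 q) (qmap q X) (transported_frame N T q j) = N.frame_vec (frame2 T) (base2 q) (?\<Psi> *v column j ?A)" for j
  proof -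
    have "nablaN (base2 q) (qmap q X) (transported_frame N T q j)
        = (\<Sum>s\<in>UNIV. dir_deriv N (base2 q) (qmap q X) (\<lambda>_. ?A $ s $ j) *\<^sub>T frame2 T s (base2 q)
            + (?A $ s $ j) *\<^sub>T nablaN (base2 q) (qmap q X) (frame2 T s))"
      unfolding transported_frame_def
      by (rule N.nabla_sum[OF op2 frames(4) qX]) (auto intro: N.smooth_function_on_const op2 N.frame_smooth[OF frames(2)])
    also have "\<dots> = (\<Sum>s\<in>UNIV. (column j ?A $ s) *\<^sub>T N.frame_vec (frame2 T) (base2 q) (column s ?\<Psi>))"
      by (simp add: N.dir_deriv_const_on[OF op2 frames(4) _ qX] tscale_simps N.nabla_frame[OF frames(2,4) qX] column_def)
    finally show ?thesis by (simp add: N.sum_frame_vec_column)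
  qed
  have tf: "transported_frame N T q i (base2 q) = N.frame_vec (frame2 T) (base2 q) (column i ?A)" for i
    by (simp add: transported_frame_def N.frame_vec_def column_def)
  have entry: "(transpose ?A ** ?\<Psi> ** ?A) $ i $ j = (?\<Psi> *v column j ?A) \<bullet> column i ?A" for i j
  proof -
    have "(transpose ?A ** ?\<Psi> ** ?A) $ i $ j = column j (transpose ?A ** (?\<Psi> ** ?A)) $ i"
      by (simp add: column_def matrix_mul_assoc)
    also have "\<dots> = (transpose ?A *v (?\<Psi> *v column j ?A)) $ i" by (simp add: column_matrix_mult)
    finally show ?thesis unfolding transpose_mult_component .
  qed
  have "vertical_part M N nablaM nablaN T q X = (\<Sum>(i, j) | i < j. (K $ i $ j) *\<^sub>R Wfield i j ?A)"
    unfolding vertical_part_def Let_def nt tf N.rmetric_frame_vec[OF frames(2,4)]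
    by (simp add: K_def entry M.connection_matrix_def)
  also have "\<dots> = ?A ** K"
  proof (rule sum_Wfield)
    fix i j
    have "(?\<Psi> *v column j ?A) \<bullet> column i ?A = - ((?\<Psi> *v column i ?A) \<bullet> column j ?A)"
      by (rule skew_inner) (rule N.connection_matrix_skew[OF frames(2,4) qX])
    then show "K $ i $ j = - K $ j $ i"
      using M.connection_matrix_skew[OF frames(1,3) X, of i j] by (simp add: K_def entry)
  qed
  also have "\<dots> = ?A ** ?\<Omega> - (?A ** transpose ?A) ** ?\<Psi> ** ?A"
    unfolding K_def by (simp add: bounded_bilinear.diff_right[OF bounded_bilinear_matrix_matrix_mult] matrix_mul_assoc)
  finally show ?thesis by (simp add: triv_matrix_orthogonal)
qed

end

end

text \<open>One trivialization around \<open>q t\<close> is asked for, since a null set cannot be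
  collected over all of them; \<open>triv_matrix_differentiable\<close> reaches the others at the
  same time \<open>t\<close>.\<close>

definition good_at :: "(real \<Rightarrow> ('a, 'b, 'n) config) \<Rightarrow> real \<Rightarrow> bool" where
  "good_at q t \<longleftrightarrow> M.differentiable_curve_at (\<lambda>s. base1 (q s)) t \<and> N.differentiable_curve_at (\<lambda>s. base2 (q s)) t \<and>
     (\<exists>T\<in>trivs_at M N (q t). (\<lambda>s. triv_matrix N T (q s)) differentiable (at t))"

section \<open>Absolutely continuous configuration curves\<close>

context
  fixes q :: "real \<Rightarrow> ('a, 'b, 'n) config" and \<tau> :: real
  assumes ac: "ac_config_curve M N \<tau> q" and \<tau>: "\<tau> > 0"
begin

lemma curve_config: "t \<in> {0..\<tau>} \<Longrightarrow> q t \<in> config_space M N"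
  using ac by (auto simp: ac_config_curve_def)

lemma curve1: "ac_curve M \<tau> (\<lambda>t. base1 (q t))" and curve2: "ac_curve N \<tau> (\<lambda>t. base2 (q t))"
  using ac by (auto simp: ac_config_curve_def)

text \<open>Both frames and both charts have to work on a common time interval, since the two curves
  are compared at the same times.\<close>

lemma local_triv:
  assumes t0: "t0 \<in> {0..\<tau>}" and c: "c \<in> charts_at M (base1 (q t0))" "c' \<in> charts_at N (base2 (q t0))"
  obtains T d where "T \<in> trivializations M N" "d > 0"
    "\<And>s u. 0 \<le> s \<Longrightarrow> s \<le> t0 \<Longrightarrow> t0 \<le> u \<Longrightarrow> u \<le> \<tau> \<Longrightarrow> u - s < d \<Longrightarrow>
      (\<lambda>t. base1 (q t)) ` {s..u} \<subseteq> dom1 T \<inter> chart_dom c \<and> (\<lambda>t. base2 (q t)) ` {s..u} \<subseteq> dom2 T \<inter> chart_dom c'"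
proof -
  obtain U e where U: "base1 (q t0) \<in> U" and e: "positive_orthonormal_frame M U e" using M.frame_exists by blast
  obtain V f where V: "base2 (q t0) \<in> V" and f: "positive_orthonormal_frame N V f" using N.frame_exists by blast
  define T where "T = \<lparr>dom1 = U, frame1 = e, dom2 = V, frame2 = f\<rparr>"
  have "open (U \<inter> chart_dom c)" "base1 (q t0) \<in> U \<inter> chart_dom c"
    using M.frame_open[OF e] M.chart(1)[of c] c(1) U by (auto simp: M.charts_at_iff)
  moreover have "continuous_on {0..\<tau>} (\<lambda>t. base1 (q t))" using curve1 by (simp add: ac_curve_def)
  ultimately obtain d1 where d1: "d1 > 0" "\<And>s u. 0 \<le> s \<and> s \<le> t0 \<and> t0 \<le> u \<and> u \<le> \<tau> \<and> u - s < d1 \<Longrightarrow>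
      (\<lambda>t. base1 (q t)) ` {s..u} \<subseteq> U \<inter> chart_dom c"
    using continuous_on_short_intervals[OF _ t0] by meson
  have "open (V \<inter> chart_dom c')" "base2 (q t0) \<in> V \<inter> chart_dom c'"
    using N.frame_open[OF f] N.chart(1)[of c'] c(2) V by (auto simp: N.charts_at_iff)
  moreover have "continuous_on {0..\<tau>} (\<lambda>t. base2 (q t))" using curve2 by (simp add: ac_curve_def)
  ultimately obtain d2 where d2: "d2 > 0" "\<And>s u. 0 \<le> s \<and> s \<le> t0 \<and> t0 \<le> u \<and> u \<le> \<tau> \<and> u - s < d2 \<Longrightarrow>
      (\<lambda>t. base2 (q t)) ` {s..u} \<subseteq> V \<inter> chart_dom c'"
    using continuous_on_short_intervals[OF _ t0] by meson
  show ?thesis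
  proof (rule that[of T "min d1 d2"])
    show "T \<in> trivializations M N" using e f by (simp add: T_def trivializations_def)
    show "(\<lambda>t. base1 (q t)) ` {s..u} \<subseteq> dom1 T \<inter> chart_dom c \<and> (\<lambda>t. base2 (q t)) ` {s..u} \<subseteq> dom2 T \<inter> chart_dom c'"
      if "0 \<le> s" "s \<le> t0" "t0 \<le> u" "u \<le> \<tau>" "u - s < min d1 d2" for s u
      using d1(2)[of s u] d2(2)[of s u] that by (simp add: T_def)
  qed (use d1 d2 in simp)
qed

lemma ac_triv_matrix:
  assumes "T \<in> trivializations M N" "0 \<le> s" "s \<le> u" "u \<le> \<tau>"
    "(\<lambda>t. base1 (q t)) ` {s..u} \<subseteq> dom1 T" "(\<lambda>t. base2 (q t)) ` {s..u} \<subseteq> dom2 T"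
  shows "abs_continuous_on s u (\<lambda>t. triv_matrix N T (q t))"
  using ac assms unfolding ac_config_curve_def image_subset_iff by blast

lemma AE_good_at: "AE t\<in>{0..\<tau>} in lebesgue. good_at q t"
proof -
  have "AE t\<in>{0..\<tau>} in lebesgue. \<exists>T\<in>trivs_at M N (q t). (\<lambda>s. triv_matrix N T (q s)) differentiable (at t)"
  proof (rule AE_local)
    fix t0 assume t0: "t0 \<in> {0..\<tau>}"
    obtain c c' where c: "c \<in> charts_at M (base1 (q t0))" "c' \<in> charts_at N (base2 (q t0))"
      using M.ex_chart_at N.ex_chart_at by blast
    obtain T d where T: "T \<in> trivializations M N" "d > 0"
      and dom: "\<And>s u. 0 \<le> s \<Longrightarrow> s \<le> t0 \<Longrightarrow> t0 \<le> u \<Longrightarrow> u \<le> \<tau> \<Longrightarrow> u - s < d \<Longrightarrow>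
      (\<lambda>t. base1 (q t)) ` {s..u} \<subseteq> dom1 T \<inter> chart_dom c \<and> (\<lambda>t. base2 (q t)) ` {s..u} \<subseteq> dom2 T \<inter> chart_dom c'"
      by (rule local_triv[OF t0 c]) blast
    show "\<exists>d>0. \<forall>s u. 0 \<le> s \<and> s \<le> t0 \<and> t0 \<le> u \<and> u \<le> \<tau> \<and> u - s < d \<longrightarrow>
        (AE t\<in>{s..u} in lebesgue. \<exists>T\<in>trivs_at M N (q t). (\<lambda>s. triv_matrix N T (q s)) differentiable (at t))"
    proof (intro exI[of _ d] conjI allI impI)
      fix s u assume su: "0 \<le> s \<and> s \<le> t0 \<and> t0 \<le> u \<and> u \<le> \<tau> \<and> u - s < d"
      then have D: "(\<lambda>t. base1 (q t)) ` {s..u} \<subseteq> dom1 T" "(\<lambda>t. base2 (q t)) ` {s..u} \<subseteq> dom2 T"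
        using dom[of s u] by auto
      have "abs_continuous_on s u (\<lambda>t. triv_matrix N T (q t))"
        by (rule ac_triv_matrix[OF T(1) _ _ _ D]) (use su in auto)
      then obtain g where "AE t\<in>{s..u} in lebesgue. ((\<lambda>t. triv_matrix N T (q t)) has_vector_derivative g t) (at t)"
        using su by (elim abs_continuous_on_AE_derivative[rotated]) auto
      then show "AE t\<in>{s..u} in lebesgue. \<exists>T\<in>trivs_at M N (q t). (\<lambda>s. triv_matrix N T (q s)) differentiable (at t)"
      proof (eventually_elim, intro impI)
        fix t assume t: "t \<in> {s..u} \<longrightarrow> ((\<lambda>t. triv_matrix N T (q t)) has_vector_derivative g t) (at t)" "t \<in> {s..u}"
        have "T \<in> trivs_at M N (q t)" using T(1) D t(2) by (auto simp: trivs_at_def)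
        then show "\<exists>T\<in>trivs_at M N (q t). (\<lambda>s. triv_matrix N T (q s)) differentiable (at t)"
          using t differentiableI_vector by blast
      qed
    qed (rule T)
  qed (use \<tau> in simp)
  then show ?thesis
    using M.AE_differentiable_curve[OF curve1 less_imp_le[OF \<tau>]] N.AE_differentiable_curve[OF curve2 less_imp_le[OF \<tau>]]
    by eventually_elim (auto simp: good_at_def)
qed

text \<open>Two trivializations differ by the inner products of their frames, smooth functions of
  the base points and hence differentiable along the curve at \<open>t\<close>. So differentiability
  passes to every trivialization without a further null set.\<close>

lemma triv_matrix_differentiable:
  assumes t: "0 < t" "t < \<tau>" and g: "good_at q t" and T: "T \<in> trivs_at M N (q t)"
  shows "(\<lambda>s. triv_matrix N T (q s)) differentiable (at t)"
proof -
  let ?x = "\<lambda>s. base1 (q s)" and ?y = "\<lambda>s. base2 (q s)"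
  obtain R where R: "R \<in> trivs_at M N (q t)" and dR: "(\<lambda>s. triv_matrix N R (q s)) differentiable (at t)"
    using g unfolding good_at_def by blast
  have dx: "M.differentiable_curve_at ?x t" and dy: "N.differentiable_curve_at ?y t" using g unfolding good_at_def by auto
  note fT = triv_frames[OF T] and fR = triv_frames[OF R]
  let ?U = "dom1 T \<inter> dom1 R" and ?V = "dom2 T \<inter> dom2 R"
  have U: "open ?U" "?x t \<in> ?U" and V: "open ?V" "?y t \<in> ?V"
    using M.frame_open[OF fT(1)] M.frame_open[OF fR(1)] N.frame_open[OF fT(2)] N.frame_open[OF fR(2)] fT fR by auto
  have cont: "isCont ?x t" "isCont ?y t" using dx dy by (auto simp: M.differentiable_curve_at_def N.differentiable_curve_at_def)
  obtain A where A: "open A" "t \<in> A" "\<And>s. s \<in> A \<Longrightarrow> ?x s \<in> ?U"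
    by (rule isCont_open_neighbourhood[OF cont(1) U]) blast
  obtain B where B: "open B" "t \<in> B" "\<And>s. s \<in> B \<Longrightarrow> ?y s \<in> ?V"
    by (rule isCont_open_neighbourhood[OF cont(2) V]) blast
  define a where "a j l s = rmetric M (?x s) (frame1 T j (?x s)) (frame1 R l (?x s))" for j l s
  define b where "b i k s = rmetric N (?y s) (frame2 T i (?y s)) (frame2 R k (?y s))" for i k s
  have ad: "a j l differentiable (at t)" for j l
    unfolding a_def
    by (rule M.differentiable_rmetric_along[OF dx U]) (auto intro: M.smooth_field_on_subset M.frame_smooth[OF fT(1)] M.frame_smooth[OF fR(1)])
  have bd: "b i k differentiable (at t)" for i k
    unfolding b_def
    by (rule N.differentiable_rmetric_along[OF dy V]) (auto intro: N.smooth_field_on_subset N.frame_smooth[OF fT(2)] N.frame_smooth[OF fR(2)])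
  have Rd: "(\<lambda>s. triv_matrix N R (q s) $ k $ l) differentiable (at t)" for k l
    using dR by (simp add: differentiable_matrix_iff)
  have eq: "triv_matrix N T (q s) $ i $ j = (\<Sum>k\<in>UNIV. (\<Sum>l\<in>UNIV. triv_matrix N R (q s) $ k $ l * a j l s) * b i k s)"
    if s: "s \<in> A \<inter> B \<inter> {0<..<\<tau>}" for s i j
  proof -
    have qs: "q s \<in> config_space M N" using curve_config s by auto
    have Rs: "R \<in> trivs_at M N (q s)" and xs: "?x s \<in> dom1 T" and ys: "?y s \<in> dom2 T"
      using R A(3)[of s] B(3)[of s] s by (auto simp: trivs_at_def)
    note fRs = triv_frames[OF Rs]
    \<comment> \<open>The frames of \<open>T\<close> are expanded in the frames of \<open>R\<close>;
      the matrix of \<open>T\<close> becomes the product of \<open>b\<close>, the matrix of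
      \<open>R\<close> and the transpose of \<open>a\<close>.\<close>
    have 1: "frame1 T j (?x s) = M.frame_vec (frame1 R) (?x s) (\<chi> l. a j l s)"
      using M.frame_vec_frame_coords[OF fRs(1,3) M.frame_tangent[OF fT(1) xs]]
      by (simp add: M.frame_coords_def a_def)
    have 2: "frame2 T i (?y s) = N.frame_vec (frame2 R) (?y s) (\<chi> k. b i k s)"
      using N.frame_vec_frame_coords[OF fRs(2,4) N.frame_tangent[OF fT(2) ys]]
      by (simp add: N.frame_coords_def b_def)
    have "triv_matrix N T (q s) $ i $ j = rmetric N (?y s) (qmap (q s) (frame1 T j (?x s))) (frame2 T i (?y s))"
      by (simp add: triv_matrix_def)
    also have "\<dots> = (triv_matrix N R (q s) *v (\<chi> l. a j l s)) \<bullet> (\<chi> k. b i k s)"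
      unfolding 1 2 config_frame_vec[OF qs Rs] by (rule N.rmetric_frame_vec[OF fRs(2,4)])
    finally show ?thesis by (simp add: matrix_vector_mult_def inner_vec_def)
  qed
  show ?thesis
    unfolding differentiable_matrix_iff
  proof (intro allI)
    fix i j
    have "(\<lambda>s. \<Sum>k\<in>UNIV. (\<Sum>l\<in>UNIV. triv_matrix N R (q s) $ k $ l * a j l s) * b i k s) differentiable (at t)"
      by (intro differentiable_sum differentiable_mult ballI finite Rd ad bd)
    then show "(\<lambda>s. triv_matrix N T (q s) $ i $ j) differentiable (at t)"
      using frechet_derivative_cong_open(2)[of "A \<inter> B \<inter> {0<..<\<tau>}" t "\<lambda>s. triv_matrix N T (q s) $ i $ j", OF _ _ eq] A(1,2) B(1,2) t
      by (simp add: open_Int)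
  qed
qed

lemma cov_deriv_rolling:
  assumes t: "0 < t" "t < \<tau>" and g: "good_at q t" and T: "T \<in> trivs_at M N (q t)"
    and A': "((\<lambda>s. triv_matrix N T (q s)) has_vector_derivative A') (at t)"
    and vel: "velocity N (\<lambda>s. base2 (q s)) t = qmap (q t) (velocity M (\<lambda>s. base1 (q s)) t)"
    and Z: "field_along M \<tau> (\<lambda>t. base1 (q t)) Z"
    and c: "c \<in> charts_at M (base1 (q t))" "(\<lambda>s. Z s c) differentiable (at t)"
  obtains w where
    "cov_deriv M nablaM (\<lambda>s. base1 (q s)) Z t = M.frame_vec (frame1 T) (base1 (q t)) w"
    "cov_deriv N nablaN (\<lambda>s. base2 (q s)) (\<lambda>s. qmap (q s) (Z s)) t
      = N.frame_vec (frame2 T) (base2 (q t)) (triv_matrix N T (q t) *v w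
          + (A' - vertical_part M N nablaM nablaN T (q t) (velocity M (\<lambda>s. base1 (q s)) t))
            *v M.frame_coords (frame1 T) (base1 (q t)) (Z t))"
proof -
  let ?x = "\<lambda>s. base1 (q s)" and ?y = "\<lambda>s. base2 (q s)"
  let ?v = "velocity M ?x t" and ?A = "\<lambda>s. triv_matrix N T (q s)"
  have dx: "M.differentiable_curve_at ?x t" and dy: "N.differentiable_curve_at ?y t" using g unfolding good_at_def by auto
  note fT = triv_frames[OF T]
  have qt: "q t \<in> config_space M N" using curve_config t by auto
  have v: "?v \<in> tangent_space M (?x t)" by (rule M.differentiable_curve_velocity(2)[OF dx])
  define z where "z s = M.frame_coords (frame1 T) (?x s) (Z s)" for s
  have "z differentiable (at t)"
    unfolding z_def by (rule M.differentiable_frame_coords[OF dx t Z c fT(1,3)])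
  then obtain z' where z': "(z has_vector_derivative z') (at t)" by (meson vector_derivative_works)
  have cont: "isCont ?x t" "isCont ?y t" using dx dy by (auto simp: M.differentiable_curve_at_def N.differentiable_curve_at_def)
  obtain B where B: "open B" "t \<in> B" "\<And>s. s \<in> B \<Longrightarrow> ?x s \<in> dom1 T"
    by (rule isCont_open_neighbourhood[OF cont(1) M.frame_open[OF fT(1)] fT(3)]) blast
  obtain C where C: "open C" "t \<in> C" "\<And>s. s \<in> C \<Longrightarrow> ?y s \<in> dom2 T"
    by (rule isCont_open_neighbourhood[OF cont(2) N.frame_open[OF fT(2)] fT(4)]) blast
  define D where "D = B \<inter> C \<inter> {0<..<\<tau>}"
  have D: "open D" "t \<in> D" using B C t by (auto simp: D_def open_Int)
  have Zz: "Z s = M.frame_vec (frame1 T) (?x s) (z s)" if "s \<in> D" for s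
    unfolding z_def
    by (rule M.frame_vec_frame_coords[OF fT(1), symmetric]) (use that B(3) Z in \<open>auto simp: D_def field_along_def\<close>)
  have qZ: "qmap (q s) (Z s) = N.frame_vec (frame2 T) (?y s) (?A s *v z s)" if s: "s \<in> D" for s
  proof -
    have "q s \<in> config_space M N" using curve_config s by (auto simp: D_def)
    moreover have "T \<in> trivs_at M N (q s)" using T B(3) C(3) s by (auto simp: trivs_at_def D_def)
    ultimately show ?thesis unfolding Zz[OF s] by (rule config_frame_vec)
  qed
  let ?\<Omega> = "M.connection_matrix (frame1 T) (?x t) ?v" and ?\<Psi> = "N.connection_matrix (frame2 T) (?y t) (velocity N ?y t)"
  have 1: "cov_deriv M nablaM ?x Z t = M.frame_vec (frame1 T) (?x t) (z' + ?\<Omega> *v z t)"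
    by (rule M.cov_deriv_frame[OF fT(1) dx fT(3) D Zz z'])
  have zz: "((\<lambda>s. ?A s *v z s) has_vector_derivative (?A t *v z' + A' *v z t)) (at t)"
    by (rule bounded_bilinear.has_vector_derivative[OF bounded_bilinear_matrix_vector_mult A' z'])
  have "cov_deriv N nablaN ?y (\<lambda>s. qmap (q s) (Z s)) t
      = N.frame_vec (frame2 T) (?y t) (?A t *v z' + A' *v z t + ?\<Psi> *v (?A t *v z t))"
    by (rule N.cov_deriv_frame[OF fT(2) dy fT(4) D qZ zz])
  \<comment> \<open>The term \<open>?A t *v (?\<Omega> *v z t)\<close> is added and subtracted.
    Hypothesis \<open>vel\<close> identifies the direction in \<open>?\<Psi>\<close> with the image
    of the first velocity, as in the vertical part.\<close>
  also have "?A t *v z' + A' *v z t + ?\<Psi> *v (?A t *v z t)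
      = ?A t *v (z' + ?\<Omega> *v z t) + (A' - vertical_part M N nablaM nablaN T (q t) ?v) *v z t"
    unfolding vertical_part_eq[OF qt T v] vel
    by (simp add: matrix_vector_mul_assoc matrix_vector_mult_diff_rdistrib matrix_vector_right_distrib algebra_simps)
  finally show ?thesis using that 1 by (simp add: z_def)
qed

lemma field_along_qmap:
  "field_along M \<tau> (\<lambda>t. base1 (q t)) Z \<Longrightarrow> field_along N \<tau> (\<lambda>t. base2 (q t)) (\<lambda>t. qmap (q t) (Z t))"
  using config_tangent curve_config unfolding field_along_def by blast

text \<open>In frame coordinates the passage is multiplication by the matrix of the trivialization,
  absolutely continuous in time; its inverse is its transpose and therefore absolutely continuous as
  well.\<close>

lemma ac_transfer_local:
  assumes Z: "field_along M \<tau> (\<lambda>t. base1 (q t)) Z" and T: "T \<in> trivializations M N"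
    and su: "0 \<le> s" "s \<le> u" "u \<le> \<tau>" and c: "c \<in> charts M" "c' \<in> charts N"
    and dom: "(\<lambda>t. base1 (q t)) ` {s..u} \<subseteq> dom1 T \<inter> chart_dom c" "(\<lambda>t. base2 (q t)) ` {s..u} \<subseteq> dom2 T \<inter> chart_dom c'"
  shows "abs_continuous_on s u (\<lambda>t. Z t c) \<longleftrightarrow> abs_continuous_on s u (\<lambda>t. qmap (q t) (Z t) c')"
proof -
  let ?x = "\<lambda>s. base1 (q s)" and ?y = "\<lambda>s. base2 (q s)"
  let ?A = "\<lambda>s. triv_matrix N T (q s)"
  have A: "abs_continuous_on s u ?A" by (rule ac_triv_matrix[OF T su]) (use dom in auto)
  have pf: "positive_orthonormal_frame M (dom1 T) (frame1 T)" "positive_orthonormal_frame N (dom2 T) (frame2 T)"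
    using T by (auto simp: trivializations_def)
  have Tt: "T \<in> trivs_at M N (q t)" and qt: "q t \<in> config_space M N" and Zt: "Z t \<in> tangent_space M (?x t)"
    if "t \<in> {s..u}" for t
    using that T dom curve_config Z su by (auto simp: trivs_at_def field_along_def)
  define z where "z t = M.frame_coords (frame1 T) (?x t) (Z t)" for t
  have Zz: "Z t = M.frame_vec (frame1 T) (?x t) (z t)" if t: "t \<in> {s..u}" for t
    unfolding z_def by (rule M.frame_vec_frame_coords[OF triv_frames(1,3)[OF Tt[OF t]] Zt[OF t], symmetric])
  have qZ: "qmap (q t) (Z t) = N.frame_vec (frame2 T) (?y t) (?A t *v z t)" if t: "t \<in> {s..u}" for t
    unfolding Zz[OF t] by (rule config_frame_vec[OF qt[OF t] Tt[OF t]])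
  show ?thesis
  proof
    assume h: "abs_continuous_on s u (\<lambda>t. Z t c)"
    have "abs_continuous_on s u z"
      unfolding z_def by (rule M.ac_frame_coords[OF pf(1) curve1 su c(1) dom(1)]) (erule Zt, rule h)
    then have "abs_continuous_on s u (\<lambda>t. N.frame_vec (frame2 T) (?y t) (?A t *v z t) c')"
      by (intro N.ac_frame_vec[OF pf(2) curve2 su c(2) dom(2)] abs_continuous_on_matrix_vector A)
    then show "abs_continuous_on s u (\<lambda>t. qmap (q t) (Z t) c')"
      by (rule abs_continuous_on_cong) (simp add: qZ)
  next
    assume h: "abs_continuous_on s u (\<lambda>t. qmap (q t) (Z t) c')"
    have "abs_continuous_on s u (\<lambda>t. N.frame_coords (frame2 T) (?y t) (qmap (q t) (Z t)))"
      by (rule N.ac_frame_coords[OF pf(2) curve2 su c(2) dom(2)]) (rule config_tangent[OF qt Zt], assumption+, rule h)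
    then have "abs_continuous_on s u (\<lambda>t. transpose (?A t) *v N.frame_coords (frame2 T) (?y t) (qmap (q t) (Z t)))"
      by (intro abs_continuous_on_matrix_vector bounded_linear.abs_continuous_on[OF bounded_linear_transpose A])
    then have "abs_continuous_on s u z"
    proof (rule abs_continuous_on_cong)
      fix t assume t: "t \<in> {s..u}"
      show "z t = transpose (?A t) *v N.frame_coords (frame2 T) (?y t) (qmap (q t) (Z t))"
        unfolding qZ[OF t] N.frame_coords_frame_vec[OF triv_frames(2,4)[OF Tt[OF t]]]
        by (simp add: matrix_vector_mul_assoc triv_matrix_orthogonal[OF qt[OF t] Tt[OF t]])
    qed
    then have "abs_continuous_on s u (\<lambda>t. M.frame_vec (frame1 T) (?x t) (z t) c)"
      by (rule M.ac_frame_vec[OF pf(1) curve1 su c(1) dom(1)])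
    then show "abs_continuous_on s u (\<lambda>t. Z t c)"
      by (rule abs_continuous_on_cong) (simp add: Zz)
  qed
qed

text \<open>Settles condition (II') for fields that are not absolutely continuous. An interval on
  which one curve stays in a chart may take the other through several charts, so the local version
  is applied on short pieces.\<close>

lemma ac_transfer:
  assumes Z: "field_along M \<tau> (\<lambda>t. base1 (q t)) Z"
  shows "ac_field_along M \<tau> (\<lambda>t. base1 (q t)) Z \<longleftrightarrow> ac_field_along N \<tau> (\<lambda>t. base2 (q t)) (\<lambda>t. qmap (q t) (Z t))"
proof
  assume ac1: "ac_field_along M \<tau> (\<lambda>t. base1 (q t)) Z"
  show "ac_field_along N \<tau> (\<lambda>t. base2 (q t)) (\<lambda>t. qmap (q t) (Z t))"
    unfolding ac_field_along_def
  proof (intro conjI field_along_qmap[OF Z] ballI allI impI)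
    fix c' a b assume c': "c' \<in> charts N" and ab: "0 \<le> a \<and> a \<le> b \<and> b \<le> \<tau> \<and> (\<lambda>t. base2 (q t)) ` {a..b} \<subseteq> chart_dom c'"
    show "abs_continuous_on a b (\<lambda>t. qmap (q t) (Z t) c')"
    proof (rule abs_continuous_on_local)
      fix t0 assume t0: "t0 \<in> {a..b}"
      then have t0': "t0 \<in> {0..\<tau>}" using ab by auto
      obtain c where c: "c \<in> charts_at M (base1 (q t0))" using M.ex_chart_at by blast
      have c'0: "c' \<in> charts_at N (base2 (q t0))" using c' ab t0 by (auto simp: N.charts_at_iff)
      obtain T d where T: "T \<in> trivializations M N" "d > 0"
        and dom: "\<And>s u. 0 \<le> s \<Longrightarrow> s \<le> t0 \<Longrightarrow> t0 \<le> u \<Longrightarrow> u \<le> \<tau> \<Longrightarrow> u - s < d \<Longrightarrow>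
        (\<lambda>t. base1 (q t)) ` {s..u} \<subseteq> dom1 T \<inter> chart_dom c \<and> (\<lambda>t. base2 (q t)) ` {s..u} \<subseteq> dom2 T \<inter> chart_dom c'"
        by (rule local_triv[OF t0' c c'0]) blast
      show "\<exists>d>0. \<forall>s t. a \<le> s \<and> s \<le> t0 \<and> t0 \<le> t \<and> t \<le> b \<and> t - s < d \<longrightarrow> abs_continuous_on s t (\<lambda>t. qmap (q t) (Z t) c')"
      proof (intro exI[of _ d] conjI allI impI T)
        fix s u assume su: "a \<le> s \<and> s \<le> t0 \<and> t0 \<le> u \<and> u \<le> b \<and> u - s < d"
        then have su': "0 \<le> s" "s \<le> u" "u \<le> \<tau>" using ab by auto
        note D = dom[of s u]
        have cM: "c \<in> charts M" using c by (simp add: M.charts_at_iff)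
        have "abs_continuous_on s u (\<lambda>t. Z t c)"
          using ac1 cM su' D su ab unfolding ac_field_along_def by auto
        then show "abs_continuous_on s u (\<lambda>t. qmap (q t) (Z t) c')"
          using ac_transfer_local[OF Z T(1) su' cM c'] D su ab by auto
      qed
    qed (use ab in auto)
  qed
next
  assume ac2: "ac_field_along N \<tau> (\<lambda>t. base2 (q t)) (\<lambda>t. qmap (q t) (Z t))"
  show "ac_field_along M \<tau> (\<lambda>t. base1 (q t)) Z"
    unfolding ac_field_along_def
  proof (intro conjI Z ballI allI impI)
    fix c a b assume c: "c \<in> charts M" and ab: "0 \<le> a \<and> a \<le> b \<and> b \<le> \<tau> \<and> (\<lambda>t. base1 (q t)) ` {a..b} \<subseteq> chart_dom c"
    show "abs_continuous_on a b (\<lambda>t. Z t c)"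
    proof (rule abs_continuous_on_local)
      fix t0 assume t0: "t0 \<in> {a..b}"
      then have t0': "t0 \<in> {0..\<tau>}" using ab by auto
      obtain c' where c': "c' \<in> charts_at N (base2 (q t0))" using N.ex_chart_at by blast
      have c0: "c \<in> charts_at M (base1 (q t0))" using c ab t0 by (auto simp: M.charts_at_iff)
      obtain T d where T: "T \<in> trivializations M N" "d > 0"
        and dom: "\<And>s u. 0 \<le> s \<Longrightarrow> s \<le> t0 \<Longrightarrow> t0 \<le> u \<Longrightarrow> u \<le> \<tau> \<Longrightarrow> u - s < d \<Longrightarrow>
        (\<lambda>t. base1 (q t)) ` {s..u} \<subseteq> dom1 T \<inter> chart_dom c \<and> (\<lambda>t. base2 (q t)) ` {s..u} \<subseteq> dom2 T \<inter> chart_dom c'"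
        by (rule local_triv[OF t0' c0 c']) blast
      show "\<exists>d>0. \<forall>s t. a \<le> s \<and> s \<le> t0 \<and> t0 \<le> t \<and> t \<le> b \<and> t - s < d \<longrightarrow> abs_continuous_on s t (\<lambda>t. Z t c)"
      proof (intro exI[of _ d] conjI allI impI T)
        fix s u assume su: "a \<le> s \<and> s \<le> t0 \<and> t0 \<le> u \<and> u \<le> b \<and> u - s < d"
        then have su': "0 \<le> s" "s \<le> u" "u \<le> \<tau>" using ab by auto
        note D = dom[of s u]
        have cN: "c' \<in> charts N" using c' by (simp add: N.charts_at_iff)
        have "abs_continuous_on s u (\<lambda>t. qmap (q t) (Z t) c')"
          using ac2 cN su' D su ab unfolding ac_field_along_def by auto
        then show "abs_continuous_on s u (\<lambda>t. Z t c)"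
          using ac_transfer_local[OF Z T(1) su' c cN] D su ab by auto
      qed
    qed (use ab in auto)
  qed
qed

section \<open>The two implications\<close>

lemma horizontal_imp_rolling:
  assumes hor: "AE t\<in>{0..\<tau>} in lebesgue. config_velocity M N q t \<in> rolling_distribution M N nablaM nablaN (q t)"
  shows "intrinsic_rolling M N nablaM nablaN \<tau> q"
proof -
  let ?x = "\<lambda>s. base1 (q s)" and ?y = "\<lambda>s. base2 (q s)"
  have hor': "AE t\<in>{0..\<tau>} in lebesgue. velocity N ?y t = qmap (q t) (velocity M ?x t) \<and>
      (\<forall>T\<in>trivs_at M N (q t). vector_derivative (\<lambda>s. triv_matrix N T (q s)) (at t)
        = vertical_part M N nablaM nablaN T (q t) (velocity M ?x t))"
    using hor AE_good_at
  proof (eventually_elim, intro impI)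
    fix t assume t: "t \<in> {0..\<tau>} \<longrightarrow> config_velocity M N q t \<in> rolling_distribution M N nablaM nablaN (q t)"
      "t \<in> {0..\<tau>} \<longrightarrow> good_at q t" "t \<in> {0..\<tau>}"
    then obtain X where X: "config_velocity M N q t = (\<lambda>T\<in>trivs_at M N (q t). (X, qmap (q t) X, vertical_part M N nablaM nablaN T (q t) X))"
      unfolding rolling_distribution_def by blast
    have *: "velocity M ?x t = X \<and> velocity N ?y t = qmap (q t) X \<and>
        vector_derivative (\<lambda>s. triv_matrix N T (q s)) (at t) = vertical_part M N nablaM nablaN T (q t) X"
      if "T \<in> trivs_at M N (q t)" for T
      using fun_cong[OF X, of T] that by (simp add: config_velocity_def)
    \<comment> \<open>The families are equal in every trivialization around \<open>q t\<close>, but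
      one must exist for their first two components to be read off; \<open>good_at\<close> provides
      it.\<close>
    obtain T0 where "T0 \<in> trivs_at M N (q t)" using t unfolding good_at_def by blast
    from *[OF this] * show "velocity N ?y t = qmap (q t) (velocity M ?x t) \<and>
      (\<forall>T\<in>trivs_at M N (q t). vector_derivative (\<lambda>s. triv_matrix N T (q s)) (at t)
        = vertical_part M N nablaM nablaN T (q t) (velocity M ?x t))" by simp
  qed
  have "parallel_along M nablaM \<tau> ?x Z \<longleftrightarrow> parallel_along N nablaN \<tau> ?y (\<lambda>t. qmap (q t) (Z t))"
    if Z: "field_along M \<tau> ?x Z" for Z
  proof (cases "ac_field_along M \<tau> ?x Z")
    case False
    then show ?thesis using ac_transfer[OF Z] by (simp add: parallel_along_def)
  next
    case True
    have E: "AE t in lebesgue. t \<in> {0..\<tau>} \<longrightarrow>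
        (cov_deriv M nablaM ?x Z t = 0 \<longleftrightarrow> cov_deriv N nablaN ?y (\<lambda>s. qmap (q s) (Z s)) t = 0)"
      using hor' AE_good_at M.AE_field_differentiable[OF curve1 True less_imp_le[OF \<tau>]] AE_interior[of 0 \<tau>]
    proof (eventually_elim, intro impI)
      fix t assume a: "t \<in> {0..\<tau>} \<longrightarrow> velocity N ?y t = qmap (q t) (velocity M ?x t) \<and>
          (\<forall>T\<in>trivs_at M N (q t). vector_derivative (\<lambda>s. triv_matrix N T (q s)) (at t)
            = vertical_part M N nablaM nablaN T (q t) (velocity M ?x t))"
        "t \<in> {0..\<tau>} \<longrightarrow> good_at q t" "t \<in> {0..\<tau>} \<longrightarrow> (\<exists>c\<in>charts_at M (?x t). (\<lambda>s. Z s c) differentiable (at t))"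
        "t \<noteq> 0 \<and> t \<noteq> \<tau>" "t \<in> {0..\<tau>}"
      then have t: "0 < t" "t < \<tau>" and g: "good_at q t" by auto
      obtain c where c: "c \<in> charts_at M (?x t)" "(\<lambda>s. Z s c) differentiable (at t)" using a by blast
      obtain T where T: "T \<in> trivs_at M N (q t)" using g unfolding good_at_def by blast
      have A': "((\<lambda>s. triv_matrix N T (q s)) has_vector_derivative vertical_part M N nablaM nablaN T (q t) (velocity M ?x t)) (at t)"
        using triv_matrix_differentiable[OF t g T] a T vector_derivative_works by metis
      have vel: "velocity N ?y t = qmap (q t) (velocity M ?x t)" using a by blast
      \<comment> \<open>Here \<open>A'\<close> equals the vertical part, so the correction in
        \<open>cov_deriv_rolling\<close> drops out and the two covariant derivatives have
        coordinates \<open>w\<close> and \<open>A w\<close> with \<open>A\<close> injective.\<close>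
      obtain w where w: "cov_deriv M nablaM ?x Z t = M.frame_vec (frame1 T) (?x t) w"
        "cov_deriv N nablaN ?y (\<lambda>s. qmap (q s) (Z s)) t = N.frame_vec (frame2 T) (?y t) (triv_matrix N T (q t) *v w)"
        by (rule cov_deriv_rolling[OF t g T A' vel Z c]) simp
      have qt: "q t \<in> config_space M N" using curve_config a by blast
      show "cov_deriv M nablaM ?x Z t = 0 \<longleftrightarrow> cov_deriv N nablaN ?y (\<lambda>s. qmap (q s) (Z s)) t = 0"
        unfolding w using M.frame_vec_inject[OF triv_frames(1,3)[OF T], of w 0]
          N.frame_vec_inject[OF triv_frames(2,4)[OF T], of "triv_matrix N T (q t) *v w" 0] triv_matrix_inj[OF qt T, of w]
        by (simp add: M.frame_vec_0 N.frame_vec_0)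
    qed
    have "(AE t\<in>{0..\<tau>} in lebesgue. cov_deriv M nablaM ?x Z t = 0) \<longleftrightarrow>
        (AE t\<in>{0..\<tau>} in lebesgue. cov_deriv N nablaN ?y (\<lambda>s. qmap (q s) (Z s)) t = 0)"
    proof
      assume "AE t\<in>{0..\<tau>} in lebesgue. cov_deriv M nablaM ?x Z t = 0"
      with E show "AE t\<in>{0..\<tau>} in lebesgue. cov_deriv N nablaN ?y (\<lambda>s. qmap (q s) (Z s)) t = 0"
        by eventually_elim blast
    next
      assume "AE t\<in>{0..\<tau>} in lebesgue. cov_deriv N nablaN ?y (\<lambda>s. qmap (q s) (Z s)) t = 0"
      with E show "AE t\<in>{0..\<tau>} in lebesgue. cov_deriv M nablaM ?x Z t = 0"
        by eventually_elim blast
    qed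
    then show ?thesis using True ac_transfer[OF Z] by (simp add: parallel_along_def)
  qed
  then show ?thesis
    using ac hor' unfolding intrinsic_rolling_def by (auto elim: eventually_mono)
qed

text \<open>Condition (II') makes the images of a parallel frame of the first curve parallel as
  well. At almost every time, \<open>cov_deriv_rolling\<close> with both covariant derivatives zero
  says that the difference of \<open>A'\<close> and the vertical part annihilates the coordinates of
  a basis.\<close>

lemma rolling_imp_horizontal:
  assumes rol: "intrinsic_rolling M N nablaM nablaN \<tau> q"
  shows "AE t\<in>{0..\<tau>} in lebesgue. config_velocity M N q t \<in> rolling_distribution M N nablaM nablaN (q t)"
proof -
  let ?x = "\<lambda>s. base1 (q s)" and ?y = "\<lambda>s. base2 (q s)"
  obtain Z :: "'n \<Rightarrow> real \<Rightarrow> ('a, 'n) tvec" where Z: "\<And>k. parallel_along M nablaM \<tau> ?x (Z k)"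
    and nd: "\<And>t. t \<in> {0..\<tau>} \<Longrightarrow> M.nondegenerate (?x t) (\<lambda>k. Z k t)"
    using M.parallel_basis_exists[OF curve1 less_imp_le[OF \<tau>]] by blast
  have Zac: "ac_field_along M \<tau> ?x (Z k)" and Zf: "field_along M \<tau> ?x (Z k)" for k
    using Z[of k] by (auto simp: parallel_along_def ac_field_along_def)
  have qZ: "parallel_along N nablaN \<tau> ?y (\<lambda>t. qmap (q t) (Z k t))" for k
    using rol Z[of k] Zf[of k] unfolding intrinsic_rolling_def by blast
  \<comment> \<open>There are finitely many fields, so one null set serves all
    \<open>k\<close>.\<close>
  have "AE t in lebesgue. \<forall>k\<in>UNIV. t \<in> {0..\<tau>} \<longrightarrow> cov_deriv M nablaM ?x (Z k) t = 0"
    by (rule AE_finite_allI) (use Z in \<open>auto simp: parallel_along_def\<close>)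
  moreover have "AE t in lebesgue. \<forall>k\<in>UNIV. t \<in> {0..\<tau>} \<longrightarrow> cov_deriv N nablaN ?y (\<lambda>t. qmap (q t) (Z k t)) t = 0"
    by (rule AE_finite_allI) (use qZ in \<open>auto simp: parallel_along_def\<close>)
  moreover have "AE t in lebesgue. \<forall>k\<in>UNIV. t \<in> {0..\<tau>} \<longrightarrow> (\<exists>c\<in>charts_at M (?x t). (\<lambda>s. Z k s c) differentiable (at t))"
    by (rule AE_finite_allI) (use M.AE_field_differentiable[OF curve1 Zac less_imp_le[OF \<tau>]] in auto)
  moreover have "AE t\<in>{0..\<tau>} in lebesgue. velocity N ?y t = qmap (q t) (velocity M ?x t)"
    using rol unfolding intrinsic_rolling_def by blast
  ultimately show ?thesis
    using AE_good_at AE_interior[of 0 \<tau>]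
  proof (eventually_elim, intro impI)
    fix t assume a: "\<forall>k\<in>UNIV. t \<in> {0..\<tau>} \<longrightarrow> cov_deriv M nablaM ?x (Z k) t = 0"
      "\<forall>k\<in>UNIV. t \<in> {0..\<tau>} \<longrightarrow> cov_deriv N nablaN ?y (\<lambda>t. qmap (q t) (Z k t)) t = 0"
      "\<forall>k\<in>UNIV. t \<in> {0..\<tau>} \<longrightarrow> (\<exists>c\<in>charts_at M (?x t). (\<lambda>s. Z k s c) differentiable (at t))"
      "t \<in> {0..\<tau>} \<longrightarrow> velocity N ?y t = qmap (q t) (velocity M ?x t)"
      "t \<in> {0..\<tau>} \<longrightarrow> good_at q t" "t \<noteq> 0 \<and> t \<noteq> \<tau>" "t \<in> {0..\<tau>}"
    then have t: "0 < t" "t < \<tau>" and g: "good_at q t" and vel: "velocity N ?y t = qmap (q t) (velocity M ?x t)" by auto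
    let ?X = "velocity M ?x t"
    have X: "?X \<in> tangent_space M (?x t)"
      using M.differentiable_curve_velocity(2) g unfolding good_at_def by blast
    \<comment> \<open>The time \<open>t\<close> is fixed before \<open>T\<close> is chosen, so no
      null set depends on the trivialization.\<close>
    have "vector_derivative (\<lambda>s. triv_matrix N T (q s)) (at t) = vertical_part M N nablaM nablaN T (q t) ?X"
      if T: "T \<in> trivs_at M N (q t)" for T
    proof -
      let ?A' = "vector_derivative (\<lambda>s. triv_matrix N T (q s)) (at t)" and ?V = "vertical_part M N nablaM nablaN T (q t) ?X"
      note fT = triv_frames[OF T]
      have A': "((\<lambda>s. triv_matrix N T (q s)) has_vector_derivative ?A') (at t)"
        using triv_matrix_differentiable[OF t g T] vector_derivative_works by blast
      define W where "W = ((\<chi> i k. M.frame_coords (frame1 T) (?x t) (Z k t) $ i) :: ((real, 'n) vec, 'n) vec)"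
      have Wk: "column k W = M.frame_coords (frame1 T) (?x t) (Z k t)" for k
        by (simp add: W_def column_def vec_eq_iff)
      have "M.frame_vec (frame1 T) (?x t) (column k W) = Z k t" for k
        unfolding Wk by (rule M.frame_vec_frame_coords[OF fT(1,3)]) (use Zf[of k] a(7) in \<open>auto simp: field_along_def\<close>)
      then have "det W \<noteq> 0" using M.nondegenerate_frame_vec[OF fT(1,3), of W] nd[OF a(7)] by simp
      moreover have "(?A' - ?V) *v column k W = 0" for k
      proof -
        obtain c where c: "c \<in> charts_at M (?x t)" "(\<lambda>s. Z k s c) differentiable (at t)" using a by blast
        obtain w where w: "cov_deriv M nablaM ?x (Z k) t = M.frame_vec (frame1 T) (?x t) w"
          "cov_deriv N nablaN ?y (\<lambda>s. qmap (q s) (Z k s)) t = N.frame_vec (frame2 T) (?y t)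
            (triv_matrix N T (q t) *v w + (?A' - ?V) *v M.frame_coords (frame1 T) (?x t) (Z k t))"
          by (rule cov_deriv_rolling[OF t g T A' vel Zf c]) blast
        have "w = 0"
          using w(1) a(1,7) M.frame_vec_inject[OF fT(1,3), of w 0] by (simp add: M.frame_vec_0)
        then have "N.frame_vec (frame2 T) (?y t) ((?A' - ?V) *v column k W) = 0"
          using w(2) a(2,7) by (simp add: Wk)
        then show ?thesis
          using N.frame_vec_inject[OF fT(2,4), of "(?A' - ?V) *v column k W" 0] by (simp add: N.frame_vec_0)
      qed
      ultimately have "?A' - ?V = 0" by (rule matrix_eq_if_columns)
      then show ?thesis by simp
    qed
    then have "config_velocity M N q t = (\<lambda>T\<in>trivs_at M N (q t). (?X, qmap (q t) ?X, vertical_part M N nablaM nablaN T (q t) ?X))"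
      unfolding config_velocity_def by (intro restrict_ext) (simp add: vel)
    then show "config_velocity M N q t \<in> rolling_distribution M N nablaM nablaN (q t)"
      unfolding rolling_distribution_def using X by blast
  qed
qed

end

end

theorem proposition3:
  fixes M :: "('a::{t2_space, second_countable_topology}, 'n::{finite, linorder}) manifold"
    and N :: "('b::{t2_space, second_countable_topology}, 'n) manifold"
    and nablaM :: "('a, 'n) connection" and nablaN :: "('b, 'n) connection"
    and \<tau> :: real and q :: "real \<Rightarrow> ('a, 'b, 'n) config"
  assumes "oriented_riemannian_manifold M" and "oriented_riemannian_manifold N"
    and "connected (UNIV :: 'a set)" and "connected (UNIV :: 'b set)"
    and "levi_civita M nablaM" and "levi_civita N nablaN"
    and "\<tau> > 0"
  shows "intrinsic_rolling M N nablaM nablaN \<tau> q \<longleftrightarrow>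
    horizontal_curve M N (rolling_distribution M N nablaM nablaN) \<tau> q"
proof -
  have "oriented_smooth_manifold M" "riemannian_metric M" "oriented_smooth_manifold N" "riemannian_metric N"
    using assms(1,2) by (simp_all only: oriented_riemannian_manifold_def)
  then interpret rolling_pair M nablaM N nablaN
    using assms(5,6) by unfold_locales
  show ?thesis
  proof
    assume r: "intrinsic_rolling M N nablaM nablaN \<tau> q"
    then have ac: "ac_config_curve M N \<tau> q" by (simp only: intrinsic_rolling_def)
    show "horizontal_curve M N (rolling_distribution M N nablaM nablaN) \<tau> q"
      unfolding horizontal_curve_def by (rule conjI[OF ac rolling_imp_horizontal[OF ac assms(7) r]])
  next
    assume "horizontal_curve M N (rolling_distribution M N nablaM nablaN) \<tau> q"
    then have "ac_config_curve M N \<tau> q"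
      "AE t\<in>{0..\<tau>} in lebesgue. config_velocity M N q t \<in> rolling_distribution M N nablaM nablaN (q t)"
      by (simp_all only: horizontal_curve_def)
    then show "intrinsic_rolling M N nablaM nablaN \<tau> q"
      by (rule horizontal_imp_rolling[OF _ assms(7)])
  qed
qed

end
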